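(* Let $n<N$ be positive integers and let $A=[a_1,\dots,a_N]\in\mathbb{C}^{n\times N}$ be a random matrix whose entries are i.i.d. complex Gaussian random variables distributed as $N(0,1)+iN(0,1)$. Let $x_0\in\mathbb{C}^n$ be nonzero, $y=A^*x_0$ and $b=|y|$ (entrywise modulus, $b(j)=|a_j^*x_0|$). Let $I\subset\{1,\dots,N\}$ with complement $I_c$ be such that $b(i)\le b(j)$ for all $i\in I$, $j\in I_c$, let $A_I$ be the $n\times|I|$ submatrix of $A$ with columns $\{a_i\}_{i\in I}$, and let \[ x_{\rm null}\in\arg\min\{\|A_I^*x\|^2: x\in\mathbb{C}^n,\ \|x\|=\|x_0\|\}. \] Suppose \[ \sigma:=\frac{|I|}{N}<1,\qquad \nu:=\frac{n}{|I|}<1 . \] Then for any $\epsilon\in(0,1)$, $\delta>0$ and $t\in(0,\nu^{-1/2}-1)$ the error bound \[ \|x_0x_0^*-x_{\rm null}x_{\rm null}^*\|^2\le\left(\left(\frac{2+t}{1-\epsilon}\right)\sigma+\epsilon\left(-2\ln(1-\sigma)+\delta\right)\right)\frac{2\|x_0\|^4}{\left(1-(1+t)\sqrt{\nu}\right)^2} \] holds with probability at least \[ 1-2\exp\left(-N\delta^2e^{-\delta}|1-\sigma|^2/2\right)-\exp\left(-2\lfloor|I|\epsilon\rfloor^2/N\right)-Q, \] where $Q$ has the asymptotic upper bound \[ 2\exp\left\{-c\min\left[\frac{e^2t^2}{16}\left(\ln\sigma^{-1}\right)^2\frac{|I|^2}{N},\ \frac{et}{4}|I|\ln\sigma^{-1}\right]\right\},\qquad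 \sigma\ll 1, \] with an absolute constant $c$.
   Context: $\|\cdot\|$ denotes the Euclidean norm on vectors and the Frobenius norm on matrices, so that $\|x_0x_0^*-x_{\rm null}x_{\rm null}^*\|^2=2\|x_0\|^4-2|x_0^*x_{\rm null}|^2$. $A^*$ denotes the conjugate transpose. The vector $x_{\rm null}$ (the "null vector") is a singular vector of $A_I^*$ for its least singular value, normalized to have norm $\|x_0\|$; it is defined only up to a global phase factor, and the error metric is independent of that phase. *)

theory Defs
  imports "HOL-Probability.Probability"
begin

definition cgauss :: "complex measure" where
  "cgauss = distr (density lborel std_normal_density \<Otimes>\<^sub>M density lborel std_normal_density)
                  borel (\<lambda>(a, b). Complex a b)"

text \<open>Random n x N matrix A with i.i.d. cgauss entries; entry (i,j) is A (i,j),
  i < n row index, j < N column index (column a_j).\<close>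
definition gauss_mat :: "nat \<Rightarrow> nat \<Rightarrow> (nat \<times> nat \<Rightarrow> complex) measure" where
  "gauss_mat n N = PiM ({..<n} \<times> {..<N}) (\<lambda>_. cgauss)"

definition vnorm :: "nat \<Rightarrow> (nat \<Rightarrow> complex) \<Rightarrow> real" where
  "vnorm n x = sqrt (\<Sum>i<n. (cmod (x i))^2)"

definition col_ip :: "(nat \<times> nat \<Rightarrow> complex) \<Rightarrow> nat \<Rightarrow> nat \<Rightarrow> (nat \<Rightarrow> complex) \<Rightarrow> complex" where
  "col_ip A n j x = (\<Sum>i<n. cnj (A (i, j)) * x i)"

definition sub_energy :: "(nat \<times> nat \<Rightarrow> complex) \<Rightarrow> nat \<Rightarrow> nat set \<Rightarrow> (nat \<Rightarrow> complex) \<Rightarrow> real" where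
  "sub_energy A n I x = (\<Sum>j\<in>I. (cmod (col_ip A n j x))^2)"

definition is_null_vec :: "(nat \<times> nat \<Rightarrow> complex) \<Rightarrow> nat \<Rightarrow> nat set \<Rightarrow> (nat \<Rightarrow> complex) \<Rightarrow> (nat \<Rightarrow> complex) \<Rightarrow> bool" where
  "is_null_vec A n I x0 x \<longleftrightarrow> vnorm n x = vnorm n x0 \<and>
     (\<forall>z. vnorm n z = vnorm n x0 \<longrightarrow> sub_energy A n I x \<le> sub_energy A n I z)"

definition outer_err :: "nat \<Rightarrow> (nat \<Rightarrow> complex) \<Rightarrow> (nat \<Rightarrow> complex) \<Rightarrow> real" where
  "outer_err n x0 x = (\<Sum>i<n. \<Sum>k<n. (cmod (x0 i * cnj (x0 k) - x i * cnj (x k)))^2)"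

end

theory Submission
  imports Defs
begin

text \<open>Write \<open>e z = \<parallel>A\<^sub>I\<^sup>* z\<parallel>\<^sup>2\<close>. By the variational characterization of a null vector, the error is at most
  \<open>2 \<parallel>x0\<parallel>\<^sup>2 e x0 / \<Lambda>\<close>, where \<open>\<Lambda>\<close> is a lower bound for \<open>e\<close> on the unit sphere orthogonal to \<open>x0\<close>.
  Rotating \<open>x0\<close> to the first axis makes \<open>I\<close> a function of the first row of \<open>A\<close>, and \<open>\<Lambda>\<close> the squared
  smallest singular value of a Gaussian array of size \<open>n - 1\<close> by \<open>m\<close> independent of that row.

  The claimed constants leave a factor close to 2 to spare on each of the two quantities, up to
  events of probability exponentially small in \<open>m\<close> and \<open>m - n + 1\<close>. For \<open>e x0\<close> a Chernoff bound on
  the number of small moduli suffices. For the singular value, let \<open>u\<close> be an independent Gaussian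
  vector in \<open>\<complex>\<^sup>p\<close>, \<open>p = n - 1\<close>, and \<open>W\<close> the Wishart matrix. If the least eigenvalue \<open>\<lambda>\<close> is small then
  \<open>u\<^sup>* W\<^sup>-\<^sup>1 u \<ge> \<bar>\<langle>u, z\<rangle>\<bar>\<^sup>2 / \<lambda>\<close> is large with probability at least \<open>exp (- r)\<close>, whereas for every fixed \<open>u\<close>
  the ratio \<open>\<bar>u\<bar>\<^sup>2 / u\<^sup>* W\<^sup>-\<^sup>1 u\<close> is the squared distance of a Gaussian vector in \<open>\<complex>\<^sup>m\<close> to the span of
  \<open>p - 1\<close> others. Comparing exponential moments gives a bound that is sharp enough up to the hard edge.\<close>

section \<open>Rotation invariance of the Gaussian law\<close>

text \<open>The entries of \<open>A\<close> have second moment 2. For small \<sigma> the m smallest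
  squared moduli average about \<sigma>, so \<open>e x0\<close> is typically near \<sigma> m
  ||x0||^2, while the least squared singular value is near 2 (sqrt m - sqrt n)^2. The proof uses
  only \<open>e x0\<close> <= (22/10) \<sigma> m ||x0||^2, bounding every selected modulus by the
  largest, and \<Lambda> = (11/10) (sqrt m - sqrt (n - 1))^2. The quotient of the two constants is
  2, the coefficient of \<sigma> in the claim at t = \<epsilon> = 0; this ties 11/10 to 11/20. The
  delicate range is m close to n. In the probe argument the supremum over z stands inside the
  expectation, so no net and no union bound over z is paid near the edge. No union bound over the
  sets I is paid either, since the first row fixes I up to ties of probability zero. The failure
  probabilities exp (- m / 300) and exp (- (m - n + 1) / 100) are absorbed by the last two error
  terms; c = 10^-7 and \<sigma>0 = 1/2400 come from that comparison.\<close>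

abbreviation "stdn \<equiv> density lborel (\<lambda>x. ennreal (std_normal_density x))"

lemma prob_space_stdn: "prob_space stdn"
  by (rule prob_space_normal_density) simp

lemma sigma_finite_stdn: "sigma_finite_measure stdn"
  using prob_space_stdn by (simp add: prob_space_imp_sigma_finite)

lemma Complex_measurable: "(\<lambda>(a, b). Complex a b) \<in> borel_measurable (borel \<Otimes>\<^sub>M borel)"
proof -
  have "(\<lambda>(a, b). Complex a b) = (\<lambda>p. complex_of_real (fst p) + \<i> * complex_of_real (snd p))"
    by (auto simp: fun_eq_iff Complex_eq)
  then show ?thesis by simp
qed

lemma sets_cgauss [simp, measurable_cong]: "sets cgauss = sets borel"
  by (simp add: cgauss_def)

lemma space_cgauss [simp]: "space cgauss = UNIV"
  by (simp add: cgauss_def)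

lemma prob_space_cgauss: "prob_space cgauss"
proof -
  interpret a: prob_space stdn by (rule prob_space_stdn)
  interpret pair_prob_space stdn stdn ..
  have "(\<lambda>(a, b). Complex a b) \<in> stdn \<Otimes>\<^sub>M stdn \<rightarrow>\<^sub>M borel"
    using Complex_measurable by (simp cong: measurable_cong_sets)
  then show ?thesis
    unfolding cgauss_def by (rule prob_space_distr)
qed

lemma nn_integral_cgauss_stdn:
  assumes [measurable]: "f \<in> borel_measurable borel"
  shows "(\<integral>\<^sup>+z. f z \<partial>cgauss) = (\<integral>\<^sup>+x. \<integral>\<^sup>+y. f (Complex x y) \<partial>stdn \<partial>stdn)"
proof -
  interpret sigma_finite_measure stdn by (rule sigma_finite_stdn)
  have [measurable]: "(\<lambda>(a, b). Complex a b) \<in> stdn \<Otimes>\<^sub>M stdn \<rightarrow>\<^sub>M borel"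
    using Complex_measurable by (simp cong: measurable_cong_sets)
  have "(\<integral>\<^sup>+z. f z \<partial>cgauss) = (\<integral>\<^sup>+p. f (case p of (a, b) \<Rightarrow> Complex a b) \<partial>(stdn \<Otimes>\<^sub>M stdn))"
    unfolding cgauss_def by (subst nn_integral_distr) (simp_all)
  also have "\<dots> = (\<integral>\<^sup>+x. \<integral>\<^sup>+y. f (Complex x y) \<partial>stdn \<partial>stdn)"
    by (subst nn_integral_fst[symmetric]) simp_all
  finally show ?thesis .
qed

lemma nn_integral_stdn:
  assumes [measurable]: "f \<in> borel_measurable borel"
  shows "(\<integral>\<^sup>+x. f x \<partial>stdn) = (\<integral>\<^sup>+x. ennreal (std_normal_density x) * f x \<partial>lborel)"
  by (subst nn_integral_density) simp_all

lemma nn_integral_stdn_pair: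
  assumes [measurable]: "(\<lambda>(x, y). f x y) \<in> borel_measurable (borel \<Otimes>\<^sub>M borel)"
  shows "(\<integral>\<^sup>+x. \<integral>\<^sup>+y. f x y \<partial>stdn \<partial>stdn) =
    (\<integral>\<^sup>+x. \<integral>\<^sup>+y. ennreal (exp (- (x\<^sup>2 + y\<^sup>2) / 2) / (2 * pi)) * f x y \<partial>lborel \<partial>lborel)"
proof -
  interpret sigma_finite_measure stdn by (rule sigma_finite_stdn)
  have "(\<integral>\<^sup>+x. \<integral>\<^sup>+y. f x y \<partial>stdn \<partial>stdn) =
    (\<integral>\<^sup>+x. ennreal (std_normal_density x) * (\<integral>\<^sup>+y. ennreal (std_normal_density y) * f x y \<partial>lborel) \<partial>lborel)"
    by (subst nn_integral_density) (simp_all add: nn_integral_density)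
  also have "\<dots> = (\<integral>\<^sup>+x. \<integral>\<^sup>+y. ennreal (std_normal_density x) * (ennreal (std_normal_density y) * f x y) \<partial>lborel \<partial>lborel)"
    by (intro nn_integral_cong nn_integral_cmult[symmetric]) simp
  also have "\<dots> = (\<integral>\<^sup>+x. \<integral>\<^sup>+y. ennreal (exp (- (x\<^sup>2 + y\<^sup>2) / 2) / (2 * pi)) * f x y \<partial>lborel \<partial>lborel)"
  proof (intro nn_integral_cong)
    fix x y :: real
    have "std_normal_density x * std_normal_density y = exp (- (x\<^sup>2 + y\<^sup>2) / 2) / (2 * pi)"
      by (simp add: std_normal_density_def exp_add[symmetric] field_simps)
    then have "ennreal (std_normal_density x) * ennreal (std_normal_density y)
        = ennreal (exp (- (x\<^sup>2 + y\<^sup>2) / 2) / (2 * pi))"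
      by (simp add: ennreal_mult[symmetric])
    then show "ennreal (std_normal_density x) * (ennreal (std_normal_density y) * f x y)
        = ennreal (exp (- (x\<^sup>2 + y\<^sup>2) / 2) / (2 * pi)) * f x y"
      by (simp add: mult.assoc[symmetric])
  qed
  finally show ?thesis .
qed

lemma ennreal_mult_cancel:
  assumes "0 < c" "ennreal c * a = ennreal c * b" shows "a = b"
  using assms by (simp add: ennreal_mult_cancel_left)

text \<open>The rotation is a product of two one-variable affine substitutions, first in
  \<open>x\<close> with \<open>y\<close> fixed, then in \<open>y\<close> with the new
  \<open>x\<close> fixed; their Jacobian factors |c| cancel. For \<open>c = 0\<close> this
  factorization degenerates, and the map exchanges the variables up to signs.\<close>

lemma nn_integral_lborel_rotate:
  fixes c s :: real and g :: "real \<Rightarrow> real \<Rightarrow> ennreal"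
  assumes [measurable]: "(\<lambda>(x, y). g x y) \<in> borel_measurable (borel \<Otimes>\<^sub>M borel)"
    and cs: "c\<^sup>2 + s\<^sup>2 = 1"
  shows "(\<integral>\<^sup>+x. \<integral>\<^sup>+y. g (c * x + s * y) (c * y - s * x) \<partial>lborel \<partial>lborel)
       = (\<integral>\<^sup>+x. \<integral>\<^sup>+y. g x y \<partial>lborel \<partial>lborel)"
proof (cases "c = 0")
  case True
  then have s: "\<bar>s\<bar> = 1" using cs by (simp add: power2_eq_1_iff) (auto)
  have a: "(\<integral>\<^sup>+x. h x \<partial>lborel) = (\<integral>\<^sup>+x. h (t * x) \<partial>lborel)"
    if [measurable]: "h \<in> borel_measurable borel" and t: "\<bar>t\<bar> = 1" for h :: "real \<Rightarrow> ennreal" and t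
    using nn_integral_real_affine[of h t 0] t by auto
  have "(\<integral>\<^sup>+x. \<integral>\<^sup>+y. g (s * y) (- s * x) \<partial>lborel \<partial>lborel) = (\<integral>\<^sup>+x. \<integral>\<^sup>+y. g y (- s * x) \<partial>lborel \<partial>lborel)"
    using s by (intro nn_integral_cong a[symmetric]) auto
  also have "\<dots> = (\<integral>\<^sup>+x. \<integral>\<^sup>+y. g y x \<partial>lborel \<partial>lborel)"
    using s by (intro a[where t="-s", symmetric]) auto
  also have "\<dots> = (\<integral>\<^sup>+x. \<integral>\<^sup>+y. g x y \<partial>lborel \<partial>lborel)"
    by (rule lborel_pair.Fubini') simp
  finally show ?thesis using True by simp
next
  case False
  have "ennreal \<bar>c\<bar> * (\<integral>\<^sup>+x. \<integral>\<^sup>+y. g (c * x + s * y) (c * y - s * x) \<partial>lborel \<partial>lborel)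
      = ennreal \<bar>c\<bar> * (\<integral>\<^sup>+y. \<integral>\<^sup>+x. g (c * x + s * y) (c * y - s * x) \<partial>lborel \<partial>lborel)"
    by (subst lborel_pair.Fubini') simp_all
  also have "\<dots> = (\<integral>\<^sup>+y. ennreal \<bar>c\<bar> * (\<integral>\<^sup>+x. g (c * x + s * y) (c * y - s * x) \<partial>lborel) \<partial>lborel)"
    by (rule nn_integral_cmult[symmetric]) simp
  also have "\<dots> = (\<integral>\<^sup>+y. (\<integral>\<^sup>+x. g x ((y - s * x) / c) \<partial>lborel) \<partial>lborel)"
  proof (intro nn_integral_cong)
    fix y :: real
    have e: "(y - s * (c * x + s * y)) / c = c * y - s * x" for x
    proof -
      have "y = (c\<^sup>2 + s\<^sup>2) * y" by (simp add: cs)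
      then have "y - s * (c * x + s * y) = c * (c * y - s * x)" by algebra
      then show ?thesis using False by simp
    qed
    show "ennreal \<bar>c\<bar> * (\<integral>\<^sup>+x. g (c * x + s * y) (c * y - s * x) \<partial>lborel)
       = (\<integral>\<^sup>+x. g x ((y - s * x) / c) \<partial>lborel)"
    proof -
      have "(\<integral>\<^sup>+x. g x ((y - s * x) / c) \<partial>lborel)
        = ennreal \<bar>c\<bar> * (\<integral>\<^sup>+x. g (s * y + c * x) ((y - s * (s * y + c * x)) / c) \<partial>lborel)"
        using False by (intro nn_integral_real_affine) auto
      then show ?thesis by (simp only: add.commute[of "s * y" "c * _"] e)
    qed
  qed
  also have "\<dots> = (\<integral>\<^sup>+x. (\<integral>\<^sup>+y. g x ((y - s * x) / c) \<partial>lborel) \<partial>lborel)"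
    by (rule lborel_pair.Fubini') simp
  also have "\<dots> = (\<integral>\<^sup>+x. ennreal \<bar>c\<bar> * (\<integral>\<^sup>+y. g x y \<partial>lborel) \<partial>lborel)"
  proof (intro nn_integral_cong)
    fix x :: real
    show "(\<integral>\<^sup>+y. g x ((y - s * x) / c) \<partial>lborel) = ennreal \<bar>c\<bar> * (\<integral>\<^sup>+y. g x y \<partial>lborel)"
      using False by (subst nn_integral_real_affine[of "\<lambda>y. g x ((y - s * x) / c)" c "s * x"]) simp_all
  qed
  also have "\<dots> = ennreal \<bar>c\<bar> * (\<integral>\<^sup>+x. (\<integral>\<^sup>+y. g x y \<partial>lborel) \<partial>lborel)"
    by (rule nn_integral_cmult) simp
  finally show ?thesis
    by (rule ennreal_mult_cancel[rotated]) (use False in simp)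
qed

lemma nn_integral_stdn_rotate:
  fixes c s :: real and f :: "real \<Rightarrow> real \<Rightarrow> ennreal"
  assumes [measurable]: "(\<lambda>(x, y). f x y) \<in> borel_measurable (borel \<Otimes>\<^sub>M borel)"
    and cs: "c\<^sup>2 + s\<^sup>2 = 1"
  shows "(\<integral>\<^sup>+x. \<integral>\<^sup>+y. f (c * x + s * y) (c * y - s * x) \<partial>stdn \<partial>stdn)
       = (\<integral>\<^sup>+x. \<integral>\<^sup>+y. f x y \<partial>stdn \<partial>stdn)"
proof -
  have e: "(c * x + s * y)\<^sup>2 + (c * y - s * x)\<^sup>2 = x\<^sup>2 + y\<^sup>2" for x y
  proof -
    have "(c * x + s * y)\<^sup>2 + (c * y - s * x)\<^sup>2 = (c\<^sup>2 + s\<^sup>2) * (x\<^sup>2 + y\<^sup>2)" by algebra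
    then show ?thesis by (simp add: cs)
  qed
  have "(\<integral>\<^sup>+x. \<integral>\<^sup>+y. f (c * x + s * y) (c * y - s * x) \<partial>stdn \<partial>stdn) =
    (\<integral>\<^sup>+x. \<integral>\<^sup>+y. ennreal (exp (- (x\<^sup>2 + y\<^sup>2) / 2) / (2 * pi)) * f (c * x + s * y) (c * y - s * x) \<partial>lborel \<partial>lborel)"
    by (rule nn_integral_stdn_pair) simp
  also have "\<dots> = (\<integral>\<^sup>+x. \<integral>\<^sup>+y. (\<lambda>x y. ennreal (exp (- (x\<^sup>2 + y\<^sup>2) / 2) / (2 * pi)) * f x y)
      (c * x + s * y) (c * y - s * x) \<partial>lborel \<partial>lborel)"
    by (simp only: e)
  also have "\<dots> = (\<integral>\<^sup>+x. \<integral>\<^sup>+y. ennreal (exp (- (x\<^sup>2 + y\<^sup>2) / 2) / (2 * pi)) * f x y \<partial>lborel \<partial>lborel)"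
    by (rule nn_integral_lborel_rotate[OF _ cs]) simp
  also have "\<dots> = (\<integral>\<^sup>+x. \<integral>\<^sup>+y. f x y \<partial>stdn \<partial>stdn)"
    by (rule nn_integral_stdn_pair[symmetric]) simp
  finally show ?thesis .
qed

lemma measurable_Complex[measurable]:
  assumes [measurable]: "f \<in> borel_measurable M" "g \<in> borel_measurable M"
  shows "(\<lambda>x. Complex (f x) (g x)) \<in> borel_measurable M"
  by (simp add: Complex_eq)

lemma nn_integral_cgauss_cis:
  assumes [measurable]: "f \<in> borel_measurable borel" and u: "cmod u = 1"
  shows "(\<integral>\<^sup>+z. f (u * z) \<partial>cgauss) = (\<integral>\<^sup>+z. f z \<partial>cgauss)"
proof -
  have "(Re u)\<^sup>2 + (- Im u)\<^sup>2 = 1" using u by (simp add: cmod_def)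
  moreover have "u * Complex x y = Complex (Re u * x + (- Im u) * y) (Re u * y - (- Im u) * x)" for x y
    by (simp add: complex_eq_iff)
  ultimately show ?thesis
    using nn_integral_stdn_rotate[of "\<lambda>x y. f (Complex x y)" "Re u" "- Im u"]
    by (simp add: nn_integral_cgauss_stdn)
qed

text \<open>A real rotation of (z, w) rotates the pair of real parts and the pair of imaginary parts
  by the same angle. Hence the middle two of the four real integrals are swapped, and the real
  rotation is applied to each pair.\<close>

lemma nn_integral_cgauss_rotate:
  fixes c s :: real and f :: "complex \<Rightarrow> complex \<Rightarrow> ennreal"
  assumes [measurable]: "(\<lambda>(x, y). f x y) \<in> borel_measurable (borel \<Otimes>\<^sub>M borel)"
    and cs: "c\<^sup>2 + s\<^sup>2 = 1"
  shows "(\<integral>\<^sup>+z. \<integral>\<^sup>+w. f (c * z + s * w) (c * w - s * z) \<partial>cgauss \<partial>cgauss)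
       = (\<integral>\<^sup>+z. \<integral>\<^sup>+w. f z w \<partial>cgauss \<partial>cgauss)"
proof -
  interpret sn: sigma_finite_measure stdn by (rule sigma_finite_stdn)
  interpret pair_sigma_finite stdn stdn ..
  have exp: "(\<integral>\<^sup>+z. \<integral>\<^sup>+w. h z w \<partial>cgauss \<partial>cgauss)
      = (\<integral>\<^sup>+a. \<integral>\<^sup>+b. \<integral>\<^sup>+x. \<integral>\<^sup>+y. h (Complex a b) (Complex x y) \<partial>stdn \<partial>stdn \<partial>stdn \<partial>stdn)"
    if [measurable]: "(\<lambda>(x, y). h x y) \<in> borel_measurable (borel \<Otimes>\<^sub>M borel)" for h
  proof -
    interpret cg: prob_space cgauss by (rule prob_space_cgauss)
    have m: "(\<lambda>z. \<integral>\<^sup>+w. h z w \<partial>cgauss) \<in> borel_measurable borel"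
      by simp
    show ?thesis
      by (subst nn_integral_cgauss_stdn[OF m]) (intro nn_integral_cong nn_integral_cgauss_stdn, simp)
  qed
  have swap: "(\<integral>\<^sup>+a. \<integral>\<^sup>+b. \<integral>\<^sup>+x. \<integral>\<^sup>+y. k a b x y \<partial>stdn \<partial>stdn \<partial>stdn \<partial>stdn)
      = (\<integral>\<^sup>+a. \<integral>\<^sup>+x. \<integral>\<^sup>+b. \<integral>\<^sup>+y. k a b x y \<partial>stdn \<partial>stdn \<partial>stdn \<partial>stdn)"
    if [measurable]: "(\<lambda>(a, b, x, y). k a b x y) \<in> borel_measurable (borel \<Otimes>\<^sub>M borel \<Otimes>\<^sub>M borel \<Otimes>\<^sub>M borel)"
    for k :: "real \<Rightarrow> real \<Rightarrow> real \<Rightarrow> real \<Rightarrow> ennreal"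
  proof (rule nn_integral_cong)
    fix a :: real
    have "(\<lambda>p. k a (snd (fst p)) (fst (fst p)) (snd p)) =
        (\<lambda>(a, b, x, y). k a b x y) \<circ> (\<lambda>p. (a, snd (fst p), fst (fst p), snd p))"
      by (simp add: fun_eq_iff)
    also have "\<dots> \<in> borel_measurable ((borel \<Otimes>\<^sub>M borel) \<Otimes>\<^sub>M borel)"
      by (rule measurable_comp[OF _ that]) measurable
    finally have "(\<lambda>p. k a (snd (fst p)) (fst (fst p)) (snd p)) \<in> borel_measurable ((stdn \<Otimes>\<^sub>M stdn) \<Otimes>\<^sub>M stdn)"
      by (simp cong: measurable_cong_sets sets_pair_measure_cong)
    then have "(\<lambda>p. \<integral>\<^sup>+y. k a (snd p) (fst p) y \<partial>stdn) \<in> borel_measurable (stdn \<Otimes>\<^sub>M stdn)"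
      by (intro sn.borel_measurable_nn_integral) (simp add: split_beta')
    then have "(\<lambda>(x, b). \<integral>\<^sup>+y. k a b x y \<partial>stdn) \<in> borel_measurable (stdn \<Otimes>\<^sub>M stdn)"
      by (simp only: split_beta')
    then show "(\<integral>\<^sup>+b. \<integral>\<^sup>+x. \<integral>\<^sup>+y. k a b x y \<partial>stdn \<partial>stdn \<partial>stdn) = (\<integral>\<^sup>+x. \<integral>\<^sup>+b. \<integral>\<^sup>+y. k a b x y \<partial>stdn \<partial>stdn \<partial>stdn)"
      by (rule Fubini'[where f = "\<lambda>x b. \<integral>\<^sup>+y. k a b x y \<partial>stdn"])
  qed
  have C: "complex_of_real c * Complex a b + complex_of_real s * Complex x y = Complex (c * a + s * x) (c * b + s * y)"
    "complex_of_real c * Complex x y - complex_of_real s * Complex a b = Complex (c * x - s * a) (c * y - s * b)" for a b x y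
    by (simp_all add: complex_eq_iff)
  have "(\<integral>\<^sup>+z. \<integral>\<^sup>+w. f (c * z + s * w) (c * w - s * z) \<partial>cgauss \<partial>cgauss)
     = (\<integral>\<^sup>+a. \<integral>\<^sup>+b. \<integral>\<^sup>+x. \<integral>\<^sup>+y. f (Complex (c * a + s * x) (c * b + s * y)) (Complex (c * x - s * a) (c * y - s * b))
        \<partial>stdn \<partial>stdn \<partial>stdn \<partial>stdn)"
    by (rule trans[OF exp]) (simp_all only: C, measurable)
  also have "\<dots> = (\<integral>\<^sup>+a. \<integral>\<^sup>+x. \<integral>\<^sup>+b. \<integral>\<^sup>+y. f (Complex (c * a + s * x) (c * b + s * y)) (Complex (c * x - s * a) (c * y - s * b))
        \<partial>stdn \<partial>stdn \<partial>stdn \<partial>stdn)"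
    by (rule swap) measurable
  also have "\<dots> = (\<integral>\<^sup>+a. \<integral>\<^sup>+x. \<integral>\<^sup>+b. \<integral>\<^sup>+y. f (Complex (c * a + s * x) b) (Complex (c * x - s * a) y)
        \<partial>stdn \<partial>stdn \<partial>stdn \<partial>stdn)"
    by (intro nn_integral_cong nn_integral_stdn_rotate[OF _ cs]) measurable
  also have "\<dots> = (\<integral>\<^sup>+a. \<integral>\<^sup>+x. \<integral>\<^sup>+b. \<integral>\<^sup>+y. f (Complex a b) (Complex x y)
        \<partial>stdn \<partial>stdn \<partial>stdn \<partial>stdn)"
    by (rule nn_integral_stdn_rotate[OF _ cs, where f = "\<lambda>a x. \<integral>\<^sup>+b. \<integral>\<^sup>+y. f (Complex a b) (Complex x y) \<partial>stdn \<partial>stdn"]) measurable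
  also have "\<dots> = (\<integral>\<^sup>+a. \<integral>\<^sup>+b. \<integral>\<^sup>+x. \<integral>\<^sup>+y. f (Complex a b) (Complex x y)
        \<partial>stdn \<partial>stdn \<partial>stdn \<partial>stdn)"
    by (rule swap[symmetric]) measurable
  also have "\<dots> = (\<integral>\<^sup>+z. \<integral>\<^sup>+w. f z w \<partial>cgauss \<partial>cgauss)"
    by (rule exp[symmetric]) measurable
  finally show ?thesis .
qed

section \<open>Modulus of a complex Gaussian variable\<close>

text \<open>The factor |x| is the Jacobian of the substitution y = x s in the planar integral; with
  it the Gaussian factor has an elementary antiderivative. The half-lines x >= sqrt (2 r) and x <= -
  sqrt (2 r) contribute equally.\<close>

lemma nn_integral_radial_line:
  fixes r :: real
  assumes r: "0 \<le> r"
  shows "(\<integral>\<^sup>+x. ennreal (\<bar>x\<bar> * (exp (- x\<^sup>2 / 2) / (2 * pi))) * indicator {w. 2 * r \<le> w\<^sup>2} x \<partial>lborel) = ennreal (exp (- r) / pi)"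
proof -
  define a where "a = sqrt (2 * r)"
  have a: "0 \<le> a" "a\<^sup>2 = 2 * r" using r by (auto simp: a_def)
  let ?f = "\<lambda>x::real. x * (exp (- x\<^sup>2 / 2) / (2 * pi))"
  let ?I = "\<integral>\<^sup>+x. ennreal (?f x) * indicator {a..} x \<partial>lborel"
  have lim: "((\<lambda>x::real. - exp (- x\<^sup>2 / 2) / (2 * pi)) \<longlongrightarrow> - 0 / (2 * pi)) at_top"
  proof -
    have "filterlim (\<lambda>x::real. 1 / 2 * x\<^sup>2) at_top at_top"
      by (rule filterlim_tendsto_pos_mult_at_top[OF tendsto_const])
        (auto intro!: filterlim_pow_at_top filterlim_ident)
    then show ?thesis
      by (intro tendsto_intros filterlim_compose[OF exp_at_bot]) (simp_all add: filterlim_uminus_at_bot)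
  qed
  have I: "?I = ennreal (0 - (- exp (- a\<^sup>2 / 2) / (2 * pi)))"
    using a lim by (intro nn_integral_FTC_atLeast) (auto intro!: derivative_eq_intros simp: field_simps)
  have split: "{w. 2 * r \<le> w\<^sup>2} = {a..} \<union> {..-a}"
  proof -
    have "(2 * r \<le> w\<^sup>2) = (a \<le> \<bar>w\<bar>)" for w
      using a abs_le_square_iff[of a w] by simp
    moreover have "(a \<le> \<bar>w\<bar>) = (a \<le> w \<or> w \<le> - a)" for w by arith
    ultimately show ?thesis by (simp only: set_eq_iff mem_Collect_eq Un_iff atLeast_iff atMost_iff) simp
  qed
  have "(\<integral>\<^sup>+x. ennreal (\<bar>x\<bar> * (exp (- x\<^sup>2 / 2) / (2 * pi))) * indicator {w. 2 * r \<le> w\<^sup>2} x \<partial>lborel)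
    = (\<integral>\<^sup>+x. ennreal (?f x) * indicator {a..} x + ennreal (?f (- x)) * indicator {a..} (- x) \<partial>lborel)"
    unfolding split using a(1) by (intro nn_integral_cong) (auto split: split_indicator simp: ennreal_neg)
  also have "\<dots> = ?I + (\<integral>\<^sup>+x. ennreal (?f (- x)) * indicator {a..} (- x) \<partial>lborel)"
    by (rule nn_integral_add) measurable
  also have "(\<integral>\<^sup>+x. ennreal (?f (- x)) * indicator {a..} (- x) \<partial>lborel) = ?I"
    by (subst nn_integral_real_affine[where c="-1" and t=0 and f="\<lambda>x. ennreal (?f x) * indicator {a..} x"]) simp_all
  also have "?I + ?I = ennreal (exp (- r) / pi)"
    unfolding I a(2) by (subst ennreal_plus[symmetric]) (auto simp: field_simps)
  finally show ?thesis .
qed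

text \<open>Integrating along lines of slope s, by y = x s, replaces polar coordinates. The radial
  part gives exp (- r) / pi, and the angular part remains as an unevaluated integral over s that is
  the same for all r.\<close>

lemma nn_integral_planar_tail:
  fixes r :: real
  assumes r: "0 \<le> r"
  shows "(\<integral>\<^sup>+x. \<integral>\<^sup>+y. ennreal (exp (- (x\<^sup>2 + y\<^sup>2) / 2) / (2 * pi)) * indicator {w. 2 * r \<le> w} (x\<^sup>2 + y\<^sup>2) \<partial>lborel \<partial>lborel)
    = ennreal (exp (- r) / pi) * (\<integral>\<^sup>+s. ennreal (1 / (1 + s\<^sup>2)) \<partial>lborel)"
proof -
  define h where "h = (\<lambda>w::real. ennreal (exp (- w / 2) / (2 * pi)) * indicator {w. 2 * r \<le> w} w)"
  have [measurable]: "h \<in> borel_measurable borel" unfolding h_def by measurable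
  have "(\<integral>\<^sup>+x. \<integral>\<^sup>+y. h (x\<^sup>2 + y\<^sup>2) \<partial>lborel \<partial>lborel)
      = (\<integral>\<^sup>+x. \<integral>\<^sup>+s. ennreal \<bar>x\<bar> * h (x\<^sup>2 * (1 + s\<^sup>2)) \<partial>lborel \<partial>lborel)"
  proof (rule nn_integral_cong_AE, rule AE_mp[OF AE_lborel_singleton[of 0]], rule AE_I2, rule impI)
    fix x :: real assume x: "x \<noteq> 0"
    have "(\<integral>\<^sup>+y. h (x\<^sup>2 + y\<^sup>2) \<partial>lborel) = ennreal \<bar>x\<bar> * (\<integral>\<^sup>+s. h (x\<^sup>2 + (0 + x * s)\<^sup>2) \<partial>lborel)"
      by (rule nn_integral_real_affine) (use x in auto)
    also have "\<dots> = ennreal \<bar>x\<bar> * (\<integral>\<^sup>+s. h (x\<^sup>2 * (1 + s\<^sup>2)) \<partial>lborel)"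
      by (simp add: power_mult_distrib distrib_left)
    also have "\<dots> = (\<integral>\<^sup>+s. ennreal \<bar>x\<bar> * h (x\<^sup>2 * (1 + s\<^sup>2)) \<partial>lborel)"
      by (rule nn_integral_cmult[symmetric]) measurable
    finally show "(\<integral>\<^sup>+y. h (x\<^sup>2 + y\<^sup>2) \<partial>lborel) = (\<integral>\<^sup>+s. ennreal \<bar>x\<bar> * h (x\<^sup>2 * (1 + s\<^sup>2)) \<partial>lborel)" .
  qed
  also have "\<dots> = (\<integral>\<^sup>+s. \<integral>\<^sup>+x. ennreal \<bar>x\<bar> * h (x\<^sup>2 * (1 + s\<^sup>2)) \<partial>lborel \<partial>lborel)"
    by (rule lborel_pair.Fubini'[symmetric]) measurable
  also have "\<dots> = (\<integral>\<^sup>+s. ennreal (1 / (1 + s\<^sup>2)) * ennreal (exp (- r) / pi) \<partial>lborel)"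
  proof (rule nn_integral_cong)
    fix s :: real
    define k where "k = sqrt (1 + s\<^sup>2)"
    have k2: "k\<^sup>2 = 1 + s\<^sup>2" by (simp add: k_def)
    have k: "0 < k" by (simp add: k_def add_pos_nonneg)
    have "(\<integral>\<^sup>+x. ennreal \<bar>x\<bar> * h (x\<^sup>2 * (1 + s\<^sup>2)) \<partial>lborel)
       = ennreal \<bar>1 / k\<bar> * (\<integral>\<^sup>+x. ennreal \<bar>0 + 1 / k * x\<bar> * h ((0 + 1 / k * x)\<^sup>2 * (1 + s\<^sup>2)) \<partial>lborel)"
      by (rule nn_integral_real_affine) (use k in \<open>auto\<close>)
    also have "\<dots> = ennreal (1 / k) * (\<integral>\<^sup>+x. ennreal (1 / k) * (ennreal (\<bar>x\<bar> * (exp (- x\<^sup>2 / 2) / (2 * pi))) * indicator {w. 2 * r \<le> w\<^sup>2} x) \<partial>lborel)"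
    proof -
      have "ennreal \<bar>0 + 1 / k * x\<bar> * h ((0 + 1 / k * x)\<^sup>2 * (1 + s\<^sup>2)) =
        ennreal (1 / k) * (ennreal (\<bar>x\<bar> * (exp (- x\<^sup>2 / 2) / (2 * pi))) * indicator {w. 2 * r \<le> w\<^sup>2} x)" for x
      proof -
        have "(0 + 1 / k * x)\<^sup>2 * (1 + s\<^sup>2) = x\<^sup>2"
          using k by (simp add: k2[symmetric] power_divide)
        moreover have "ennreal \<bar>0 + 1 / k * x\<bar> * ennreal (exp (- x\<^sup>2 / 2) / (2 * pi))
           = ennreal (1 / k) * ennreal (\<bar>x\<bar> * (exp (- x\<^sup>2 / 2) / (2 * pi)))"
          using k by (simp add: ennreal_mult[symmetric] abs_divide)
        ultimately show ?thesis
          by (simp add: h_def mult.assoc[symmetric] indicator_def)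
      qed
      then show ?thesis using k by simp
    qed
    also have "\<dots> = ennreal (1 / k) * (ennreal (1 / k) * ennreal (exp (- r) / pi))"
      by (subst nn_integral_cmult) (measurable, simp only: nn_integral_radial_line[OF r])
    also have "\<dots> = ennreal (1 / (1 + s\<^sup>2)) * ennreal (exp (- r) / pi)"
      using k by (simp add: mult.assoc[symmetric] ennreal_mult[symmetric] k2[symmetric] power2_eq_square[of k])
    finally show "(\<integral>\<^sup>+x. ennreal \<bar>x\<bar> * h (x\<^sup>2 * (1 + s\<^sup>2)) \<partial>lborel) = ennreal (1 / (1 + s\<^sup>2)) * ennreal (exp (- r) / pi)" .
  qed
  also have "\<dots> = ennreal (exp (- r) / pi) * (\<integral>\<^sup>+s. ennreal (1 / (1 + s\<^sup>2)) \<partial>lborel)"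
    by (subst nn_integral_multc) (measurable, simp add: mult.commute)
  finally show ?thesis unfolding h_def .
qed

text \<open>That is, |z|^2 / 2 has the exponential law of mean 1. The tail formula leaves one
  unknown constant, the angular integral; the total mass 1, which is the case r = 0, determines
  it.\<close>

lemma emeasure_cgauss_ge:
  fixes r :: real
  assumes r: "0 \<le> r"
  shows "emeasure cgauss {z. 2 * r \<le> (cmod z)\<^sup>2} = ennreal (exp (- r))"
proof -
  have tail: "emeasure cgauss {z. 2 * r \<le> (cmod z)\<^sup>2} = ennreal (exp (- r) / pi) * (\<integral>\<^sup>+s. ennreal (1 / (1 + s\<^sup>2)) \<partial>lborel)"
    if r: "0 \<le> r" for r :: real
  proof -
    have "emeasure cgauss {z. 2 * r \<le> (cmod z)\<^sup>2} = (\<integral>\<^sup>+z. indicator {z. 2 * r \<le> (cmod z)\<^sup>2} z \<partial>cgauss)"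
      by simp
    also have "\<dots> = (\<integral>\<^sup>+x. \<integral>\<^sup>+y. indicator {z. 2 * r \<le> (cmod z)\<^sup>2} (Complex x y) \<partial>stdn \<partial>stdn)"
      by (rule nn_integral_cgauss_stdn) measurable
    also have "\<dots> = (\<integral>\<^sup>+x. \<integral>\<^sup>+y. ennreal (exp (- (x\<^sup>2 + y\<^sup>2) / 2) / (2 * pi)) * indicator {z. 2 * r \<le> (cmod z)\<^sup>2} (Complex x y) \<partial>lborel \<partial>lborel)"
      by (rule nn_integral_stdn_pair) measurable
    also have "\<dots> = (\<integral>\<^sup>+x. \<integral>\<^sup>+y. ennreal (exp (- (x\<^sup>2 + y\<^sup>2) / 2) / (2 * pi)) * indicator {w. 2 * r \<le> w} (x\<^sup>2 + y\<^sup>2) \<partial>lborel \<partial>lborel)"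
      by (intro nn_integral_cong) (simp add: indicator_def cmod_def)
    finally show ?thesis using nn_integral_planar_tail[OF r] by simp
  qed
  have "emeasure cgauss (space cgauss) = 1"
    by (rule prob_space.emeasure_space_1[OF prob_space_cgauss])
  then have one: "ennreal (1 / pi) * (\<integral>\<^sup>+s. ennreal (1 / (1 + s\<^sup>2)) \<partial>lborel) = 1"
    using tail[of 0] by simp
  have "ennreal (exp (- r) / pi) = ennreal (exp (- r)) * ennreal (1 / pi)"
    by (simp add: ennreal_mult[symmetric])
  then show ?thesis
    using tail[OF r] one by (simp add: mult.assoc)
qed

text \<open>Up to the factor s = 1 / sqrt (1 + b) the tilted density is the normal density of
  standard deviation s. Negative b > -1 is included because the probe vector needs positive
  exponential moments.\<close>

lemma nn_integral_stdn_exp_sq: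
  fixes b :: real
  assumes b: "-1 < b"
  shows "(\<integral>\<^sup>+x. ennreal (exp (- b * x\<^sup>2 / 2)) \<partial>stdn) = ennreal (1 / sqrt (1 + b))"
proof -
  define s where "s = 1 / sqrt (1 + b)"
  have s: "0 < s" "s\<^sup>2 = 1 / (1 + b)" using b by (auto simp: s_def power_divide)
  have e: "std_normal_density x * exp (- (b * x\<^sup>2 / 2)) = s * normal_density 0 s x" for x
  proof -
    have "exp (- x\<^sup>2 / 2) * exp (- (b * x\<^sup>2 / 2)) = exp (- x\<^sup>2 / (2 * s\<^sup>2))"
      unfolding s(2) by (simp add: exp_add[symmetric] field_simps)
    moreover have "s / sqrt (2 * pi * s\<^sup>2) = 1 / sqrt (2 * pi)"
      using s(1) by (simp add: real_sqrt_mult)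
    ultimately show ?thesis
      by (simp add: normal_density_def field_simps)
  qed
  have "(\<integral>\<^sup>+x. ennreal (exp (- b * x\<^sup>2 / 2)) \<partial>stdn) = (\<integral>\<^sup>+x. ennreal s * ennreal (normal_density 0 s x) \<partial>lborel)"
    by (subst nn_integral_stdn) (measurable, simp add: ennreal_mult[symmetric] e less_imp_le[OF s(1)])
  also have "\<dots> = ennreal s * emeasure (density lborel (\<lambda>x. ennreal (normal_density 0 s x))) (space lborel)"
    by (subst nn_integral_cmult) (auto simp: emeasure_density)
  also have "\<dots> = ennreal s"
    using prob_space.emeasure_space_1[OF prob_space_normal_density[OF s(1), of 0]] by simp
  finally show ?thesis by (simp add: s_def)
qed

lemma nn_integral_cgauss_exp_sq:
  fixes b :: real
  assumes b: "-1 < b"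
  shows "(\<integral>\<^sup>+z. ennreal (exp (- b * (cmod z)\<^sup>2 / 2)) \<partial>cgauss) = ennreal (1 / (1 + b))"
proof -
  let ?g = "\<lambda>x. ennreal (exp (- b * x\<^sup>2 / 2))"
  have "(\<integral>\<^sup>+z. ennreal (exp (- b * (cmod z)\<^sup>2 / 2)) \<partial>cgauss)
      = (\<integral>\<^sup>+x. \<integral>\<^sup>+y. ennreal (exp (- b * (cmod (Complex x y))\<^sup>2 / 2)) \<partial>stdn \<partial>stdn)"
    by (rule nn_integral_cgauss_stdn) measurable
  also have "\<dots> = (\<integral>\<^sup>+x. \<integral>\<^sup>+y. ?g x * ?g y \<partial>stdn \<partial>stdn)"
    by (intro nn_integral_cong)
      (simp add: cmod_def ennreal_mult[symmetric] exp_add[symmetric] algebra_simps add_divide_distrib diff_divide_distrib)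
  also have "\<dots> = (\<integral>\<^sup>+x. ?g x * ennreal (1 / sqrt (1 + b)) \<partial>stdn)"
    by (intro nn_integral_cong, subst nn_integral_cmult) (measurable, simp only: nn_integral_stdn_exp_sq[OF b])
  also have "\<dots> = ennreal (1 / sqrt (1 + b)) * ennreal (1 / sqrt (1 + b))"
    by (subst nn_integral_multc) (measurable, simp only: nn_integral_stdn_exp_sq[OF b])
  also have "\<dots> = ennreal (1 / (1 + b))"
    using b by (simp add: ennreal_mult[symmetric])
  finally show ?thesis .
qed

section \<open>Rotations of Gaussian arrays\<close>

abbreviation gauss_PiM :: "'k set \<Rightarrow> ('k \<Rightarrow> complex) measure" where
  "gauss_PiM K \<equiv> PiM K (\<lambda>_. cgauss)"

lemma product_sigma_finite_cgauss: "product_sigma_finite (\<lambda>_. cgauss)"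
  by unfold_locales (rule sigma_finite_measure.sigma_finite_countable[OF prob_space_imp_sigma_finite[OF prob_space_cgauss]])

lemma product_prob_space_cgauss: "product_prob_space (\<lambda>_. cgauss)"
  by (intro product_prob_space.intro product_sigma_finite_cgauss product_prob_space_axioms.intro prob_space_cgauss)

lemma prob_space_gauss_PiM: "prob_space (gauss_PiM K)"
  by (rule prob_space_PiM) (rule prob_space_cgauss)

section \<open>Maps preserving the law of a Gaussian array\<close>

definition measure_preserving_map :: "'a measure \<Rightarrow> ('a \<Rightarrow> 'a) \<Rightarrow> bool" where
  "measure_preserving_map M T \<longleftrightarrow> T \<in> measurable M M \<and> distr M M T = M"

lemma measure_preserving_mapI:
  assumes [measurable]: "T \<in> measurable M M"
    and inv: "\<And>f. f \<in> borel_measurable M \<Longrightarrow> (\<integral>\<^sup>+x. f (T x) \<partial>M) = (\<integral>\<^sup>+x. f x \<partial>M)"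
  shows "measure_preserving_map M T"
  unfolding measure_preserving_map_def
proof (intro conjI measure_eqI)
  fix A assume "A \<in> sets (distr M M T)"
  then have A[measurable]: "A \<in> sets M" by simp
  have "emeasure (distr M M T) A = (\<integral>\<^sup>+x. indicator A x \<partial>distr M M T)" by simp
  also have "\<dots> = (\<integral>\<^sup>+x. indicator A (T x) \<partial>M)" by (rule nn_integral_distr) simp_all
  also have "\<dots> = emeasure M A" using inv[of "indicator A"] by simp
  finally show "emeasure (distr M M T) A = emeasure M A" .
qed simp_all

lemma measure_preserving_map_measurable: "measure_preserving_map M T \<Longrightarrow> T \<in> measurable M M"
  by (simp add: measure_preserving_map_def)

lemma measure_preserving_map_nn_integral:
  assumes "measure_preserving_map M T" "f \<in> borel_measurable M"
  shows "(\<integral>\<^sup>+x. f (T x) \<partial>M) = (\<integral>\<^sup>+x. f x \<partial>M)"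
  using assms nn_integral_distr[of T M M f] by (simp add: measure_preserving_map_def)

lemma measure_preserving_map_emeasure:
  assumes "measure_preserving_map M T" "A \<in> sets M"
  shows "emeasure M (T -` A \<inter> space M) = emeasure M A"
  using assms emeasure_distr[of T M M A] by (simp add: measure_preserving_map_def)

lemma measure_preserving_map_id: "measure_preserving_map M (\<lambda>x. x)"
  by (rule measure_preserving_mapI) auto

lemma measure_preserving_map_comp:
  assumes "measure_preserving_map M S" "measure_preserving_map M T"
  shows "measure_preserving_map M (\<lambda>x. S (T x))"
proof (rule measure_preserving_mapI)
  note [measurable] = assms[THEN measure_preserving_map_measurable]
  show "(\<lambda>x. S (T x)) \<in> measurable M M" by measurable
  fix f :: "'a \<Rightarrow> ennreal" assume [measurable]: "f \<in> borel_measurable M"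
  have "(\<integral>\<^sup>+x. f (S (T x)) \<partial>M) = (\<integral>\<^sup>+x. f (S x) \<partial>M)"
    using assms(2) by (rule measure_preserving_map_nn_integral[where f="\<lambda>x. f (S x)"]) measurable
  also have "\<dots> = (\<integral>\<^sup>+x. f x \<partial>M)"
    using assms(1) by (rule measure_preserving_map_nn_integral) measurable
  finally show "(\<integral>\<^sup>+x. f (S (T x)) \<partial>M) = (\<integral>\<^sup>+x. f x \<partial>M)" .
qed

lemma measurable_upd_gauss:
  assumes k: "k \<in> K" and [measurable]: "g \<in> borel_measurable (gauss_PiM K)"
  shows "(\<lambda>A. A(k := g A)) \<in> measurable (gauss_PiM K) (gauss_PiM K)"
proof (rule measurable_PiM_single')
  fix i assume [measurable]: "i \<in> K"
  show "(\<lambda>A. (A(k := g A)) i) \<in> measurable (gauss_PiM K) cgauss"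
    by (cases "i = k") (simp_all cong: measurable_cong_sets)
next
  show "(\<lambda>A. A(k := g A)) \<in> space (gauss_PiM K) \<rightarrow> (\<Pi>\<^sub>E i\<in>K. space cgauss)"
    using k by (auto simp: space_PiM PiE_def extensional_def)
qed

lemma gauss_PiM_phase:
  assumes K: "finite K" "k \<in> K" and u: "cmod u = 1"
  shows "measure_preserving_map (gauss_PiM K) (\<lambda>A. A(k := u * A k))"
proof (rule measure_preserving_mapI)
  interpret product_sigma_finite "\<lambda>_. cgauss" by (rule product_sigma_finite_cgauss)
  have [measurable]: "k \<in> K" by fact
  show [measurable]: "(\<lambda>A. A(k := u * A k)) \<in> measurable (gauss_PiM K) (gauss_PiM K)"
    by (rule measurable_upd_gauss) (use K in measurable)
  fix f :: "('a \<Rightarrow> complex) \<Rightarrow> ennreal" assume f[measurable]: "f \<in> borel_measurable (gauss_PiM K)"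
  define K' where "K' = K - {k}"
  have K': "K = insert k K'" "finite K'" "k \<notin> K'" using K by (auto simp: K'_def)
  have mz: "(\<lambda>z. f (x(k := z))) \<in> borel_measurable borel" if "x \<in> space (gauss_PiM K')" for x
  proof -
    have "(\<lambda>z. x(k := z)) \<in> measurable cgauss (gauss_PiM K)"
      unfolding K'(1) using that K'(3) by (rule measurable_component_update)
    from measurable_comp[OF this f] show ?thesis by (simp add: comp_def cong: measurable_cong_sets)
  qed
  have "(\<integral>\<^sup>+A. f (A(k := u * A k)) \<partial>gauss_PiM K) = (\<integral>\<^sup>+x. \<integral>\<^sup>+z. f (x(k := u * z)) \<partial>cgauss \<partial>gauss_PiM K')"
    using product_nn_integral_insert[OF K'(2,3), of "\<lambda>A. f (A(k := u * A k))"] unfolding K'(1)[symmetric] by simp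
  also have "\<dots> = (\<integral>\<^sup>+x. \<integral>\<^sup>+z. f (x(k := z)) \<partial>cgauss \<partial>gauss_PiM K')"
    by (rule nn_integral_cong) (rule nn_integral_cgauss_cis[OF mz u])
  also have "\<dots> = (\<integral>\<^sup>+A. f A \<partial>gauss_PiM K)"
    using product_nn_integral_insert[OF K'(2,3), of f] unfolding K'(1)[symmetric] by simp
  finally show "(\<integral>\<^sup>+A. f (A(k := u * A k)) \<partial>gauss_PiM K) = (\<integral>\<^sup>+A. f A \<partial>gauss_PiM K)" .
qed

lemma gauss_PiM_rotate:
  fixes c s :: real
  assumes K: "finite K" "k \<in> K" "l \<in> K" "k \<noteq> l" and cs: "c\<^sup>2 + s\<^sup>2 = 1"
  shows "measure_preserving_map (gauss_PiM K) (\<lambda>A. A(k := c * A k + s * A l, l := c * A l - s * A k))"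
    (is "measure_preserving_map _ ?T")
proof (rule measure_preserving_mapI)
  interpret product_sigma_finite "\<lambda>_. cgauss" by (rule product_sigma_finite_cgauss)
  have [measurable]: "k \<in> K" "l \<in> K" by fact+
  have "(\<lambda>A. (A(k := c * A k + s * A l, l := c * A l - s * A k)) i) \<in> measurable (gauss_PiM K) cgauss"
    if [measurable]: "i \<in> K" for i
    by (cases "i = l"; cases "i = k") (simp_all cong: measurable_cong_sets)
  then show [measurable]: "?T \<in> measurable (gauss_PiM K) (gauss_PiM K)"
    by (intro measurable_PiM_single') (use K in \<open>auto simp: space_PiM PiE_def extensional_def\<close>)
  fix f :: "('a \<Rightarrow> complex) \<Rightarrow> ennreal" assume f[measurable]: "f \<in> borel_measurable (gauss_PiM K)"
  define K' where "K' = K - {k, l}"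
  have K': "K = insert k (insert l K')" "finite K'" "l \<notin> K'" "k \<notin> insert l K'" "finite (insert l K')"
    using K by (auto simp: K'_def)
  have mz: "(\<lambda>(z, w). f (x(l := w, k := z))) \<in> borel_measurable (borel \<Otimes>\<^sub>M borel)" if x: "x \<in> space (gauss_PiM K')" for x
  proof -
    have "(\<lambda>p. x(l := snd p, k := fst p)) \<in> measurable (borel \<Otimes>\<^sub>M borel) (gauss_PiM K)"
    proof (rule measurable_PiM_single')
      fix i assume "i \<in> K"
      show "(\<lambda>p. (x(l := snd p, k := fst p)) i) \<in> measurable (borel \<Otimes>\<^sub>M borel) cgauss"
        by (cases "i = l"; cases "i = k") (simp_all cong: measurable_cong_sets)
    next
      show "(\<lambda>p. x(l := snd p, k := fst p)) \<in> space (borel \<Otimes>\<^sub>M borel) \<rightarrow> (\<Pi>\<^sub>E i\<in>K. space cgauss)"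
        using x unfolding K'(1) by (auto simp: space_PiM PiE_def extensional_def)
    qed
    from measurable_comp[OF this f] show ?thesis by (simp add: comp_def split_beta')
  qed
  have two: "(\<integral>\<^sup>+A. g A \<partial>gauss_PiM K) = (\<integral>\<^sup>+x. \<integral>\<^sup>+z. \<integral>\<^sup>+w. g (x(l := w, k := z)) \<partial>cgauss \<partial>cgauss \<partial>gauss_PiM K')"
    if g: "g \<in> borel_measurable (gauss_PiM K)" for g
  proof -
    note [measurable] = g[unfolded K'(1)]
    have "(\<integral>\<^sup>+A. g A \<partial>gauss_PiM K) = (\<integral>\<^sup>+z. \<integral>\<^sup>+x. g (x(k := z)) \<partial>gauss_PiM (insert l K') \<partial>cgauss)"
      unfolding K'(1) by (rule product_nn_integral_insert_rev[OF K'(5,4)]) measurable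
    also have "\<dots> = (\<integral>\<^sup>+z. \<integral>\<^sup>+x. \<integral>\<^sup>+w. g (x(l := w, k := z)) \<partial>cgauss \<partial>gauss_PiM K' \<partial>cgauss)"
    proof (rule nn_integral_cong)
      fix z
      have "(\<lambda>x. x(k := z)) \<in> measurable (gauss_PiM (insert l K')) (gauss_PiM (insert k (insert l K')))"
        by (rule measurable_fun_upd[where J="insert l K'"]) auto
      from measurable_comp[OF this g[unfolded K'(1)]]
      have "(\<lambda>x. g (x(k := z))) \<in> borel_measurable (gauss_PiM (insert l K'))"
        by (simp add: comp_def)
      then show "(\<integral>\<^sup>+x. g (x(k := z)) \<partial>gauss_PiM (insert l K')) = (\<integral>\<^sup>+x. \<integral>\<^sup>+w. g (x(l := w, k := z)) \<partial>cgauss \<partial>gauss_PiM K')"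
        by (rule product_nn_integral_insert[OF K'(2,3)])
    qed
    also have "\<dots> = (\<integral>\<^sup>+x. \<integral>\<^sup>+z. \<integral>\<^sup>+w. g (x(l := w, k := z)) \<partial>cgauss \<partial>cgauss \<partial>gauss_PiM K')"
    proof (rule pair_sigma_finite.Fubini')
      show "pair_sigma_finite (gauss_PiM K') cgauss"
        by (simp add: prob_space_imp_sigma_finite[OF prob_space_cgauss] pair_sigma_finite_def K'(2) sigma_finite)
      have "(\<lambda>q. (fst (fst q))(l := snd q, k := snd (fst q))) \<in>
         measurable ((gauss_PiM K' \<Otimes>\<^sub>M cgauss) \<Otimes>\<^sub>M cgauss) (gauss_PiM (insert k (insert l K')))"
      proof (rule measurable_PiM_single')
        fix i assume i: "i \<in> insert k (insert l K')"
        show "(\<lambda>q. ((fst (fst q))(l := snd q, k := snd (fst q))) i) \<in>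
           measurable ((gauss_PiM K' \<Otimes>\<^sub>M cgauss) \<Otimes>\<^sub>M cgauss) cgauss"
          using i by (cases "i = l"; cases "i = k") simp_all
      next
        show "(\<lambda>q. (fst (fst q))(l := snd q, k := snd (fst q))) \<in>
          space ((gauss_PiM K' \<Otimes>\<^sub>M cgauss) \<Otimes>\<^sub>M cgauss) \<rightarrow> (\<Pi>\<^sub>E i\<in>insert k (insert l K'). space cgauss)"
          by (auto simp: space_PiM PiE_def extensional_def space_pair_measure)
      qed
      from measurable_comp[OF this g[unfolded K'(1)]]
      have "(\<lambda>q. g ((fst (fst q))(l := snd q, k := snd (fst q)))) \<in> borel_measurable ((gauss_PiM K' \<Otimes>\<^sub>M cgauss) \<Otimes>\<^sub>M cgauss)"
        by (simp add: comp_def)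
      then have "(\<lambda>p. \<integral>\<^sup>+w. g ((fst p)(l := w, k := snd p)) \<partial>cgauss) \<in> borel_measurable (gauss_PiM K' \<Otimes>\<^sub>M cgauss)"
        by (intro sigma_finite_measure.borel_measurable_nn_integral[OF prob_space_imp_sigma_finite[OF prob_space_cgauss]]) (simp add: split_beta')
      then show "(\<lambda>(x, z). \<integral>\<^sup>+w. g (x(l := w, k := z)) \<partial>cgauss) \<in> borel_measurable (gauss_PiM K' \<Otimes>\<^sub>M cgauss)"
        by (simp only: split_beta')
    qed
    finally show ?thesis .
  qed
  have "(\<integral>\<^sup>+A. f (?T A) \<partial>gauss_PiM K) = (\<integral>\<^sup>+x. \<integral>\<^sup>+z. \<integral>\<^sup>+w. f (x(l := c * w - s * z, k := c * z + s * w)) \<partial>cgauss \<partial>cgauss \<partial>gauss_PiM K')"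
    using two[of "\<lambda>A. f (?T A)"] K(4) by (simp add: fun_upd_twist)
  also have "\<dots> = (\<integral>\<^sup>+x. \<integral>\<^sup>+z. \<integral>\<^sup>+w. f (x(l := w, k := z)) \<partial>cgauss \<partial>cgauss \<partial>gauss_PiM K')"
    by (rule nn_integral_cong) (rule nn_integral_cgauss_rotate[OF mz cs])
  also have "\<dots> = (\<integral>\<^sup>+A. f A \<partial>gauss_PiM K)"
    using two[OF f] by simp
  finally show "(\<integral>\<^sup>+A. f (?T A) \<partial>gauss_PiM K) = (\<integral>\<^sup>+A. f A \<partial>gauss_PiM K)" .
qed

text \<open>The embeddings \<open>e\<close> let one isometry of \<open>\<complex>\<^sup>L\<close> act on rows, on columns and on single
  vectors of a Gaussian array.\<close>
definition gauss_unitary :: "nat set \<Rightarrow> ((nat \<Rightarrow> complex) \<Rightarrow> (nat \<Rightarrow> complex)) \<Rightarrow> bool" where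
  "gauss_unitary L V \<longleftrightarrow>
     (\<forall>x y. (\<forall>i\<in>L. x i = y i) \<longrightarrow> (\<forall>i\<in>L. V x i = V y i)) \<and>
     (\<forall>x y a. \<forall>i\<in>L. V (\<lambda>j. x j + a * y j) i = V x i + a * V y i) \<and>
     (\<forall>x y. (\<Sum>i\<in>L. cnj (V x i) * V y i) = (\<Sum>i\<in>L. cnj (x i) * y i)) \<and>
     (\<forall>K (e :: nat \<Rightarrow> nat \<times> nat). finite K \<longrightarrow> inj_on e L \<longrightarrow> e ` L \<subseteq> K \<longrightarrow>
        (\<exists>T. measure_preserving_map (gauss_PiM K) T \<and>
          (\<forall>A. (\<forall>i\<in>L. T A (e i) = V (\<lambda>i. A (e i)) i) \<and> (\<forall>k\<in>K - e ` L. T A k = A k))))"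

lemma gauss_unitary_cong:
  assumes "gauss_unitary L V" and "\<And>i. i \<in> L \<Longrightarrow> x i = y i" and "i \<in> L"
  shows "V x i = V y i"
proof -
  have "\<forall>x y. (\<forall>i\<in>L. x i = y i) \<longrightarrow> (\<forall>i\<in>L. V x i = V y i)"
    using assms(1) unfolding gauss_unitary_def by (elim conjE)
  then show ?thesis using assms(2,3) by blast
qed

lemma gauss_unitary_linear:
  assumes "gauss_unitary L V" and "i \<in> L"
  shows "V (\<lambda>j. x j + a * y j) i = V x i + a * V y i"
proof -
  have "\<forall>x y a. \<forall>i\<in>L. V (\<lambda>j. x j + a * y j) i = V x i + a * V y i"
    using assms(1) unfolding gauss_unitary_def by (elim conjE)
  then show ?thesis using assms(2) by simp
qed

lemma gauss_unitary_ip: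
  assumes "gauss_unitary L V"
  shows "(\<Sum>i\<in>L. cnj (V x i) * V y i) = (\<Sum>i\<in>L. cnj (x i) * y i)"
proof -
  have "\<forall>x y. (\<Sum>i\<in>L. cnj (V x i) * V y i) = (\<Sum>i\<in>L. cnj (x i) * y i)"
    using assms(1) unfolding gauss_unitary_def by (elim conjE)
  then show ?thesis by simp
qed

lemma gauss_unitary_map:
  fixes K :: "(nat \<times> nat) set"
  assumes "gauss_unitary L V" "finite K" "inj_on e L" "e ` L \<subseteq> K"
  obtains T where "measure_preserving_map (gauss_PiM K) T"
    "\<And>A i. i \<in> L \<Longrightarrow> T A (e i) = V (\<lambda>i. A (e i)) i"
    "\<And>A k. k \<in> K - e ` L \<Longrightarrow> T A k = A k"
proof -
  have "\<forall>K (e :: nat \<Rightarrow> nat \<times> nat). finite K \<longrightarrow> inj_on e L \<longrightarrow> e ` L \<subseteq> K \<longrightarrow>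
        (\<exists>T. measure_preserving_map (gauss_PiM K) T \<and>
          (\<forall>A. (\<forall>i\<in>L. T A (e i) = V (\<lambda>i. A (e i)) i) \<and> (\<forall>k\<in>K - e ` L. T A k = A k)))"
    using assms(1) unfolding gauss_unitary_def by (elim conjE)
  from this[THEN spec[where x=K], THEN spec[where x=e], THEN mp, OF assms(2), THEN mp, OF assms(3), THEN mp, OF assms(4)]
  obtain T where "measure_preserving_map (gauss_PiM K) T"
    "\<forall>A. (\<forall>i\<in>L. T A (e i) = V (\<lambda>i. A (e i)) i) \<and> (\<forall>k\<in>K - e ` L. T A k = A k)"
    by (elim exE conjE)
  then show ?thesis by (intro that[of T]) auto
qed

lemma sum_cnj_mult_self: "(\<Sum>i\<in>L. cnj (x i) * x i) = of_real (\<Sum>i\<in>L. (cmod (x i))\<^sup>2)"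
  by (simp add: complex_norm_square mult.commute del: of_real_power)

lemma gauss_unitary_norm:
  assumes "gauss_unitary L V"
  shows "(\<Sum>i\<in>L. (cmod (V x i))\<^sup>2) = (\<Sum>i\<in>L. (cmod (x i))\<^sup>2)"
  using gauss_unitary_ip[OF assms, of x x] unfolding sum_cnj_mult_self of_real_eq_iff .

lemma gauss_unitary_sum:
  assumes V: "gauss_unitary L V" and i: "i \<in> L" and S: "finite S"
  shows "V (\<lambda>j. x j + (\<Sum>s\<in>S. w s * h s j)) i = V x i + (\<Sum>s\<in>S. w s * V (h s) i)"
  using S
proof induction
  case (insert s S)
  have "V (\<lambda>j. x j + (\<Sum>s\<in>insert s S. w s * h s j)) i = V (\<lambda>j. (x j + (\<Sum>s\<in>S. w s * h s j)) + w s * h s j) i"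
    using insert.hyps by (simp add: algebra_simps)
  also have "\<dots> = V (\<lambda>j. x j + (\<Sum>s\<in>S. w s * h s j)) i + w s * V (h s) i"
    by (rule gauss_unitary_linear[OF V i])
  finally show ?case using insert by simp
qed simp

lemma gauss_unitary_id: "gauss_unitary L (\<lambda>x. x)"
  unfolding gauss_unitary_def
  by (intro conjI allI impI ballI exI[of _ "\<lambda>x. x"] measure_preserving_map_id) auto

lemma gauss_unitary_comp:
  assumes V: "gauss_unitary L V" and W: "gauss_unitary L W"
  shows "gauss_unitary L (\<lambda>x. V (W x))"
  unfolding gauss_unitary_def
proof (intro conjI allI impI ballI)
  fix x y :: "nat \<Rightarrow> complex" and i assume "\<forall>i\<in>L. x i = y i" "i \<in> L"
  then show "V (W x) i = V (W y) i"
    by (intro gauss_unitary_cong[OF V] gauss_unitary_cong[OF W]) auto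
next
  fix x y a i assume i: "i \<in> L"
  have "V (W (\<lambda>j. x j + a * y j)) i = V (\<lambda>i. W x i + a * W y i) i"
    by (rule gauss_unitary_cong[OF V _ i]) (rule gauss_unitary_linear[OF W])
  also have "\<dots> = V (W x) i + a * V (W y) i"
    by (rule gauss_unitary_linear[OF V i])
  finally show "V (W (\<lambda>j. x j + a * y j)) i = V (W x) i + a * V (W y) i" .
next
  fix x y
  show "(\<Sum>i\<in>L. cnj (V (W x) i) * V (W y) i) = (\<Sum>i\<in>L. cnj (x i) * y i)"
    by (simp only: gauss_unitary_ip[OF V] gauss_unitary_ip[OF W])
next
  fix K and e :: "nat \<Rightarrow> nat \<times> nat" assume K: "finite K" "inj_on e L" "e ` L \<subseteq> K"
  obtain S where S: "measure_preserving_map (gauss_PiM K) S"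
    "\<And>A i. i \<in> L \<Longrightarrow> S A (e i) = V (\<lambda>i. A (e i)) i" "\<And>A k. k \<in> K - e ` L \<Longrightarrow> S A k = A k"
    by (rule gauss_unitary_map[OF V K]) blast
  obtain T where T: "measure_preserving_map (gauss_PiM K) T"
    "\<And>A i. i \<in> L \<Longrightarrow> T A (e i) = W (\<lambda>i. A (e i)) i" "\<And>A k. k \<in> K - e ` L \<Longrightarrow> T A k = A k"
    by (rule gauss_unitary_map[OF W K]) blast
  have "S (T A) (e i) = V (W (\<lambda>i. A (e i))) i" if "i \<in> L" for A i
    unfolding S(2)[OF that] by (rule gauss_unitary_cong[OF V _ that]) (rule T(2))
  then show "\<exists>T. measure_preserving_map (gauss_PiM K) T \<and>
      (\<forall>A. (\<forall>i\<in>L. T A (e i) = V (W (\<lambda>i. A (e i))) i) \<and> (\<forall>k\<in>K - e ` L. T A k = A k))"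
    using S(3) T(3) measure_preserving_map_comp[OF S(1) T(1)]
    by (intro exI[of _ "\<lambda>x. S (T x)"]) simp
qed

lemma gauss_unitary_phase:
  assumes L: "finite L" "k \<in> L" and u: "cmod u = 1"
  shows "gauss_unitary L (\<lambda>x. x(k := u * x k))"
  unfolding gauss_unitary_def
proof (intro conjI allI impI ballI)
  fix x y :: "nat \<Rightarrow> complex"
  have "u * cnj u = 1" using complex_norm_square[of u] u by simp
  moreover have "cnj (u * x k) * (u * y k) = (u * cnj u) * (cnj (x k) * y k)" by simp
  ultimately have "cnj (u * x k) * (u * y k) = cnj (x k) * y k" by (simp only: mult_1_left)
  then show "(\<Sum>i\<in>L. cnj ((x(k := u * x k)) i) * (y(k := u * y k)) i) = (\<Sum>i\<in>L. cnj (x i) * y i)"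
    by (intro sum.cong) auto
next
  fix K and e :: "nat \<Rightarrow> nat \<times> nat" assume K: "finite K" "inj_on e L" "e ` L \<subseteq> K"
  have "e i = e k \<longleftrightarrow> i = k" if "i \<in> L" for i
    using inj_onD[OF K(2)] L(2) that by auto
  then show "\<exists>T. measure_preserving_map (gauss_PiM K) T \<and>
      (\<forall>A. (\<forall>i\<in>L. T A (e i) = ((\<lambda>i. A (e i))(k := u * A (e k))) i) \<and> (\<forall>k\<in>K - e ` L. T A k = A k))"
    using L(2) K by (intro exI[of _ "\<lambda>A. A(e k := u * A (e k))"] conjI gauss_PiM_phase u) auto
qed (use L in \<open>auto simp: algebra_simps\<close>)

lemma gauss_unitary_rotate:
  fixes c s :: real
  assumes L: "finite L" "k \<in> L" "l \<in> L" "k \<noteq> l" and cs: "c\<^sup>2 + s\<^sup>2 = 1"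
  shows "gauss_unitary L (\<lambda>x. x(k := c * x k + s * x l, l := c * x l - s * x k))"
  unfolding gauss_unitary_def
proof (intro conjI allI impI ballI)
  fix x y :: "nat \<Rightarrow> complex"
  have split: "(\<Sum>i\<in>L. f i) = f k + f l + (\<Sum>i\<in>L - {k, l}. f i)" for f :: "nat \<Rightarrow> complex"
  proof -
    have "L = insert k (insert l (L - {k, l}))" using L by auto
    then have "(\<Sum>i\<in>L. f i) = (\<Sum>i\<in>insert k (insert l (L - {k, l})). f i)" by simp
    also have "\<dots> = f k + f l + (\<Sum>i\<in>L - {k, l}. f i)"
      using L by (subst sum.insert; simp)+
    finally show ?thesis .
  qed
  have cs': "(of_real c)\<^sup>2 + (of_real s)\<^sup>2 = (1::complex)"
    using cs by (metis of_real_1 of_real_add of_real_power)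
  have "cnj (c * x k + s * x l) * (c * y k + s * y l) + cnj (c * x l - s * x k) * (c * y l - s * y k)
      = ((of_real c)\<^sup>2 + (of_real s)\<^sup>2) * (cnj (x k) * y k + cnj (x l) * y l)"
    by (simp add: algebra_simps power2_eq_square)
  then show "(\<Sum>i\<in>L. cnj ((x(k := c * x k + s * x l, l := c * x l - s * x k)) i)
        * (y(k := c * y k + s * y l, l := c * y l - s * y k)) i) = (\<Sum>i\<in>L. cnj (x i) * y i)"
    unfolding cs' split using L(4) by simp
next
  fix K and e :: "nat \<Rightarrow> nat \<times> nat" assume K: "finite K" "inj_on e L" "e ` L \<subseteq> K"
  have e: "e i = e k \<longleftrightarrow> i = k" "e i = e l \<longleftrightarrow> i = l" if "i \<in> L" for i
    using inj_onD[OF K(2)] L that by auto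
  have mp: "measure_preserving_map (gauss_PiM K) (\<lambda>A. A(e k := c * A (e k) + s * A (e l), e l := c * A (e l) - s * A (e k)))"
    using L K e by (intro gauss_PiM_rotate cs) auto
  show "\<exists>T. measure_preserving_map (gauss_PiM K) T \<and>
      (\<forall>A :: nat \<times> nat \<Rightarrow> complex. (\<forall>i\<in>L. T A (e i) = ((\<lambda>i. A (e i))(k := c * A (e k) + s * A (e l), l := c * A (e l) - s * A (e k))) i)
        \<and> (\<forall>k\<in>K - e ` L. T A k = A k))"
    by (rule exI, intro conjI, rule mp) (use L(2-4) e in auto)
qed (use L in \<open>auto simp: algebra_simps\<close>)

section \<open>Isometries that move given vectors onto few coordinate axes\<close>

lemma unit_phase: "\<exists>u::complex. cmod u = 1 \<and> u * z = of_real (cmod z)"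
proof (cases "z = 0")
  case False
  have "cnj z / of_real (cmod z) * z = of_real ((cmod z)\<^sup>2) / of_real (cmod z)"
    by (simp add: complex_norm_square mult.commute del: of_real_power)
  also have "\<dots> = of_real (cmod z)" by (simp add: power2_eq_square)
  finally show ?thesis
    using False by (intro exI[of _ "cnj z / of_real (cmod z)"]) (simp add: norm_divide)
qed (auto intro: exI[of _ 1])

text \<open>Phases turn \<open>q k\<close> and \<open>q l\<close> into nonnegative reals, and a
  plane rotation then moves the mass at \<open>l\<close> to \<open>k\<close>. The last two conjuncts
  ensure that an elimination does not spoil coordinates and vectors treated before.\<close>

lemma gauss_unitary_kill_one:
  assumes L: "finite L" "k \<in> L" "l \<in> L" "k \<noteq> l"
  shows "\<exists>V. gauss_unitary L V \<and> V q l = 0 \<and> (\<forall>x i. i \<noteq> k \<longrightarrow> i \<noteq> l \<longrightarrow> V x i = x i) \<and>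
    (\<forall>x. x k = 0 \<longrightarrow> x l = 0 \<longrightarrow> V x k = 0 \<and> V x l = 0)"
proof -
  obtain u where u: "cmod u = 1" "u * q k = of_real (cmod (q k))" using unit_phase by blast
  obtain v where v: "cmod v = 1" "v * q l = of_real (cmod (q l))" using unit_phase by blast
  obtain c s :: real where cs: "c\<^sup>2 + s\<^sup>2 = 1" "c * cmod (q l) = s * cmod (q k)"
  proof (cases "q k = 0 \<and> q l = 0")
    case True
    then show ?thesis using that[of 1 0] by simp
  next
    case False
    define r where "r = sqrt ((cmod (q k))\<^sup>2 + (cmod (q l))\<^sup>2)"
    have r: "r\<^sup>2 = (cmod (q k))\<^sup>2 + (cmod (q l))\<^sup>2" by (simp add: r_def)
    have "r \<noteq> 0" using False by (auto simp: r_def sum_power2_eq_zero_iff)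
    then show ?thesis
      by (intro that[of "cmod (q k) / r" "cmod (q l) / r"])
        (simp_all add: power_divide add_divide_distrib[symmetric] r[symmetric])
  qed
  define P where "P = (\<lambda>x::nat \<Rightarrow> complex. x(k := u * x k))"
  define P' where "P' = (\<lambda>x::nat \<Rightarrow> complex. x(l := v * x l))"
  define R where "R = (\<lambda>x::nat \<Rightarrow> complex. x(k := c * x k + s * x l, l := c * x l - s * x k))"
  have "gauss_unitary L (\<lambda>x. R (P' (P x)))"
    unfolding R_def P'_def P_def
    by (rule gauss_unitary_comp[OF gauss_unitary_rotate[OF L cs(1)]
      gauss_unitary_comp[OF gauss_unitary_phase[OF L(1,3) v(1)] gauss_unitary_phase[OF L(1,2) u(1)]]])
  moreover have "R (P' (P q)) l = of_real (c * cmod (q l)) - of_real (s * cmod (q k))"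
    using L(4) by (simp add: R_def P'_def P_def u v)
  then have "R (P' (P q)) l = 0" unfolding cs(2) by simp
  ultimately show ?thesis
    using L(4) by (intro exI[of _ "\<lambda>x. R (P' (P x))"]) (auto simp: R_def P_def P'_def)
qed

text \<open>The axis \<open>k\<close> is the pivot that collects the mass of \<open>q\<close> on
  \<open>F\<close>. That vanishing on \<open>insert k F\<close> is preserved is what allows several
  vectors to be treated one after another.\<close>

lemma gauss_unitary_kill:
  assumes L: "finite L" "k \<in> L" and F: "finite F" "F \<subseteq> L" "k \<notin> F"
  shows "\<exists>V. gauss_unitary L V \<and> (\<forall>i\<in>F. V q i = 0) \<and> (\<forall>x i. i \<notin> insert k F \<longrightarrow> V x i = x i) \<and>
    (\<forall>x. (\<forall>i\<in>insert k F. x i = 0) \<longrightarrow> (\<forall>i\<in>insert k F. V x i = 0))"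
  using F
proof induction
  case empty
  show ?case using gauss_unitary_id[of L] by (intro exI[of _ "\<lambda>x. x"]) auto
next
  case (insert l F)
  then obtain V where V: "gauss_unitary L V" "\<forall>i\<in>F. V q i = 0" "\<forall>x i. i \<notin> insert k F \<longrightarrow> V x i = x i"
    "\<forall>x. (\<forall>i\<in>insert k F. x i = 0) \<longrightarrow> (\<forall>i\<in>insert k F. V x i = 0)" by auto
  have "l \<in> L" "k \<noteq> l" using insert by auto
  from gauss_unitary_kill_one[OF L this, of "V q"] obtain W where
    W: "gauss_unitary L W" "W (V q) l = 0" "\<forall>x i. i \<noteq> k \<longrightarrow> i \<noteq> l \<longrightarrow> W x i = x i"
    "\<forall>x. x k = 0 \<longrightarrow> x l = 0 \<longrightarrow> W x k = 0 \<and> W x l = 0" by blast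
  have "W (V q) i = 0" if "i \<in> insert l F" for i
  proof (cases "i = l")
    case False
    then have "i \<in> F" "i \<noteq> k" using that insert.prems by auto
    then show ?thesis using False W(3) V(2) by simp
  qed (use W(2) in simp)
  moreover have "W (V x) i = x i" if "i \<notin> insert k (insert l F)" for x i
    using that W(3) V(3) by auto
  moreover have "W (V x) i = 0" if x: "\<forall>i\<in>insert k (insert l F). x i = 0" and i: "i \<in> insert k (insert l F)" for x i
  proof -
    have a: "V x i = 0" if "i \<in> insert k F" for i
    proof -
      have "\<forall>i\<in>insert k F. x i = 0" using x by simp
      then show ?thesis using V(4) that by blast
    qed
    have b: "V x l = 0"
      using x V(3) insert.hyps \<open>k \<noteq> l\<close> by simp
    have "V x k = 0" by (rule a) simp
    then have c: "W (V x) k = 0 \<and> W (V x) l = 0" using b W(4) by blast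
    show ?thesis
    proof (cases "i = k \<or> i = l")
      case False
      then show ?thesis using i a W(3) by simp
    qed (use c in auto)
  qed
  ultimately show ?case
    using gauss_unitary_comp[OF W(1) V(1)] by (intro exI[of _ "\<lambda>x. W (V x)"]) auto
qed

lemma gauss_unitary_to_axis:
  assumes L: "finite L" "k \<in> L"
  obtains V where "gauss_unitary L V" "\<And>i. i \<in> L \<Longrightarrow> i \<noteq> k \<Longrightarrow> V q i = 0"
  using gauss_unitary_kill[OF L, of "L - {k}" q] L by auto

text \<open>Elimination as in a QR factorization: each vector costs at most one new pivot axis, and
  its isometry mixes only axes outside \<open>K\<close>, where the earlier vectors vanish and keep
  vanishing. So all images of the \<open>h s\<close> are supported on at most \<open>card S\<close>
  axes of \<open>J\<close>.\<close>

lemma gauss_unitary_triangularize: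
  assumes J: "finite J" and S: "finite S"
  shows "\<exists>V K. gauss_unitary J V \<and> K \<subseteq> J \<and> card K \<le> card S \<and> (\<forall>s\<in>S. \<forall>j\<in>J - K. V (h s) j = 0)"
  using S
proof induction
  case empty
  show ?case using gauss_unitary_id[of J] by auto
next
  case (insert s S)
  then obtain V K where V: "gauss_unitary J V" "K \<subseteq> J" "card K \<le> card S" "\<forall>s\<in>S. \<forall>j\<in>J - K. V (h s) j = 0"
    by blast
  show ?case
  proof (cases "J - K = {}")
    case True
    then show ?thesis using V insert.hyps by (intro exI[of _ V] exI[of _ K]) auto
  next
    case False
    then obtain k where k: "k \<in> J - K" by blast
    have "finite (J - K - {k})" "J - K - {k} \<subseteq> J" "k \<notin> J - K - {k}" "k \<in> J" using J k by auto
    from gauss_unitary_kill[OF J this(4,1,2,3), of "V (h s)"] obtain W where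
      W: "gauss_unitary J W" "\<forall>i\<in>J - K - {k}. W (V (h s)) i = 0"
      "\<forall>x. (\<forall>i\<in>insert k (J - K - {k}). x i = 0) \<longrightarrow> (\<forall>i\<in>insert k (J - K - {k}). W x i = 0)" by blast
    have ins: "insert k (J - K - {k}) = J - K" using k by auto
    have "W (V (h t)) j = 0" if "t \<in> insert s S" "j \<in> J - insert k K" for t j
    proof (cases "t = s")
      case False
      then have "\<forall>i\<in>J - K. W (V (h t)) i = 0"
        using W(3)[unfolded ins] V(4) that by simp
      then show ?thesis using that by simp
    qed (use that W(2) in auto)
    moreover have "card (insert k K) \<le> card (insert s S)"
      using insert.hyps V(3) finite_subset[OF V(2) J] by (simp add: card_insert_if)
    ultimately show ?thesis
      using gauss_unitary_comp[OF W(1) V(1)] V(2) k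
      by (intro exI[of _ "\<lambda>x. W (V x)"] exI[of _ "insert k K"]) auto
  qed
qed

lemma gauss_unitary_columns:
  fixes J :: "nat set"
  assumes V: "gauss_unitary L V" and L: "finite L" "finite J"
  shows "\<exists>T. measure_preserving_map (gauss_PiM (L \<times> J)) T \<and>
    (\<forall>A. \<forall>i\<in>L. \<forall>j\<in>J. T A (i, j) = V (\<lambda>i. A (i, j)) i)"
proof -
  have "\<exists>T. measure_preserving_map (gauss_PiM (L \<times> J)) T \<and>
    (\<forall>A. \<forall>i\<in>L. \<forall>j\<in>J. T A (i, j) = (if j \<in> J' then V (\<lambda>i. A (i, j)) i else A (i, j)))"
    if "finite J'" "J' \<subseteq> J" for J'
    using that
  proof induction
    case empty
    show ?case by (intro exI[of _ "\<lambda>x. x"] conjI measure_preserving_map_id) simp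
  next
    case (insert j0 J')
    then obtain T where T: "measure_preserving_map (gauss_PiM (L \<times> J)) T"
      "\<forall>A. \<forall>i\<in>L. \<forall>j\<in>J. T A (i, j) = (if j \<in> J' then V (\<lambda>i. A (i, j)) i else A (i, j))" by auto
    obtain S where S: "measure_preserving_map (gauss_PiM (L \<times> J)) S"
      "\<And>A i. i \<in> L \<Longrightarrow> S A (i, j0) = V (\<lambda>i. A (i, j0)) i"
      "\<And>A k. k \<in> L \<times> J - (\<lambda>i. (i, j0)) ` L \<Longrightarrow> S A k = A k"
      by (rule gauss_unitary_map[OF V, of "L \<times> J" "\<lambda>i. (i, j0)"])
        (use L insert.prems in \<open>auto simp: inj_on_def\<close>)
    have "S (T A) (i, j) = (if j \<in> insert j0 J' then V (\<lambda>i. A (i, j)) i else A (i, j))"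
      if ij: "i \<in> L" "j \<in> J" for A i j
    proof (cases "j = j0")
      case True
      have "V (\<lambda>i. T A (i, j0)) i = V (\<lambda>i. A (i, j0)) i"
        using T(2) insert ij True by (intro gauss_unitary_cong[OF V]) auto
      then show ?thesis using True S(2)[OF ij(1)] by simp
    next
      case False
      then have "(i, j) \<in> L \<times> J - (\<lambda>i. (i, j0)) ` L" using ij by auto
      then show ?thesis using S(3) T(2) ij False by auto
    qed
    then show ?case using measure_preserving_map_comp[OF S(1) T(1)] by blast
  qed
  from this[of J] show ?thesis using L(2) by simp
qed

section \<open>The smallest singular value of a Gaussian array\<close>

text \<open>The Wishart quadratic form of a subarray. General row sets \<open>L\<close> are allowed
  because the first row is split off later.\<close>

definition array_energy :: "nat set \<Rightarrow> nat set \<Rightarrow> (nat \<times> nat \<Rightarrow> complex) \<Rightarrow> (nat \<Rightarrow> complex) \<Rightarrow> real" where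
  "array_energy L J G z = (\<Sum>j\<in>J. (cmod (\<Sum>i\<in>L. cnj (G (i, j)) * z i))\<^sup>2)"

lemma array_energy_nonneg: "0 \<le> array_energy L J G z"
  by (simp add: array_energy_def sum_nonneg)

lemma borel_measurable_cnj:
  assumes [measurable]: "f \<in> borel_measurable M"
  shows "(\<lambda>x. cnj (f x)) \<in> borel_measurable M"
proof -
  have "cnj \<in> borel_measurable borel"
    by (intro borel_measurable_continuous_onI continuous_intros)
  from measurable_compose[OF assms this] show ?thesis .
qed

lemma measurable_gauss_coord:
  "k \<in> K \<Longrightarrow> (\<lambda>A. A k) \<in> borel_measurable (gauss_PiM K)"
  using measurable_component_singleton[of k K "\<lambda>_. cgauss"] by (simp cong: measurable_cong_sets)

lemma borel_measurable_array_form: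
  assumes "\<And>i. i \<in> L \<Longrightarrow> (\<lambda>x. f x i) \<in> borel_measurable M"
  shows "(\<lambda>x. \<Sum>i\<in>L. cnj (f x i) * z i) \<in> borel_measurable M"
  using assms by (intro borel_measurable_sum borel_measurable_times borel_measurable_cnj) auto

lemma borel_measurable_array_energy:
  assumes "f \<in> measurable M (gauss_PiM (L \<times> J))"
  shows "(\<lambda>x. array_energy L J (f x) z) \<in> borel_measurable M"
proof -
  have "(\<lambda>x. f x (i, j)) \<in> borel_measurable M" if "i \<in> L" "j \<in> J" for i j
    using measurable_compose[OF assms measurable_gauss_coord] that by simp
  then show ?thesis
    unfolding array_energy_def
    by (intro borel_measurable_sum borel_measurable_power measurable_compose[OF _ borel_measurable_norm] borel_measurable_array_form) auto
qed

section \<open>Exponential moments of norms and of distances to spans\<close>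

lemma nn_integral_gauss_PiM_exp_sq:
  fixes b :: real
  assumes K: "finite K" "D \<subseteq> K" and b: "-1 < b"
  shows "(\<integral>\<^sup>+A. ennreal (exp (- b * (\<Sum>k\<in>D. (cmod (A k))\<^sup>2) / 2)) \<partial>gauss_PiM K) = ennreal ((1 / (1 + b)) ^ card D)"
proof -
  interpret product_sigma_finite "\<lambda>_. cgauss" by (rule product_sigma_finite_cgauss)
  let ?f = "\<lambda>k z. if k \<in> D then ennreal (exp (- b * (cmod z)\<^sup>2 / 2)) else 1"
  have D: "finite D" using K finite_subset by blast
  have "ennreal (exp (- b * (\<Sum>k\<in>D. (cmod (A k))\<^sup>2) / 2)) = (\<Prod>k\<in>K. ?f k (A k))" for A
  proof -
    have "(\<Prod>k\<in>K. ?f k (A k)) = (\<Prod>k\<in>D. ennreal (exp (- b * (cmod (A k))\<^sup>2 / 2)))"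
      using K by (simp add: prod.If_cases Int_absorb1)
    also have "\<dots> = ennreal (\<Prod>k\<in>D. exp (- b * (cmod (A k))\<^sup>2 / 2))"
      by (rule prod_ennreal) simp
    also have "(\<Prod>k\<in>D. exp (- b * (cmod (A k))\<^sup>2 / 2)) = exp (- b * (\<Sum>k\<in>D. (cmod (A k))\<^sup>2) / 2)"
      using D by (simp add: exp_sum[symmetric] sum_distrib_left sum_divide_distrib sum_negf)
    finally show ?thesis by simp
  qed
  then have "(\<integral>\<^sup>+A. ennreal (exp (- b * (\<Sum>k\<in>D. (cmod (A k))\<^sup>2) / 2)) \<partial>gauss_PiM K)
      = (\<integral>\<^sup>+A. (\<Prod>k\<in>K. ?f k (A k)) \<partial>gauss_PiM K)" by simp
  also have "\<dots> = (\<Prod>k\<in>K. integral\<^sup>N cgauss (?f k))"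
    by (rule product_nn_integral_prod[OF K(1)]) (simp cong: measurable_cong_sets)
  also have "\<dots> = (\<Prod>k\<in>K. if k \<in> D then ennreal (1 / (1 + b)) else 1)"
    using nn_integral_cgauss_exp_sq[OF b] prob_space.emeasure_space_1[OF prob_space_cgauss]
    by (intro prod.cong) auto
  also have "\<dots> = ennreal (1 / (1 + b)) ^ card D"
    using K by (simp add: prod.If_cases Int_absorb1)
  also have "\<dots> = ennreal ((1 / (1 + b)) ^ card D)"
    using b by (simp add: ennreal_power)
  finally show ?thesis .
qed

text \<open>In coordinates in which the vectors \<open>h s\<close> live on few axes, the squared distance to their span
  dominates the squared norm on the remaining axes.\<close>
lemma nn_integral_exp_dist_span_le:
  fixes b :: real and h :: "'s \<Rightarrow> nat \<Rightarrow> complex" and i0 :: nat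
  assumes J: "finite J" and S: "finite S" and b: "0 < b"
  shows "(\<integral>\<^sup>+A. (SUP w\<in>W. ennreal (exp (- b * (\<Sum>j\<in>J. (cmod (A (i0, j) + (\<Sum>s\<in>S. w s * h s j)))\<^sup>2) / 2)))
      \<partial>gauss_PiM ({i0} \<times> J)) \<le> ennreal ((1 / (1 + b)) ^ (card J - card S))"
proof -
  obtain V K where V: "gauss_unitary J V" "K \<subseteq> J" "card K \<le> card S" "\<forall>s\<in>S. \<forall>j\<in>J - K. V (h s) j = 0"
    using gauss_unitary_triangularize[OF J S] by blast
  obtain T where T: "measure_preserving_map (gauss_PiM ({i0} \<times> J)) T"
    "\<And>A j. j \<in> J \<Longrightarrow> T A (i0, j) = V (\<lambda>j. A (i0, j)) j"
    by (rule gauss_unitary_map[OF V(1), of "{i0} \<times> J" "\<lambda>j. (i0, j)"]) (use J in \<open>auto simp: inj_on_def\<close>)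
  let ?D = "{i0} \<times> (J - K)"
  define g where "g = (\<lambda>A :: nat \<times> nat \<Rightarrow> complex. ennreal (exp (- b * (\<Sum>k\<in>?D. (cmod (A k))\<^sup>2) / 2)))"
  have g[measurable]: "g \<in> borel_measurable (gauss_PiM ({i0} \<times> J))"
  proof -
    have "(\<lambda>A. \<Sum>k\<in>?D. (cmod (A k))\<^sup>2) \<in> borel_measurable (gauss_PiM ({i0} \<times> J))"
      by (intro borel_measurable_sum borel_measurable_power measurable_compose[OF _ borel_measurable_norm] measurable_gauss_coord) auto
    then show ?thesis unfolding g_def by measurable
  qed
  \<comment> \<open>Outside \<open>K\<close> the images of all \<open>h s\<close> vanish, so the
    correction by \<open>w\<close> is invisible there. The bound is therefore uniform in
    \<open>w\<close> and passes to the supremum.\<close>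
  have le: "(SUP w\<in>W. ennreal (exp (- b * (\<Sum>j\<in>J. (cmod (A (i0, j) + (\<Sum>s\<in>S. w s * h s j)))\<^sup>2) / 2))) \<le> g (T A)" for A
  proof (rule SUP_least)
    fix w
    have "(\<Sum>k\<in>?D. (cmod (T A k))\<^sup>2) = (\<Sum>j\<in>J - K. (cmod (T A (i0, j)))\<^sup>2)"
      by (rule sum.reindex_bij_witness[of _ "\<lambda>j. (i0, j)" snd]) auto
    also have "\<dots> = (\<Sum>j\<in>J - K. (cmod (V (\<lambda>j. A (i0, j) + (\<Sum>s\<in>S. w s * h s j)) j))\<^sup>2)"
    proof (intro sum.cong refl)
      fix j assume j: "j \<in> J - K"
      have "V (\<lambda>j. A (i0, j) + (\<Sum>s\<in>S. w s * h s j)) j = V (\<lambda>j. A (i0, j)) j + (\<Sum>s\<in>S. w s * V (h s) j)"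
        using j by (intro gauss_unitary_sum[OF V(1) _ S]) auto
      also have "\<dots> = T A (i0, j)" using j V(4) T(2) by simp
      finally show "(cmod (T A (i0, j)))\<^sup>2 = (cmod (V (\<lambda>j. A (i0, j) + (\<Sum>s\<in>S. w s * h s j)) j))\<^sup>2" by simp
    qed
    also have "\<dots> \<le> (\<Sum>j\<in>J. (cmod (V (\<lambda>j. A (i0, j) + (\<Sum>s\<in>S. w s * h s j)) j))\<^sup>2)"
      using J by (intro sum_mono2) auto
    also have "\<dots> = (\<Sum>j\<in>J. (cmod (A (i0, j) + (\<Sum>s\<in>S. w s * h s j)))\<^sup>2)"
      by (rule gauss_unitary_norm[OF V(1)])
    finally show "ennreal (exp (- b * (\<Sum>j\<in>J. (cmod (A (i0, j) + (\<Sum>s\<in>S. w s * h s j)))\<^sup>2) / 2)) \<le> g (T A)"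
      unfolding g_def using b by (intro ennreal_leI) simp
  qed
  have "(\<integral>\<^sup>+A. (SUP w\<in>W. ennreal (exp (- b * (\<Sum>j\<in>J. (cmod (A (i0, j) + (\<Sum>s\<in>S. w s * h s j)))\<^sup>2) / 2)))
      \<partial>gauss_PiM ({i0} \<times> J)) \<le> (\<integral>\<^sup>+A. g (T A) \<partial>gauss_PiM ({i0} \<times> J))"
    by (intro nn_integral_mono le)
  also have "\<dots> = (\<integral>\<^sup>+A. g A \<partial>gauss_PiM ({i0} \<times> J))"
    by (rule measure_preserving_map_nn_integral[OF T(1) g])
  also have "\<dots> = ennreal ((1 / (1 + b)) ^ card ?D)"
    unfolding g_def using J b by (intro nn_integral_gauss_PiM_exp_sq) auto
  also have "\<dots> \<le> ennreal ((1 / (1 + b)) ^ (card J - card S))"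
  proof (intro ennreal_leI power_decreasing)
    have "card ?D = card J - card K"
      using J V(2) by (simp add: card_cartesian_product card_Diff_subset finite_subset)
    then show "card J - card S \<le> card ?D" using V(3) by simp
  qed (use b in auto)
  finally show ?thesis .
qed

text \<open>Rotating \<open>z\<close> to the axis \<open>k\<close> makes the modulus of the form
  equal to |z| times that of one Gaussian coordinate, so the probability is exact and independent of
  \<open>z\<close>. The vector \<open>u\<close> is stored as a one-column array so that the isometry
  lemmas for arrays apply to it.\<close>

lemma emeasure_gauss_form_ge:
  fixes L :: "nat set"
  assumes L: "finite L" "k \<in> L" and r: "0 \<le> r" and z: "\<exists>i\<in>L. z i \<noteq> 0"
  shows "emeasure (gauss_PiM (L \<times> {0})) {u \<in> space (gauss_PiM (L \<times> {0::nat})).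
    2 * r * (\<Sum>i\<in>L. (cmod (z i))\<^sup>2) \<le> (cmod (\<Sum>i\<in>L. cnj (u (i, 0)) * z i))\<^sup>2} = ennreal (exp (- r))"
    (is "emeasure ?M ?E = _")
proof -
  obtain V where V: "gauss_unitary L V" "\<And>i. i \<in> L \<Longrightarrow> i \<noteq> k \<Longrightarrow> V z i = 0"
    by (rule gauss_unitary_to_axis[OF L, of z]) blast
  have fin: "finite {0::nat}" by simp
  obtain T where T0: "measure_preserving_map ?M T"
    "\<forall>A. \<forall>i\<in>L. \<forall>j\<in>{0}. T A (i, j) = V (\<lambda>i. A (i, j)) i"
    using gauss_unitary_columns[OF V(1) L(1) fin] by blast
  have T: "measure_preserving_map ?M T" "\<And>A i. i \<in> L \<Longrightarrow> T A (i, 0) = V (\<lambda>i. A (i, 0)) i"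
    using T0 by simp_all
  have single: "(\<Sum>i\<in>L. f i) = f k" if "\<And>i. i \<in> L \<Longrightarrow> i \<noteq> k \<Longrightarrow> f i = 0" for f :: "nat \<Rightarrow> 'b::comm_monoid_add"
    using sum.remove[OF L, of f] that by simp
  have nz: "(\<Sum>i\<in>L. (cmod (z i))\<^sup>2) = (cmod (V z k))\<^sup>2"
    unfolding gauss_unitary_norm[OF V(1), of z, symmetric] by (rule single) (simp add: V(2))
  have pos: "0 < (\<Sum>i\<in>L. (cmod (z i))\<^sup>2)"
  proof -
    obtain i where "i \<in> L" "z i \<noteq> 0" using z by blast
    then show ?thesis using L(1) by (intro sum_pos2[of _ i]) auto
  qed
  have ip: "(\<Sum>i\<in>L. cnj (u (i, 0)) * z i) = cnj (T u (k, 0)) * V z k" for u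
  proof -
    have "(\<Sum>i\<in>L. cnj (u (i, 0)) * z i) = (\<Sum>i\<in>L. cnj (V (\<lambda>i. u (i, 0)) i) * V z i)"
      by (rule gauss_unitary_ip[OF V(1), symmetric])
    also have "\<dots> = cnj (V (\<lambda>i. u (i, 0)) k) * V z k" by (rule single) (simp add: V(2))
    finally show ?thesis using T(2) L(2) by simp
  qed
  define B where "B = {u \<in> space ?M. u (k, 0) \<in> {z. 2 * r \<le> (cmod z)\<^sup>2}}"
  have coord: "(\<lambda>u. u (k, 0)) \<in> measurable ?M cgauss"
    using L by (intro measurable_component_singleton) simp
  have C: "{z. 2 * r \<le> (cmod z)\<^sup>2} \<in> sets cgauss" by simp
  have B: "B \<in> sets ?M"
    using measurable_sets[OF coord C] by (simp add: B_def vimage_def Int_def conj_commute)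
  have "?E = T -` B \<inter> space ?M"
    using pos measurable_space[OF measure_preserving_map_measurable[OF T(1)]]
    by (auto simp: B_def ip norm_mult power_mult_distrib nz)
  then have "emeasure ?M ?E = emeasure ?M B"
    using measure_preserving_map_emeasure[OF T(1) B] by simp
  also have "\<dots> = emeasure (distr ?M cgauss (\<lambda>u. u (k, 0))) {z. 2 * r \<le> (cmod z)\<^sup>2}"
    by (subst emeasure_distr[OF coord C]) (simp add: B_def vimage_def Int_def conj_commute)
  also have "distr ?M cgauss (\<lambda>u. u (k, 0)) = cgauss"
    using L by (intro distr_PiM_component prob_space_cgauss) auto
  finally show ?thesis using emeasure_cgauss_ge[OF r] by simp
qed

lemma borel_measurable_SUP_array_exp:
  fixes b :: real
  assumes "countable W"
  shows "(\<lambda>H. SUP w\<in>W. ennreal (exp (- b * (\<Sum>j\<in>J. (cmod (H (i0, j) + (\<Sum>i\<in>L'. w i * H (i, j))))\<^sup>2) / 2)))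
    \<in> borel_measurable (gauss_PiM (insert i0 L' \<times> J))"
proof (rule borel_measurable_SUP[OF assms])
  fix w
  have "(\<lambda>H. \<Sum>j\<in>J. (cmod (H (i0, j) + (\<Sum>i\<in>L'. w i * H (i, j))))\<^sup>2) \<in> borel_measurable (gauss_PiM (insert i0 L' \<times> J))"
    by (intro borel_measurable_sum borel_measurable_power measurable_compose[OF _ borel_measurable_norm]
        borel_measurable_add borel_measurable_times measurable_gauss_coord borel_measurable_const) auto
  then show "(\<lambda>H. ennreal (exp (- b * (\<Sum>j\<in>J. (cmod (H (i0, j) + (\<Sum>i\<in>L'. w i * H (i, j))))\<^sup>2) / 2)))
    \<in> borel_measurable (gauss_PiM (insert i0 L' \<times> J))"
    by measurable
qed

text \<open>For fixed rows in \<open>L'\<close> the bound for spans applies with these rows as the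
  vectors \<open>h\<close>. Its right-hand side does not depend on them, so integrating over the
  rows changes nothing.\<close>

lemma nn_integral_exp_dist_array_le:
  fixes b :: real and i0 :: nat and L' J :: "nat set"
  assumes L: "finite L'" "i0 \<notin> L'" and J: "finite J" and b: "0 < b" and W: "countable W"
  shows "(\<integral>\<^sup>+H. (SUP w\<in>W. ennreal (exp (- b * (\<Sum>j\<in>J. (cmod (H (i0, j) + (\<Sum>i\<in>L'. w i * H (i, j))))\<^sup>2) / 2)))
      \<partial>gauss_PiM (insert i0 L' \<times> J)) \<le> ennreal ((1 / (1 + b)) ^ (card J - card L'))"
    (is "(\<integral>\<^sup>+H. ?F H \<partial>_) \<le> ?C")
proof -
  interpret product_sigma_finite "\<lambda>_. cgauss" by (rule product_sigma_finite_cgauss)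
  have un: "insert i0 L' \<times> J = (L' \<times> J) \<union> ({i0} \<times> J)" by auto
  have F: "?F \<in> borel_measurable (gauss_PiM ((L' \<times> J) \<union> ({i0} \<times> J)))"
    using borel_measurable_SUP_array_exp[OF W, where b=b and J=J and L'=L' and ?i0.0=i0] unfolding un .
  have "(\<integral>\<^sup>+H. ?F H \<partial>gauss_PiM (insert i0 L' \<times> J))
    = (\<integral>\<^sup>+H. \<integral>\<^sup>+A. ?F (merge (L' \<times> J) ({i0} \<times> J) (H, A)) \<partial>gauss_PiM ({i0} \<times> J) \<partial>gauss_PiM (L' \<times> J))"
    unfolding un by (rule product_nn_integral_fold[OF _ _ _ F]) (use L J in auto)
  also have "\<dots> \<le> (\<integral>\<^sup>+H. ?C \<partial>gauss_PiM (L' \<times> J))"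
  proof (rule nn_integral_mono)
    fix H
    have "(\<Sum>j\<in>J. (cmod (merge (L' \<times> J) ({i0} \<times> J) (H, A) (i0, j)
        + (\<Sum>i\<in>L'. w i * merge (L' \<times> J) ({i0} \<times> J) (H, A) (i, j))))\<^sup>2)
       = (\<Sum>j\<in>J. (cmod (A (i0, j) + (\<Sum>i\<in>L'. w i * H (i, j))))\<^sup>2)" for A w
    proof (rule sum.cong[OF refl])
      fix j assume j: "j \<in> J"
      have "(\<Sum>i\<in>L'. w i * merge (L' \<times> J) ({i0} \<times> J) (H, A) (i, j)) = (\<Sum>i\<in>L'. w i * H (i, j))"
        using j by (intro sum.cong) (auto simp: merge_def)
      moreover have "merge (L' \<times> J) ({i0} \<times> J) (H, A) (i0, j) = A (i0, j)"
        using j L(2) by (simp add: merge_def)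
      ultimately show "(cmod (merge (L' \<times> J) ({i0} \<times> J) (H, A) (i0, j)
        + (\<Sum>i\<in>L'. w i * merge (L' \<times> J) ({i0} \<times> J) (H, A) (i, j))))\<^sup>2
        = (cmod (A (i0, j) + (\<Sum>i\<in>L'. w i * H (i, j))))\<^sup>2" by (simp only:)
    qed
    then show "(\<integral>\<^sup>+A. ?F (merge (L' \<times> J) ({i0} \<times> J) (H, A)) \<partial>gauss_PiM ({i0} \<times> J)) \<le> ?C"
      using nn_integral_exp_dist_span_le[OF J L(1) b, where W=W and ?i0.0=i0 and h="\<lambda>i j. H (i, j)"] by (simp only:)
  qed
  also have "\<dots> = ?C"
    using prob_space.emeasure_space_1[OF prob_space_gauss_PiM[of "L' \<times> J"]] by simp
  finally show ?thesis .
qed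

section \<open>Probe-vector bound for the least singular value\<close>

lemma sum_eq_single:
  assumes "finite L" "k \<in> L" "\<And>i. i \<in> L \<Longrightarrow> i \<noteq> k \<Longrightarrow> f i = 0"
  shows "(\<Sum>i\<in>L. f i) = (f k :: 'a::comm_monoid_add)"
  using sum.remove[OF assms(1,2), of f] assms(3) by simp

text \<open>For a probe vector \<open>u\<close>, the infimum over \<open>z\<close> of \<open>\<bar>u\<bar>\<^sup>2 \<cdot> array_energy L J G z / \<bar>\<langle>u, z\<rangle>\<bar>\<^sup>2\<close>
  is the squared distance of one Gaussian vector in \<open>\<complex>\<^sup>J\<close> to the span of \<open>card L - 1\<close> others,
  whatever \<open>u\<close> is.\<close>
definition probe_weight :: "nat set \<Rightarrow> nat set \<Rightarrow> real \<Rightarrow> real \<Rightarrow> (nat \<Rightarrow> complex) \<Rightarrow>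
    (nat \<times> nat \<Rightarrow> complex) \<Rightarrow> (nat \<times> nat \<Rightarrow> complex) \<Rightarrow> ennreal" where
  "probe_weight L J a b z G u =
    (if (\<Sum>i\<in>L. cnj (u (i, 0)) * z i) = 0 then 0 else
      ennreal (exp (a * (\<Sum>i\<in>L. (cmod (u (i, 0)))\<^sup>2) / 2
        - b * (\<Sum>i\<in>L. (cmod (u (i, 0)))\<^sup>2) * array_energy L J G z / (2 * (cmod (\<Sum>i\<in>L. cnj (u (i, 0)) * z i))\<^sup>2))))"

lemma measurable_probe_weight:
  assumes f: "f \<in> measurable M (gauss_PiM (L \<times> J))" and g: "g \<in> measurable M (gauss_PiM (L \<times> {0}))"
  shows "(\<lambda>x. probe_weight L J a b z (f x) (g x)) \<in> borel_measurable M"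
proof -
  have g': "(\<lambda>x. g x (i, 0)) \<in> borel_measurable M" if "i \<in> L" for i
    using measurable_compose[OF g measurable_gauss_coord] that by simp
  have [measurable]: "(\<lambda>x. \<Sum>i\<in>L. cnj (g x (i, 0)) * z i) \<in> borel_measurable M"
    by (intro borel_measurable_array_form g')
  have [measurable]: "(\<lambda>x. \<Sum>i\<in>L. (cmod (g x (i, 0)))\<^sup>2) \<in> borel_measurable M"
    by (intro borel_measurable_sum borel_measurable_power measurable_compose[OF _ borel_measurable_norm] g')
  note [measurable] = borel_measurable_array_energy[OF f]
  show ?thesis unfolding probe_weight_def by measurable
qed

text \<open>Rotate \<open>u\<close> to the axis \<open>k\<close>. Then the product of
  \<open>u\<close> and \<open>z\<close> involves only \<open>V z k\<close>, and dividing by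
  \<open>V z k\<close> turns the energy of \<open>z\<close> into the squared norm of row
  \<open>k\<close> plus a combination of the other \<open>card L - 1\<close> rows. All
  \<open>z\<close> are thus covered by one supremum over coefficients, and the direction of
  \<open>u\<close> disappears.\<close>

lemma nn_integral_probe_weight_le:
  fixes L J :: "nat set" and a b :: real and Z :: "(nat \<Rightarrow> complex) set"
  assumes L: "finite L" "k \<in> L" and J: "finite J" and b: "0 < b" and Z: "countable Z"
  shows "(\<integral>\<^sup>+G. (SUP z\<in>Z. probe_weight L J a b z G u) \<partial>gauss_PiM (L \<times> J))
    \<le> ennreal (exp (a * (\<Sum>i\<in>L. (cmod (u (i, 0)))\<^sup>2) / 2)) * ennreal ((1 / (1 + b)) ^ (card J - (card L - 1)))"
proof -
  define n where "n = (\<Sum>i\<in>L. (cmod (u (i, 0)))\<^sup>2)"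
  define q where "q = (\<lambda>i. u (i, 0))"
  obtain V where V: "gauss_unitary L V" "\<And>i. i \<in> L \<Longrightarrow> i \<noteq> k \<Longrightarrow> V q i = 0"
    by (rule gauss_unitary_to_axis[OF L, of q]) blast
  obtain T where T: "measure_preserving_map (gauss_PiM (L \<times> J)) T"
    "\<forall>A. \<forall>i\<in>L. \<forall>j\<in>J. T A (i, j) = V (\<lambda>i. A (i, j)) i"
    using gauss_unitary_columns[OF V(1) L(1) J] by blast
  define L' where "L' = L - {k}"
  have L': "finite L'" "k \<notin> L'" "L = insert k L'" "card L' = card L - 1" using L by (auto simp: L'_def)
  define W where "W = (\<lambda>z i. cnj (V z i / V z k)) ` Z"
  define F' where "F' = (\<lambda>H. SUP w\<in>W. ennreal (exp (- b * (\<Sum>j\<in>J. (cmod (H (k, j) + (\<Sum>i\<in>L'. w i * H (i, j))))\<^sup>2) / 2)))"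
  have W: "countable W" using Z by (simp add: W_def)
  have F': "F' \<in> borel_measurable (gauss_PiM (L \<times> J))"
    unfolding F'_def L'(3) by (rule borel_measurable_SUP_array_exp[OF W])
  have n: "n = (cmod (V q k))\<^sup>2"
    unfolding n_def q_def[symmetric] using gauss_unitary_norm[OF V(1), of q] sum_eq_single[OF L, of "\<lambda>i. (cmod (V q i))\<^sup>2"] V(2)
    by (simp add: q_def)
  have ip: "(\<Sum>i\<in>L. cnj (u (i, 0)) * z i) = cnj (V q k) * V z k" for z
    using gauss_unitary_ip[OF V(1), of q z] sum_eq_single[OF L, of "\<lambda>i. cnj (V q i) * V z i"] V(2)
    by (simp add: q_def)
  have pt: "probe_weight L J a b z G u \<le> ennreal (exp (a * n / 2)) * F' (T G)" if z: "z \<in> Z" for z G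
  proof (cases "V q k = 0 \<or> V z k = 0")
    \<comment> \<open>The guard in \<open>probe_weight\<close> matters here. Since division by zero
      yields 0, the unguarded formula would give the weight exp (a n / 2), which \<open>F'\<close>
      need not dominate; the value 0 is the correct limit for an infinite ratio.\<close>
    case True
    then show ?thesis by (auto simp: probe_weight_def ip)
  next
    case False
    then have nz: "V q k \<noteq> 0" "V z k \<noteq> 0" by auto
    let ?w = "\<lambda>i. cnj (V z i / V z k)"
    let ?S = "\<Sum>j\<in>J. (cmod (T G (k, j) + (\<Sum>i\<in>L'. ?w i * T G (i, j))))\<^sup>2"
    have "array_energy L J G z = (\<Sum>j\<in>J. (cmod (V z k))\<^sup>2 * (cmod (T G (k, j) + (\<Sum>i\<in>L'. ?w i * T G (i, j))))\<^sup>2)"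
      unfolding array_energy_def
    proof (rule sum.cong[OF refl])
      fix j assume j: "j \<in> J"
      have "(\<Sum>i\<in>L. cnj (G (i, j)) * z i) = (\<Sum>i\<in>L. cnj (V (\<lambda>i. G (i, j)) i) * V z i)"
        by (rule gauss_unitary_ip[OF V(1), symmetric])
      also have "\<dots> = (\<Sum>i\<in>L. cnj (T G (i, j)) * V z i)"
        using T(2) j by (intro sum.cong) auto
      also have "\<dots> = cnj (T G (k, j)) * V z k + (\<Sum>i\<in>L'. cnj (T G (i, j)) * V z i)"
        unfolding L'(3) using L'(1,2) by simp
      also have "\<dots> = V z k * cnj (T G (k, j) + (\<Sum>i\<in>L'. ?w i * T G (i, j)))"
        using nz(2) by (simp add: algebra_simps sum_distrib_left)
      finally have "cmod (\<Sum>i\<in>L. cnj (G (i, j)) * z i) = cmod (V z k) * cmod (T G (k, j) + (\<Sum>i\<in>L'. ?w i * T G (i, j)))"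
        by (simp only: norm_mult complex_mod_cnj)
      then show "(cmod (\<Sum>i\<in>L. cnj (G (i, j)) * z i))\<^sup>2 = (cmod (V z k))\<^sup>2 * (cmod (T G (k, j) + (\<Sum>i\<in>L'. ?w i * T G (i, j))))\<^sup>2"
        by (simp only: power_mult_distrib)
    qed
    then have e: "array_energy L J G z = (cmod (V z k))\<^sup>2 * ?S" by (simp only: sum_distrib_left)
    have "b * n * array_energy L J G z / (2 * (cmod (\<Sum>i\<in>L. cnj (u (i, 0)) * z i))\<^sup>2) = b * ?S / 2"
      unfolding e ip n using nz by (simp add: norm_mult power_mult_distrib)
    then have "probe_weight L J a b z G u = ennreal (exp (a * n / 2 - b * ?S / 2))"
      using nz by (simp add: probe_weight_def ip n_def[symmetric])
    also have "\<dots> = ennreal (exp (a * n / 2)) * ennreal (exp (- b * ?S / 2))"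
      by (simp add: ennreal_mult[symmetric] exp_add[symmetric])
    also have "\<dots> \<le> ennreal (exp (a * n / 2)) * F' (T G)"
      unfolding F'_def W_def using z by (intro mult_left_mono SUP_upper2[OF imageI order_refl]) auto
    finally show ?thesis .
  qed
  have "(\<integral>\<^sup>+G. (SUP z\<in>Z. probe_weight L J a b z G u) \<partial>gauss_PiM (L \<times> J))
    \<le> (\<integral>\<^sup>+G. ennreal (exp (a * n / 2)) * F' (T G) \<partial>gauss_PiM (L \<times> J))"
    by (intro nn_integral_mono SUP_least pt)
  also have "\<dots> = ennreal (exp (a * n / 2)) * (\<integral>\<^sup>+G. F' (T G) \<partial>gauss_PiM (L \<times> J))"
    by (rule nn_integral_cmult) (rule measurable_compose[OF measure_preserving_map_measurable[OF T(1)] F'])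
  also have "(\<integral>\<^sup>+G. F' (T G) \<partial>gauss_PiM (L \<times> J)) = (\<integral>\<^sup>+G. F' G \<partial>gauss_PiM (L \<times> J))"
    by (rule measure_preserving_map_nn_integral[OF T(1) F'])
  also have "ennreal (exp (a * n / 2)) * \<dots> \<le> ennreal (exp (a * n / 2)) * ennreal ((1 / (1 + b)) ^ (card J - (card L - 1)))"
    using nn_integral_exp_dist_array_le[OF L'(1,2) J b W]
    unfolding F'_def L'(3)[symmetric] L'(4) by (intro mult_left_mono) auto
  finally show ?thesis by (simp only: n_def)
qed

lemma array_energy_small_event_sets:
  fixes x :: real
  assumes "countable Z"
  shows "{G \<in> space (gauss_PiM (L \<times> J)). \<exists>z\<in>Z. array_energy L J G z < 2 * x * (\<Sum>i\<in>L. (cmod (z i))\<^sup>2)}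
    \<in> sets (gauss_PiM (L \<times> J))"
proof -
  have "{G \<in> space (gauss_PiM (L \<times> J)). \<exists>z\<in>Z. array_energy L J G z < 2 * x * (\<Sum>i\<in>L. (cmod (z i))\<^sup>2)}
    = (\<Union>z\<in>Z. {G \<in> space (gauss_PiM (L \<times> J)). array_energy L J G z < 2 * x * (\<Sum>i\<in>L. (cmod (z i))\<^sup>2)})"
    by auto
  also have "\<dots> \<in> sets (gauss_PiM (L \<times> J))"
  proof (rule sets.countable_UN''[OF assms])
    fix z
    have [measurable]: "(\<lambda>G. array_energy L J G z) \<in> borel_measurable (gauss_PiM (L \<times> J))"
      by (rule borel_measurable_array_energy[OF measurable_ident_sets[OF refl]])
    show "{G \<in> space (gauss_PiM (L \<times> J)). array_energy L J G z < 2 * x * (\<Sum>i\<in>L. (cmod (z i))\<^sup>2)}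
      \<in> sets (gauss_PiM (L \<times> J))" by measurable
  qed
  finally show ?thesis .
qed

text \<open>If \<open>G\<close> is bad with witness \<open>z\<close>, every probe with |<u, z>|^2 >=
  2 r |z|^2 has weight at least 1, and such probes have probability exp (- r). So exp (- r) times
  the probability of the bad event is at most the expected supremum of the weights. That expectation
  is taken in the other order: over \<open>G\<close> for fixed \<open>u\<close>, then over
  \<open>u\<close>, where exp (a |u|^2 / 2) has mean (1 / (1 - a)) ^ card L.\<close>

lemma emeasure_array_energy_small_le:
  fixes a r x :: real and L J :: "nat set" and Z :: "(nat \<Rightarrow> complex) set"
  assumes L: "finite L" "L \<noteq> {}" and J: "finite J" and Z: "countable Z"
    and a: "0 < a" "a < 1" and r: "0 < r" and x: "0 < x"
  shows "emeasure (gauss_PiM (L \<times> J))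
      {G \<in> space (gauss_PiM (L \<times> J)). \<exists>z\<in>Z. array_energy L J G z < 2 * x * (\<Sum>i\<in>L. (cmod (z i))\<^sup>2)}
    \<le> ennreal (exp r * (1 / (1 - a)) ^ card L * (1 / (1 + a * r / x)) ^ (card J - (card L - 1)))"
    (is "emeasure ?M ?bad \<le> _")
proof -
  \<comment> \<open>On the probe event the ratio of the energy to |<u, z>|^2 is below x / r, so this
    is the largest \<open>b\<close> for which that estimate keeps the exponent of the weight
    nonnegative.\<close>
  define b where "b = a * r / x"
  have b: "0 < b" using a r x by (simp add: b_def)
  let ?U = "gauss_PiM (L \<times> {0::nat})"
  let ?F = "\<lambda>G u. SUP z\<in>Z. probe_weight L J a b z G u"
  obtain k where k: "k \<in> L" using L by auto
  interpret M: prob_space ?M by (rule prob_space_gauss_PiM)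
  interpret U: prob_space ?U by (rule prob_space_gauss_PiM)
  interpret MU: pair_sigma_finite ?M ?U ..
  have bad: "?bad \<in> sets ?M" by (rule array_energy_small_event_sets[OF Z])
  have F: "(\<lambda>(G, u). ?F G u) \<in> borel_measurable (?M \<Otimes>\<^sub>M ?U)"
    unfolding split_beta' by (intro borel_measurable_SUP[OF Z] measurable_probe_weight) auto
  have low: "ennreal (exp (- r)) * indicator ?bad G \<le> (\<integral>\<^sup>+u. ?F G u \<partial>?U)" if G: "G \<in> space ?M" for G
  proof (cases "G \<in> ?bad")
    case True
    then obtain z where z: "z \<in> Z" "array_energy L J G z < 2 * x * (\<Sum>i\<in>L. (cmod (z i))\<^sup>2)" by auto
    let ?n = "\<Sum>i\<in>L. (cmod (z i))\<^sup>2"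
    have n: "0 < ?n" using z(2) array_energy_nonneg[of L J G z] x
      by (metis less_le_trans le_less_trans mult_less_cancel_left_pos mult_zero_right zero_less_mult_iff zero_less_numeral)
    have "\<exists>i\<in>L. z i \<noteq> 0"
    proof (rule ccontr)
      assume "\<not> ?thesis"
      then have "?n = 0" by simp
      then show False using n by simp
    qed
    note tail = emeasure_gauss_form_ge[OF L(1) k less_imp_le[OF r] this]
    let ?E = "{u \<in> space ?U. 2 * r * ?n \<le> (cmod (\<Sum>i\<in>L. cnj (u (i, 0)) * z i))\<^sup>2}"
    have E: "?E \<in> sets ?U"
    proof -
      have "(\<lambda>u. (cmod (\<Sum>i\<in>L. cnj (u (i, 0)) * z i))\<^sup>2) \<in> borel_measurable ?U"
        by (intro borel_measurable_power measurable_compose[OF _ borel_measurable_norm]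
            borel_measurable_array_form measurable_gauss_coord) auto
      then show ?thesis by measurable
    qed
    have "ennreal (exp (- r)) = (\<integral>\<^sup>+u. indicator ?E u \<partial>?U)"
      using tail E by simp
    also have "\<dots> \<le> (\<integral>\<^sup>+u. ?F G u \<partial>?U)"
    proof (rule nn_integral_mono)
      fix u
      show "indicator ?E u \<le> ?F G u"
      proof (cases "u \<in> ?E")
        case True
        define y where "y = (cmod (\<Sum>i\<in>L. cnj (u (i, 0)) * z i))\<^sup>2"
        define m where "m = (\<Sum>i\<in>L. (cmod (u (i, 0)))\<^sup>2)"
        have m: "0 \<le> m" by (simp add: m_def sum_nonneg)
        have y: "2 * r * ?n \<le> y" using True by (simp add: y_def)
        have ypos: "0 < y" using y r n by (smt (verit) mult_pos_pos)
        then have nz: "(\<Sum>i\<in>L. cnj (u (i, 0)) * z i) \<noteq> 0" by (auto simp: y_def)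
        have "r * array_energy L J G z \<le> r * (2 * x * ?n)"
          using z(2) r by (intro mult_left_mono) auto
        also have "\<dots> = x * (2 * r * ?n)" by simp
        also have "\<dots> \<le> x * y" using y x by (intro mult_left_mono) auto
        finally have "r * array_energy L J G z / (x * y) \<le> 1"
          using x ypos by (simp add: divide_le_eq)
        then have "a * m / 2 * (r * array_energy L J G z / (x * y)) \<le> a * m / 2 * 1"
          using a m by (intro mult_left_mono) auto
        then have "0 \<le> a * m / 2 - b * m * array_energy L J G z / (2 * y)"
          by (simp add: b_def field_simps)
        then have "1 \<le> probe_weight L J a b z G u"
          using nz by (simp add: probe_weight_def m_def[symmetric] y_def[symmetric] ennreal_ge_1)
        also have "\<dots> \<le> ?F G u" by (rule SUP_upper[OF z(1)])
        finally show ?thesis using True by simp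
      qed simp
    qed
    finally show ?thesis using True by simp
  qed simp
  have "ennreal (exp (- r)) * emeasure ?M ?bad = (\<integral>\<^sup>+G. ennreal (exp (- r)) * indicator ?bad G \<partial>?M)"
    using bad by (simp add: nn_integral_cmult_indicator)
  also have "\<dots> \<le> (\<integral>\<^sup>+G. \<integral>\<^sup>+u. ?F G u \<partial>?U \<partial>?M)"
    by (rule nn_integral_mono) (rule low)
  also have "\<dots> = (\<integral>\<^sup>+u. \<integral>\<^sup>+G. ?F G u \<partial>?M \<partial>?U)"
    by (rule MU.Fubini'[symmetric]) (rule F)
  also have "\<dots> \<le> (\<integral>\<^sup>+u. ennreal (exp (a * (\<Sum>i\<in>L. (cmod (u (i, 0)))\<^sup>2) / 2)) * ennreal ((1 / (1 + b)) ^ (card J - (card L - 1))) \<partial>?U)"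
    by (intro nn_integral_mono nn_integral_probe_weight_le[OF L(1) k J b Z])
  also have "\<dots> = (\<integral>\<^sup>+u. ennreal (exp (a * (\<Sum>i\<in>L. (cmod (u (i, 0)))\<^sup>2) / 2)) \<partial>?U) * ennreal ((1 / (1 + b)) ^ (card J - (card L - 1)))"
  proof (rule nn_integral_multc)
    have "(\<lambda>u. \<Sum>i\<in>L. (cmod (u (i, 0)))\<^sup>2) \<in> borel_measurable ?U"
      by (intro borel_measurable_sum borel_measurable_power measurable_compose[OF _ borel_measurable_norm] measurable_gauss_coord) auto
    then show "(\<lambda>u. ennreal (exp (a * (\<Sum>i\<in>L. (cmod (u (i, 0)))\<^sup>2) / 2))) \<in> borel_measurable ?U" by measurable
  qed
  also have "(\<integral>\<^sup>+u. ennreal (exp (a * (\<Sum>i\<in>L. (cmod (u (i, 0)))\<^sup>2) / 2)) \<partial>?U) = ennreal ((1 / (1 - a)) ^ card L)"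
  proof -
    have "(\<Sum>i\<in>L. (cmod (u (i, 0::nat)))\<^sup>2) = (\<Sum>k\<in>L \<times> {0}. (cmod (u k))\<^sup>2)" for u
      by (rule sum.reindex_bij_witness[of _ fst "\<lambda>i. (i, 0)"]) auto
    then show ?thesis
      using nn_integral_gauss_PiM_exp_sq[of "L \<times> {0::nat}" "L \<times> {0}" "- a"] L(1) a by (simp add: card_cartesian_product)
  qed
  finally have "ennreal (exp r) * (ennreal (exp (- r)) * emeasure ?M ?bad)
     \<le> ennreal (exp r) * (ennreal ((1 / (1 - a)) ^ card L) * ennreal ((1 / (1 + b)) ^ (card J - (card L - 1))))"
    by (intro mult_left_mono) auto
  moreover have "ennreal (exp r) * (ennreal (exp (- r)) * emeasure ?M ?bad) = emeasure ?M ?bad"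
    by (simp add: mult.assoc[symmetric] ennreal_mult[symmetric] exp_minus_inverse)
  moreover have "ennreal (exp r) * (ennreal ((1 / (1 - a)) ^ card L) * ennreal ((1 / (1 + b)) ^ (card J - (card L - 1))))
      = ennreal (exp r * (1 / (1 - a)) ^ card L * (1 / (1 + b)) ^ (card J - (card L - 1)))"
    using a b by (simp add: ennreal_mult[symmetric] mult.assoc)
  ultimately show ?thesis by (simp only: b_def)
qed

section \<open>Choice of the parameters in the tail bound\<close>

lemma exp_double_ge:
  fixes b c x :: real
  assumes "b \<le> exp x" "0 \<le> b" "c \<le> b * b"
  shows "c \<le> exp (2 * x)"
proof -
  have "b * b \<le> exp x * exp x" using assms by (intro mult_mono) auto
  then show ?thesis using assms(3) by (simp add: exp_add[symmetric])
qed

text \<open>The inequality exp (- 68/100) >= 1/2 is certified by five squarings with downward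
  rounding, starting from 1 + y <= exp y at y = - 17/800 = - (68/100) / 32. The bound on ln (11/20)
  is obtained in the same way from - 59/3200.\<close>

lemma ln_2_ge: "68 / 100 \<le> ln (2::real)"
proof -
  have "97875 / 100000 \<le> exp (- 17 / 800 :: real)"
    using exp_ge_add_one_self[of "- 17 / 800 :: real"] by simp
  then have "9579 / 10000 \<le> exp (2 * (- 17 / 800) :: real)" by (rule exp_double_ge) auto
  then have "9175 / 10000 \<le> exp (2 * (2 * (- 17 / 800)) :: real)" by (rule exp_double_ge) auto
  then have "8417 / 10000 \<le> exp (2 * (2 * (2 * (- 17 / 800))) :: real)" by (rule exp_double_ge) auto
  then have "7084 / 10000 \<le> exp (2 * (2 * (2 * (2 * (- 17 / 800)))) :: real)" by (rule exp_double_ge) auto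
  then have "1 / 2 \<le> exp (2 * (2 * (2 * (2 * (2 * (- 17 / 800))))) :: real)" by (rule exp_double_ge) auto
  then have "ln (1 / 2) \<le> ln (exp (2 * (2 * (2 * (2 * (2 * (- 17 / 800))))) :: real))"
    by (subst ln_le_cancel_iff) auto
  then show ?thesis by (simp add: ln_div)
qed

lemma ln_11_20_le: "ln (11 / 20 :: real) \<le> - 59 / 100"
proof -
  have "98156 / 100000 \<le> exp (- 59 / 3200 :: real)"
    using exp_ge_add_one_self[of "- 59 / 3200 :: real"] by simp
  then have "96346 / 100000 \<le> exp (2 * (- 59 / 3200) :: real)" by (rule exp_double_ge) auto
  then have "92825 / 100000 \<le> exp (2 * (2 * (- 59 / 3200)) :: real)" by (rule exp_double_ge) auto
  then have "86164 / 100000 \<le> exp (2 * (2 * (2 * (- 59 / 3200))) :: real)" by (rule exp_double_ge) auto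
  then have "74242 / 100000 \<le> exp (2 * (2 * (2 * (2 * (- 59 / 3200)))) :: real)" by (rule exp_double_ge) auto
  then have "11 / 20 \<le> exp (2 * (2 * (2 * (2 * (2 * (- 59 / 3200))))) :: real)" by (rule exp_double_ge) auto
  then have "ln (11 / 20) \<le> ln (exp (2 * (2 * (2 * (2 * (2 * (- 59 / 3200))))) :: real))"
    by (subst ln_le_cancel_iff) auto
  then show ?thesis by simp
qed

lemma ln_one_plus_chord:
  fixes s :: real
  assumes "0 \<le> s" "s \<le> 1"
  shows "s * ln 2 \<le> ln (1 + s)"
proof -
  have "concave_on {0<..} (ln :: real \<Rightarrow> real)" by (rule ln_concave)
  from concave_onD[OF this, of s 1 2] assms show ?thesis by (simp add: algebra_simps)
qed

text \<open>With q = sqrt (p / m) the left-hand side bounds the exponent of the tail estimate per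
  unit of m - p. It is estimated by (11/20) / (1 + q)^2 >= 42/100 - 36/100 q, ln (1 + q) >= 68/100 q
  and ln (11/20) <= - 59/100. The slopes are chosen so that the terms in q cancel, which leaves
  58/100 - 59/100.\<close>

lemma edge_exponent_bound:
  fixes q :: real
  assumes q: "0 \<le> q" "q \<le> 1"
  shows "1 + q - (11 / 20) / (1 + q)\<^sup>2 - ln ((1 + q)\<^sup>2 / (11 / 20)) \<le> - 1 / 100"
proof -
  \<comment> \<open>The cubic polynomial to be kept below 11/20 peaks at about q = 4/9, so
    \<open>q ^ 3\<close> and the square of \<open>q\<close> are replaced by their tangents at
    9/20.\<close>
  have "0 \<le> (q - 9 / 20)\<^sup>2 * (q + 9 / 10)" using q by simp
  also have "\<dots> = q ^ 3 - 243 / 400 * q + 729 / 4000"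
    by (simp add: power2_eq_square power3_eq_cube field_simps)
  finally have c: "243 / 400 * q - 729 / 4000 \<le> q ^ 3" by simp
  have "0 \<le> (q - 9 / 20)\<^sup>2" by simp
  then have c2: "9 / 10 * q - 81 / 400 \<le> q\<^sup>2"
    by (simp add: power2_eq_square algebra_simps)
  have "(42 / 100 - 36 / 100 * q) * (1 + q)\<^sup>2 = 42 / 100 + 48 / 100 * q - 30 / 100 * q\<^sup>2 - 36 / 100 * q ^ 3"
    by (simp add: power2_eq_square power3_eq_cube field_simps)
  also have "\<dots> \<le> 11 / 20" using c c2 q by linarith
  finally have "42 / 100 - 36 / 100 * q \<le> (11 / 20) / (1 + q)\<^sup>2"
    using q by (simp add: pos_le_divide_eq)
  moreover have "ln ((1 + q)\<^sup>2 / (11 / 20)) = 2 * ln (1 + q) - ln (11 / 20)"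
    using q by (subst ln_div) (auto simp: ln_realpow)
  moreover have "68 / 100 * q \<le> ln (1 + q)"
    using ln_one_plus_chord[OF q] mult_left_mono[OF ln_2_ge q(1)] by (simp add: mult.commute)
  ultimately show ?thesis using ln_11_20_le by linarith
qed

text \<open>The difference of the two sides vanishes at 1 and has derivative (1 - 1 / t)^2. The case
  y = 1 / q is the one that matters, where p (1 / q - q) = (m - p) q.\<close>

lemma two_ln_le:
  fixes y :: real
  assumes "1 \<le> y"
  shows "2 * ln y \<le> y - 1 / y"
proof (cases "y = 1")
  case False
  then have y: "1 < y" using assms by simp
  let ?f = "\<lambda>y::real. y - 1 / y - 2 * ln y"
  have "?f 1 \<le> ?f y"
  proof (rule DERIV_nonneg_imp_nondecreasing[OF assms])
    fix t :: real assume t: "1 \<le> t" "t \<le> y"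
    have "(?f has_real_derivative (1 + 1 / t\<^sup>2 - 2 / t)) (at t)"
      using t by (auto intro!: derivative_eq_intros simp: field_simps power2_eq_square)
    moreover have "1 + 1 / t\<^sup>2 - 2 / t = (1 - 1 / t)\<^sup>2"
      using t by (simp add: power2_eq_square field_simps)
    ultimately show "\<exists>d. (?f has_real_derivative d) (at t) \<and> 0 \<le> d" by fastforce
  qed
  then show ?thesis by simp
qed simp

text \<open>Put d = m - p and lower the exponent m - p + 1 to d. Then \<open>r\<close> is the
  stationary point of the bound for given \<open>a\<close>, and a = d / m is stationary in the limit
  x -> 0. With q = sqrt (p / m) this gives 1 - a = q^2 and 1 + a r / x = (1 + q)^2 / (11/20): the
  factors 1 - q cancel, so the rate per unit of d stays bounded away from 0 as q tends to 1.\<close>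

lemma chernoff_parameters:
  fixes m p :: nat
  assumes p: "0 < p" "p < m"
  defines "x \<equiv> 11 / 20 * (sqrt m - sqrt p)\<^sup>2"
  defines "a \<equiv> (real m - real p) / real m"
  defines "r \<equiv> (real m - real p) - x / a"
  shows "0 < x" "0 < a" "a < 1" "0 < r"
    "exp r * (1 / (1 - a)) ^ p * (1 / (1 + a * r / x)) ^ (m - (p - 1)) \<le> exp (- (real m - real p) / 100)"
proof -
  define d where "d = real m - real p"
  define q where "q = sqrt (real p / real m)"
  have m: "0 < real m" "0 < real p" using p by auto
  have d: "0 < d" using p by (simp add: d_def)
  have q: "0 < q" "q < 1" using p m by (simp_all add: q_def)
  have q2: "q\<^sup>2 = real p / real m" by (simp add: q_def)
  have pq: "real p = q\<^sup>2 * real m" using m by (simp add: q2)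
  have sp: "sqrt (real p) = q * sqrt (real m)" using m by (simp add: q_def real_sqrt_divide)
  have dq: "d = real m * ((1 - q) * (1 + q))" by (simp add: d_def pq algebra_simps power2_eq_square)
  have xq: "x = 11 / 20 * (real m * (1 - q)\<^sup>2)"
  proof -
    have "sqrt (real m) - sqrt (real p) = sqrt (real m) * (1 - q)" by (simp add: sp algebra_simps)
    then show ?thesis using m by (simp add: x_def power_mult_distrib)
  qed
  have ad: "a = (1 - q) * (1 + q)" unfolding a_def d_def[symmetric] dq using m by simp
  have oa: "1 - a = q\<^sup>2" by (simp add: ad algebra_simps power2_eq_square)
  show x: "0 < x" using m q by (simp add: xq)
  show a: "0 < a" using q by (simp add: ad)
  show a1: "a < 1" using oa q by (smt (verit) zero_less_power)
  have xa: "x / a = d * ((11 / 20) / (1 + q)\<^sup>2)"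
  proof -
    have "11 / 20 * (M * g\<^sup>2) / (g * h) = M * (g * h) * (11 / 20 / h\<^sup>2)" if "0 < g" "0 < h" for M g h :: real
      using that by (simp add: field_simps power2_eq_square)
    from this[of "1 - q" "1 + q"] show ?thesis using q by (simp only: xq ad dq)
  qed
  have rq: "r = d * (1 - (11 / 20) / (1 + q)\<^sup>2)"
    unfolding r_def xa d_def[symmetric] by (simp add: algebra_simps)
  have h: "1 < (1 + q)\<^sup>2" using q by (simp add: one_less_power)
  then have "(11 / 20) / (1 + q)\<^sup>2 < 1" by (simp add: divide_less_eq)
  then show r: "0 < r" using d by (simp add: rq)
  have y: "1 + a * r / x = (1 + q)\<^sup>2 / (11 / 20)"
  proof -
    have "a * r / x = a * d / x - 1"
      using x a by (simp add: r_def d_def[symmetric] field_simps)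
    moreover have "a * d / x = (1 + q)\<^sup>2 / (11 / 20)"
    proof -
      have "g * h * (M * (g * h)) / (11 / 20 * (M * g\<^sup>2)) = h\<^sup>2 / (11 / 20)" if "0 < M" "0 < g" "0 < h" for M g h :: real
        using that by (simp add: field_simps power2_eq_square)
      from this[of "real m" "1 - q" "1 + q"] show ?thesis using q m by (simp only: xq ad dq)
    qed
    ultimately show ?thesis by simp
  qed
  define Y where "Y = (1 + q)\<^sup>2 / (11 / 20)"
  have Y: "1 \<le> Y" using h by (simp add: Y_def)
  have e1: "(1 / (1 - a)) ^ p \<le> exp (d * q)"
  proof -
    have "(1 / (1 - a)) ^ p = exp (real p * (2 * ln (1 / q)))"
    proof -
      have "1 / (1 - a) = exp (2 * ln (1 / q))"
        using q by (simp add: oa exp_double power_divide)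
      then show ?thesis by (simp add: exp_of_nat_mult)
    qed
    also have "\<dots> \<le> exp (real p * (1 / q - 1 / (1 / q)))"
      using q m two_ln_le[of "1 / q"] by (subst exp_le_cancel_iff, intro mult_left_mono) auto
    also have "real p * (1 / q - 1 / (1 / q)) = d * q"
      using q by (simp add: pq dq field_simps power2_eq_square)
    finally show ?thesis .
  qed
  have e2: "(1 / Y) ^ (m - (p - 1)) \<le> exp (- d * ln Y)"
  proof -
    have "(1 / Y) ^ (m - (p - 1)) \<le> (1 / Y) ^ (m - p)"
      using Y by (intro power_decreasing) auto
    also have "\<dots> = exp (real (m - p) * (- ln Y))"
      using Y by (subst exp_of_nat_mult) (simp add: exp_minus inverse_eq_divide)
    also have "\<dots> = exp (- d * ln Y)" using p by (simp add: d_def of_nat_diff algebra_simps)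
    finally show ?thesis .
  qed
  have "exp r * (1 / (1 - a)) ^ p * (1 / (1 + a * r / x)) ^ (m - (p - 1)) \<le> exp r * exp (d * q) * exp (- d * ln Y)"
    unfolding y Y_def[symmetric] using e1 e2 Y a1 by (intro mult_mono) auto
  also have "\<dots> = exp (d * (1 + q - (11 / 20) / (1 + q)\<^sup>2 - ln Y))"
    by (simp add: exp_add[symmetric] rq algebra_simps)
  also have "\<dots> \<le> exp (d * (- 1 / 100))"
    using edge_exponent_bound[of q] q d unfolding Y_def by (subst exp_le_cancel_iff, intro mult_left_mono) auto
  also have "d * (- 1 / 100) = - (real m - real p) / 100" by (simp add: d_def field_simps)
  finally show "exp r * (1 / (1 - a)) ^ p * (1 / (1 + a * r / x)) ^ (m - (p - 1)) \<le> exp (- (real m - real p) / 100)" .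
qed

section \<open>Order statistics of the moduli\<close>

text \<open>The disc and the closed tail overlap on a circle; bounding the integrand there by 1
  gives the estimate from the tail formula alone.\<close>

lemma nn_integral_cgauss_truncation_le:
  fixes \<theta> \<tau> :: real
  assumes "0 \<le> \<theta>" "0 \<le> \<tau>"
  shows "(\<integral>\<^sup>+z. ennreal (if (cmod z)\<^sup>2 \<le> 2 * \<tau> then exp (- \<theta>) else 1) \<partial>cgauss)
    \<le> ennreal (1 - (1 - exp (- \<theta>)) * (1 - exp (- \<tau>)))"
proof -
  have "(\<integral>\<^sup>+z. ennreal (if (cmod z)\<^sup>2 \<le> 2 * \<tau> then exp (- \<theta>) else 1) \<partial>cgauss)
      \<le> (\<integral>\<^sup>+z. ennreal (exp (- \<theta>)) + ennreal (1 - exp (- \<theta>)) * indicator {z. 2 * \<tau> \<le> (cmod z)\<^sup>2} z \<partial>cgauss)"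
    using assms by (intro nn_integral_mono) (auto simp: indicator_def ennreal_plus[symmetric] simp del: ennreal_plus)
  also have "\<dots> = ennreal (exp (- \<theta>)) + ennreal (1 - exp (- \<theta>)) * emeasure cgauss {z. 2 * \<tau> \<le> (cmod z)\<^sup>2}"
    using prob_space.emeasure_space_1[OF prob_space_cgauss]
    by (subst nn_integral_add) (auto simp: nn_integral_cmult_indicator)
  also have "\<dots> = ennreal (exp (- \<theta>) + (1 - exp (- \<theta>)) * exp (- \<tau>))"
    using assms by (simp add: emeasure_cgauss_ge ennreal_mult[symmetric] ennreal_plus[symmetric] del: ennreal_plus)
  also have "exp (- \<theta>) + (1 - exp (- \<theta>)) * exp (- \<tau>) = 1 - (1 - exp (- \<theta>)) * (1 - exp (- \<tau>))"
    by (simp add: algebra_simps)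
  finally show ?thesis .
qed

lemma few_small_coords_sets:
  assumes "finite K"
  shows "{A \<in> space (gauss_PiM K). card {k\<in>K. (cmod (A k))\<^sup>2 \<le> t} < m} \<in> sets (gauss_PiM K)"
proof -
  have eq: "real (card {k\<in>K. (cmod (A k))\<^sup>2 \<le> t}) = (\<Sum>k\<in>K. indicator {z. (cmod z)\<^sup>2 \<le> t} (A k))" for A
    using assms by (simp add: indicator_def sum.If_cases Int_def)
  have [measurable]: "(\<lambda>A. \<Sum>k\<in>K. indicator {z. (cmod z)\<^sup>2 \<le> t} (A k) :: real) \<in> borel_measurable (gauss_PiM K)"
  proof (intro borel_measurable_sum)
    fix k assume "k \<in> K"
    have "(indicator {z. (cmod z)\<^sup>2 \<le> t} :: complex \<Rightarrow> real) \<in> borel_measurable borel" by measurable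
    from measurable_compose[OF measurable_gauss_coord[OF \<open>k \<in> K\<close>] this]
    show "(\<lambda>A. indicator {z. (cmod z)\<^sup>2 \<le> t} (A k) :: real) \<in> borel_measurable (gauss_PiM K)" .
  qed
  have "{A \<in> space (gauss_PiM K). card {k\<in>K. (cmod (A k))\<^sup>2 \<le> t} < m}
     = {A \<in> space (gauss_PiM K). (\<Sum>k\<in>K. indicator {z. (cmod z)\<^sup>2 \<le> t} (A k)) < real m}"
    unfolding eq[symmetric] by simp
  also have "\<dots> \<in> sets (gauss_PiM K)" by measurable
  finally show ?thesis .
qed

lemma emeasure_few_small_coords_le:
  fixes \<theta> \<tau> :: real
  assumes K: "finite K" and \<theta>: "0 \<le> \<theta>" "0 \<le> \<tau>"
  shows "emeasure (gauss_PiM K) {A \<in> space (gauss_PiM K). card {k\<in>K. (cmod (A k))\<^sup>2 \<le> 2 * \<tau>} < m}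
    \<le> ennreal (exp (\<theta> * m) * (1 - (1 - exp (- \<theta>)) * (1 - exp (- \<tau>))) ^ card K)"
    (is "emeasure ?M ?B \<le> _")
proof -
  interpret product_sigma_finite "\<lambda>_. cgauss" by (rule product_sigma_finite_cgauss)
  define g where "g = (\<lambda>z. if (cmod z)\<^sup>2 \<le> 2 * \<tau> then exp (- \<theta>) else 1)"
  have g: "0 \<le> g z" for z by (simp add: g_def)
  have gm: "(\<lambda>z. ennreal (g z)) \<in> borel_measurable cgauss" unfolding g_def by measurable
  have gK: "(\<Prod>k\<in>K. ennreal (g (A k))) = ennreal (exp (- \<theta> * card {k\<in>K. (cmod (A k))\<^sup>2 \<le> 2 * \<tau>}))" for A
  proof -
    have "(\<Prod>k\<in>K. g (A k)) = exp (- \<theta>) ^ card {k\<in>K. (cmod (A k))\<^sup>2 \<le> 2 * \<tau>}"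
      using K by (simp add: g_def prod.If_cases Int_def)
    also have "\<dots> = exp (- \<theta> * card {k\<in>K. (cmod (A k))\<^sup>2 \<le> 2 * \<tau>})"
      by (simp add: exp_of_nat_mult[symmetric] mult.commute)
    finally show ?thesis using g by (simp add: prod_ennreal)
  qed
  have "emeasure ?M ?B = (\<integral>\<^sup>+A. indicator ?B A \<partial>?M)"
    using few_small_coords_sets[OF K] by simp
  also have "\<dots> \<le> (\<integral>\<^sup>+A. ennreal (exp (\<theta> * m)) * (\<Prod>k\<in>K. ennreal (g (A k))) \<partial>?M)"
  proof (rule nn_integral_mono)
    fix A
    show "indicator ?B A \<le> ennreal (exp (\<theta> * m)) * (\<Prod>k\<in>K. ennreal (g (A k)))"
    proof (cases "A \<in> ?B")
      case True
      then have "\<theta> * real (card {k\<in>K. (cmod (A k))\<^sup>2 \<le> 2 * \<tau>}) \<le> \<theta> * m"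
        using \<theta> by (intro mult_left_mono) auto
      then have "1 \<le> exp (\<theta> * m) * exp (- \<theta> * card {k\<in>K. (cmod (A k))\<^sup>2 \<le> 2 * \<tau>})"
        by (simp add: exp_add[symmetric])
      then show ?thesis using True by (simp add: gK ennreal_mult[symmetric] ennreal_ge_1)
    qed simp
  qed
  also have "\<dots> = ennreal (exp (\<theta> * m)) * (\<integral>\<^sup>+A. (\<Prod>k\<in>K. ennreal (g (A k))) \<partial>?M)"
    by (intro nn_integral_cmult borel_measurable_prod_ennreal measurable_compose[OF _ gm] measurable_component_singleton)
  also have "(\<integral>\<^sup>+A. (\<Prod>k\<in>K. ennreal (g (A k))) \<partial>?M) = (\<Prod>k\<in>K. \<integral>\<^sup>+z. ennreal (g z) \<partial>cgauss)"
    by (rule product_nn_integral_prod[OF K gm])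
  also have "ennreal (exp (\<theta> * m)) * \<dots> \<le> ennreal (exp (\<theta> * m)) * (\<Prod>k\<in>K. ennreal (1 - (1 - exp (- \<theta>)) * (1 - exp (- \<tau>))))"
    using nn_integral_cgauss_truncation_le[OF \<theta>] unfolding g_def
    by (simp add: mult_left_mono power_mono)
  also have "\<dots> = ennreal (exp (\<theta> * m) * (1 - (1 - exp (- \<theta>)) * (1 - exp (- \<tau>))) ^ card K)"
  proof -
    have "(1 - exp (- \<theta>)) * (1 - exp (- \<tau>)) \<le> 1"
      using \<theta> by (intro mult_le_one) auto
    then show ?thesis by (simp add: ennreal_power ennreal_mult[symmetric])
  qed
  finally show ?thesis .
qed

lemma one_minus_exp_neg_ge:
  fixes x :: real
  assumes "0 \<le> x"
  shows "x - x\<^sup>2 / 2 \<le> 1 - exp (- x)"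
proof -
  let ?f = "\<lambda>x::real. 1 - exp (- x) - (x - x\<^sup>2 / 2)"
  have "?f 0 \<le> ?f x"
  proof (rule DERIV_nonneg_imp_nondecreasing[OF assms])
    fix t :: real
    have "(?f has_real_derivative (exp (- t) - (1 - t))) (at t)"
      by (auto intro!: derivative_eq_intros)
    moreover have "0 \<le> exp (- t) - (1 - t)" using exp_ge_add_one_self[of "- t"] by simp
    ultimately show "\<exists>d. (?f has_real_derivative d) (at t) \<and> 0 \<le> d" by blast
  qed
  then show ?thesis by simp
qed

text \<open>The threshold makes the expected number of small coordinates about 11/10 m, so having
  fewer than \<open>m\<close> of them is a large deviation.\<close>

lemma emeasure_few_small_coords_le_exp:
  fixes K :: "'k set"
  assumes K: "finite K" "0 < card K" and \<sigma>: "real m / card K \<le> 1 / 100"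
  shows "emeasure (gauss_PiM K) {A \<in> space (gauss_PiM K). card {k\<in>K. (cmod (A k))\<^sup>2 \<le> 2 * (11 / 10 * (real m / card K))} < m}
    \<le> ennreal (exp (- (real m / 300)))"
proof -
  \<comment> \<open>A round value near ln (11/10), the optimal tilt for a Poisson count of mean
    11/10 m. The bounds below give the rate 768/10000 * 994/1000 * 11/10 - 8/100 > 1/300.\<close>
  define \<theta> where "\<theta> = (8 / 100 :: real)"
  define \<tau> where "\<tau> = 11 / 10 * (real m / card K)"
  have \<tau>: "0 \<le> \<tau>" "\<tau> \<le> 11 / 1000" using \<sigma> by (auto simp: \<tau>_def)
  have "768 / 10000 \<le> 1 - exp (- \<theta>)"
    using one_minus_exp_neg_ge[of \<theta>] by (simp add: \<theta>_def power2_eq_square)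
  moreover have "\<tau> * (994 / 1000) \<le> 1 - exp (- \<tau>)"
  proof -
    have "\<tau> * (994 / 1000) \<le> \<tau> * (1 - \<tau> / 2)" using \<tau> by (intro mult_left_mono) auto
    also have "\<dots> \<le> 1 - exp (- \<tau>)" using one_minus_exp_neg_ge[OF \<tau>(1)] by (simp add: power2_eq_square algebra_simps)
    finally show ?thesis .
  qed
  ultimately have "768 / 10000 * (\<tau> * (994 / 1000)) \<le> (1 - exp (- \<theta>)) * (1 - exp (- \<tau>))"
    using \<tau> by (intro mult_mono) (auto simp: \<theta>_def)
  moreover define e where "e = (1 - exp (- \<theta>)) * (1 - exp (- \<tau>))"
  ultimately have e: "768 / 10000 * (\<tau> * (994 / 1000)) \<le> e" by simp
  have e1: "e \<le> 1" unfolding e_def using \<tau> by (intro mult_le_one) (auto simp: \<theta>_def)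
  have "(1 - e) ^ card K \<le> exp (- e) ^ card K"
    using e1 exp_ge_add_one_self[of "- e"] by (intro power_mono) auto
  also have "\<dots> = exp (- (card K * e))" by (simp add: exp_of_nat_mult[symmetric])
  finally have "exp (\<theta> * m) * (1 - e) ^ card K \<le> exp (\<theta> * m) * exp (- (card K * e))"
    by (intro mult_left_mono) auto
  also have "\<dots> = exp (\<theta> * m - card K * e)" by (simp add: exp_diff exp_minus field_simps)
  also have "\<dots> \<le> exp (- (real m / 300))"
  proof -
    have "card K * (768 / 10000 * (\<tau> * (994 / 1000))) \<le> card K * e" using e by (intro mult_left_mono) auto
    moreover have "card K * (768 / 10000 * (\<tau> * (994 / 1000))) = 768 / 10000 * (994 / 1000) * (card K * \<tau>)"
      by simp
    moreover have "card K * \<tau> = 11 / 10 * real m"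
      using K(2) by (simp add: \<tau>_def)
    ultimately have "768 / 10000 * (994 / 1000) * (11 / 10 * real m) \<le> card K * e" by (simp only:)
    then show ?thesis unfolding \<theta>_def by simp
  qed
  finally have "ennreal (exp (\<theta> * m) * (1 - e) ^ card K) \<le> ennreal (exp (- (real m / 300)))"
    by (rule ennreal_leI)
  moreover have "emeasure (gauss_PiM K) {A \<in> space (gauss_PiM K). card {k\<in>K. (cmod (A k))\<^sup>2 \<le> 2 * \<tau>} < m}
    \<le> ennreal (exp (\<theta> * m) * (1 - e) ^ card K)"
    unfolding e_def using \<tau> by (intro emeasure_few_small_coords_le[OF K(1)]) (auto simp: \<theta>_def)
  ultimately show ?thesis unfolding \<tau>_def by (rule order_trans[rotated])
qed

text \<open>Ties have to be excluded for the selected column set to be a function of the moduli.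
  Given coordinate \<open>l\<close>, a tie forces coordinate \<open>k\<close> onto a fixed circle,
  which is a null set.\<close>

lemma null_sets_equal_modulus:
  assumes K: "finite K" "k \<in> K" "l \<in> K" "k \<noteq> l"
  shows "{A \<in> space (gauss_PiM K). cmod (A k) = cmod (A l)} \<in> null_sets (gauss_PiM K)"
    (is "?B \<in> _")
proof (rule null_setsI)
  interpret product_sigma_finite "\<lambda>_. cgauss" by (rule product_sigma_finite_cgauss)
  note [measurable] = measurable_gauss_coord[OF K(2)] measurable_gauss_coord[OF K(3)]
  show B: "?B \<in> sets (gauss_PiM K)" by measurable
  define K' where "K' = K - {k}"
  have K': "K = insert k K'" "finite K'" "k \<notin> K'" "l \<in> K'" using K by (auto simp: K'_def)
  have null: "emeasure cgauss {z. cmod z = c} = 0" for c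
  proof (cases "0 \<le> c")
    case False
    then have "{z. cmod z = c} = {}" by auto
    then show ?thesis by simp
  next
    case True
    interpret cg: prob_space cgauss by (rule prob_space_cgauss)
    \<comment> \<open>The circle lies in an annulus between the tails at c^2 / 2 and c^2 / 2 + e,
      whose mass is at most 1 - exp (- e).\<close>
    have le: "cg.prob {z. cmod z = c} \<le> e" if e: "0 < e" for e
    proof -
      have cm: "cg.prob {z. 2 * r \<le> (cmod z)\<^sup>2} = exp (- r)" if "0 \<le> r" for r
        using emeasure_cgauss_ge[OF that] by (simp add: measure_def)
      let ?r = "c\<^sup>2 / 2"
      have "cg.prob {z. cmod z = c} + cg.prob {z. 2 * (?r + e) \<le> (cmod z)\<^sup>2}
         = cg.prob ({z. cmod z = c} \<union> {z. 2 * (?r + e) \<le> (cmod z)\<^sup>2})"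
        using e by (intro cg.finite_measure_Union[symmetric]) auto
      also have "\<dots> \<le> cg.prob {z. 2 * ?r \<le> (cmod z)\<^sup>2}"
        using e by (intro cg.finite_measure_mono) auto
      also have "\<dots> = exp (- ?r)" by (rule cm) simp
      also have "cg.prob {z. 2 * (?r + e) \<le> (cmod z)\<^sup>2} = exp (- ?r) * exp (- e)"
        using e cm[of "?r + e"] by (simp add: exp_add[symmetric])
      finally have "cg.prob {z. cmod z = c} \<le> exp (- ?r) * (1 - exp (- e))"
        by (simp add: right_diff_distrib)
      also have "\<dots> \<le> 1 * (1 - exp (- e))" using e by (intro mult_right_mono) auto
      also have "\<dots> \<le> e" using exp_ge_add_one_self[of "- e"] by simp
      finally show ?thesis .
    qed
    have "cg.prob {z. cmod z = c} \<le> 0"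
    proof (rule field_le_epsilon)
      fix e :: real assume "0 < e"
      from le[OF this] show "cg.prob {z. cmod z = c} \<le> 0 + e" by simp
    qed
    then have "cg.prob {z. cmod z = c} = 0" using measure_nonneg by (rule order_antisym)
    then show ?thesis by (simp add: cg.emeasure_eq_measure)
  qed
  have "emeasure (gauss_PiM K) ?B = (\<integral>\<^sup>+A. indicator ?B A \<partial>gauss_PiM K)" using B by simp
  also have "\<dots> = (\<integral>\<^sup>+x. \<integral>\<^sup>+z. indicator ?B (x(k := z)) \<partial>cgauss \<partial>gauss_PiM K')"
    using product_nn_integral_insert[OF K'(2,3), of "indicator ?B"] B unfolding K'(1)[symmetric] by simp
  also have "\<dots> \<le> (\<integral>\<^sup>+x. 0 \<partial>gauss_PiM K')"
  proof (rule nn_integral_mono)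
    fix x
    have "(\<integral>\<^sup>+z. indicator ?B (x(k := z)) \<partial>cgauss) \<le> (\<integral>\<^sup>+z. indicator {z. cmod z = cmod (x l)} z \<partial>cgauss)"
      using K(4) by (intro nn_integral_mono) (auto simp: indicator_def)
    also have "\<dots> = 0" using null by simp
    finally show "(\<integral>\<^sup>+z. indicator ?B (x(k := z)) \<partial>cgauss) \<le> 0" .
  qed
  finally show "emeasure (gauss_PiM K) ?B = 0" by simp
qed

section \<open>Null vectors\<close>

lemma sum_cmod_sq_lincomb:
  "(\<Sum>j\<in>S. (cmod (s * a j + t * b j))\<^sup>2) =
    (cmod s)\<^sup>2 * (\<Sum>j\<in>S. (cmod (a j))\<^sup>2) + (cmod t)\<^sup>2 * (\<Sum>j\<in>S. (cmod (b j))\<^sup>2)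
    + 2 * Re (cnj s * t * (\<Sum>j\<in>S. cnj (a j) * b j))"
proof -
  have "(cmod (s * p + t * q))\<^sup>2 = (cmod s)\<^sup>2 * (cmod p)\<^sup>2 + (cmod t)\<^sup>2 * (cmod q)\<^sup>2 + 2 * Re (cnj s * t * (cnj p * q))" for p q
    by (simp only: cmod_power2) (simp add: power2_eq_square algebra_simps)
  then show ?thesis
    by (simp add: sum.distrib sum_distrib_left Re_sum)
qed

lemma vnorm_sq: "(vnorm n z)\<^sup>2 = (\<Sum>i<n. (cmod (z i))\<^sup>2)"
  by (simp add: vnorm_def sum_nonneg)

lemma outer_err_eq:
  "outer_err n x0 x = (vnorm n x0) ^ 4 + (vnorm n x) ^ 4 - 2 * (cmod (\<Sum>i<n. cnj (x i) * x0 i))\<^sup>2"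
proof -
  let ?p = "\<lambda>i. cnj (x i) * x0 i"
  have four: "r ^ 4 = r\<^sup>2 * r\<^sup>2" for r :: real by (simp add: power4_eq_xxxx power2_eq_square)
  have "outer_err n x0 x = (\<Sum>i<n. \<Sum>k<n. (cmod (x0 i))\<^sup>2 * (cmod (x0 k))\<^sup>2 + (cmod (x i))\<^sup>2 * (cmod (x k))\<^sup>2
      - 2 * Re (?p i * cnj (?p k)))"
    unfolding outer_err_def
    by (intro sum.cong refl, simp only: cmod_power2) (simp add: power2_eq_square algebra_simps)
  also have "\<dots> = (\<Sum>i<n. (cmod (x0 i))\<^sup>2) * (\<Sum>i<n. (cmod (x0 i))\<^sup>2) + (\<Sum>i<n. (cmod (x i))\<^sup>2) * (\<Sum>i<n. (cmod (x i))\<^sup>2)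
      - 2 * Re ((\<Sum>i<n. ?p i) * cnj (\<Sum>i<n. ?p i))"
    unfolding sum_product cnj_sum Re_sum by (simp add: sum.distrib sum_subtractf sum_distrib_left)
  also have "Re ((\<Sum>i<n. ?p i) * cnj (\<Sum>i<n. ?p i)) = (cmod (\<Sum>i<n. ?p i))\<^sup>2"
    by (simp only: complex_norm_square[symmetric] Re_complex_of_real)
  finally show ?thesis by (simp only: four vnorm_sq)
qed

text \<open>Minimality makes the energy form block diagonal along a null vector \<open>x\<close> and its orthogonal
  complement, and forces the energy on the complement to dominate that on the hyperplane orthogonal
  to \<open>x0\<close>.\<close>
lemma null_vec_outer_err_le:
  fixes \<Lambda> :: real
  assumes nv: "is_null_vec A n I x0 x" and x0: "0 < vnorm n x0"
    and low: "\<And>z. (\<Sum>i<n. cnj (x0 i) * z i) = 0 \<Longrightarrow> \<Lambda> * (vnorm n z)\<^sup>2 \<le> sub_energy A n I z"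
  shows "\<Lambda> * outer_err n x0 x \<le> 2 * (vnorm n x0)\<^sup>2 * sub_energy A n I x0"
proof -
  define N where "N = (\<lambda>z::nat \<Rightarrow> complex. \<Sum>i<n. (cmod (z i))\<^sup>2)"
  define ip where "ip = (\<lambda>u v::nat \<Rightarrow> complex. \<Sum>i<n. cnj (u i) * v i)"
  define e where "e = sub_energy A n I"
  define B where "B = (\<lambda>u v. \<Sum>j\<in>I. cnj (col_ip A n j u) * col_ip A n j v)"
  have N_lin: "N (\<lambda>i. s * u i + t * v i) = (cmod s)\<^sup>2 * N u + (cmod t)\<^sup>2 * N v + 2 * Re (cnj s * t * ip u v)" for s t u v
    unfolding N_def ip_def by (rule sum_cmod_sq_lincomb)
  have col: "col_ip A n j (\<lambda>i. s * u i + t * v i) = s * col_ip A n j u + t * col_ip A n j v" for j s t u v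
    by (simp add: col_ip_def algebra_simps sum.distrib sum_distrib_left)
  have e_lin: "e (\<lambda>i. s * u i + t * v i) = (cmod s)\<^sup>2 * e u + (cmod t)\<^sup>2 * e v + 2 * Re (cnj s * t * B u v)" for s t u v
    unfolding e_def sub_energy_def B_def col by (rule sum_cmod_sq_lincomb)
  have N0: "0 \<le> N z" for z by (simp add: N_def sum_nonneg)
  have e0: "0 \<le> e z" for z by (simp add: e_def sub_energy_def sum_nonneg)
  define \<rho> where "\<rho> = N x0"
  have \<rho>: "0 < \<rho>" using x0 by (simp add: \<rho>_def N_def vnorm_sq[symmetric])
  have Nx: "N x = \<rho>" using nv by (simp add: is_null_vec_def \<rho>_def N_def vnorm_sq[symmetric])
  have min: "e x * N z \<le> e z * \<rho>" for z
  proof (cases "N z = 0")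
    case True
    then show ?thesis using e0 \<rho> by simp
  next
    case False
    then have Nz: "0 < N z" using N0[of z] by simp
    define k where "k = sqrt (\<rho> / N z)"
    have k2: "k\<^sup>2 = \<rho> / N z" using \<rho> Nz by (simp add: k_def)
    \<comment> \<open>The zero term brings the scaled vector into the two-term form of
      \<open>N_lin\<close> and \<open>e_lin\<close>.\<close>
    let ?z = "\<lambda>i. of_real k * z i + 0 * z i"
    have "N ?z = \<rho>" unfolding N_lin using k2 Nz by simp
    then have "vnorm n ?z = vnorm n x0" by (simp add: \<rho>_def N_def vnorm_def)
    then have "e x \<le> e ?z" using nv unfolding is_null_vec_def e_def by blast
    also have "\<dots> = \<rho> / N z * e z" unfolding e_lin using k2 by simp
    finally show ?thesis using Nz by (simp add: field_simps)
  qed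
  \<comment> \<open>First-order optimality. A step along \<open>w\<close> with coefficient
    \<open>?t\<close> lowers the energy by 2 s b to first order. \<open>C\<close> collects the
    second-order terms, and s = \<rho> / (|C| + 1) keeps s C at most \<rho>, whereas minimality
    would require at least 2 \<rho>.\<close>
  have stat: "B x w = 0" if w: "ip x w = 0" for w
  proof (rule ccontr)
    assume B: "B x w \<noteq> 0"
    define b where "b = (cmod (B x w))\<^sup>2"
    have b: "0 < b" using B by (simp add: b_def)
    define C where "C = e w * \<rho> - e x * N w"
    define s where "s = \<rho> / (\<bar>C\<bar> + 1)"
    have s: "0 < s" using \<rho> by (simp add: s_def)
    let ?t = "- (of_real s * cnj (B x w))"
    have t2: "(cmod ?t)\<^sup>2 = s\<^sup>2 * b" by (simp add: b_def norm_mult power_mult_distrib)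
    have Nz: "N (\<lambda>i. 1 * x i + ?t * w i) = \<rho> + s\<^sup>2 * b * N w" unfolding N_lin t2 w Nx by simp
    have tB: "cnj 1 * ?t * B x w = - of_real (s * b)"
      using complex_norm_square[of "B x w"] by (simp add: b_def mult.commute mult.left_commute)
    have ez: "e (\<lambda>i. 1 * x i + ?t * w i) = e x + s\<^sup>2 * b * e w - 2 * (s * b)" unfolding e_lin t2 tB by simp
    have "e x * (\<rho> + s\<^sup>2 * b * N w) \<le> (e x + s\<^sup>2 * b * e w - 2 * (s * b)) * \<rho>"
      using min[of "\<lambda>i. 1 * x i + ?t * w i"] unfolding Nz ez .
    then have "(s * b) * (2 * \<rho>) \<le> (s * b) * (s * C)"
      by (simp add: C_def algebra_simps power2_eq_square)
    then have "2 * \<rho> \<le> s * C" using s b by simp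
    also have "s * C \<le> s * \<bar>C\<bar>" using s by (intro mult_left_mono) auto
    also have "s * \<bar>C\<bar> \<le> \<rho>" using \<rho> by (simp add: s_def divide_le_eq algebra_simps)
    finally show False using \<rho> by simp
  qed
  define \<beta> where "\<beta> = ip x x0 / of_real \<rho>"
  define w where "w = (\<lambda>i. 1 * x0 i + (- \<beta>) * x i)"
  have ip_self: "ip u u = of_real (N u)" for u
    by (simp add: ip_def N_def sum_cnj_mult_self)
  have ip_lin: "ip u (\<lambda>i. s * y i + t * z i) = s * ip u y + t * ip u z" for u s y t z
    by (simp add: ip_def algebra_simps sum.distrib sum_distrib_left)
  have ip_cnj: "ip u v = cnj (ip v u)" for u v by (simp add: ip_def mult.commute)
  have xw: "ip x w = 0"
    unfolding w_def ip_lin ip_self Nx \<beta>_def using \<rho> by simp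
  have x0_eq: "x0 = (\<lambda>i. \<beta> * x i + 1 * w i)" by (simp add: w_def)
  have \<rho>_eq: "\<rho> = (cmod \<beta>)\<^sup>2 * \<rho> + N w"
    using N_lin[of \<beta> x 1 w] unfolding x0_eq[symmetric] xw Nx \<rho>_def[symmetric] by simp
  have e_x0: "e x0 = (cmod \<beta>)\<^sup>2 * e x + e w"
    using e_lin[of \<beta> x 1 w] unfolding x0_eq[symmetric] stat[OF xw] by simp
  have ew: "\<Lambda> * N w \<le> e w"
  proof (cases "N w = 0")
    case True
    then show ?thesis using e0 by simp
  next
    case False
    then have W: "0 < N w" using N0[of w] by simp
    \<comment> \<open>\<open>v\<close> is the combination of \<open>x\<close> and \<open>w\<close>
      orthogonal to \<open>x0\<close>, so \<open>low\<close> applies to it. By \<open>stat\<close>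
      there is no cross term in \<open>e v\<close>, and minimality gives e x / N x <= e w / N w;
      hence the quotient of \<open>v\<close> is at most that of \<open>w\<close>.\<close>
    let ?s = "of_real (N w) :: complex" and ?t = "- (cnj \<beta> * of_real \<rho>)"
    define v where "v = (\<lambda>i. ?s * x i + ?t * w i)"
    have "ip x0 x = cnj \<beta> * of_real \<rho>"
      using \<rho> ip_cnj[of x0 x] by (simp add: \<beta>_def)
    moreover have "ip x0 w = of_real (N w)"
    proof -
      have "ip w x0 = \<beta> * ip w x + 1 * ip w w"
        using ip_lin[of w \<beta> x 1 w] unfolding x0_eq[symmetric] .
      then show ?thesis using ip_cnj[of x0 w] ip_cnj[of w x] xw ip_self by simp
    qed
    ultimately have "ip x0 v = 0" unfolding v_def ip_lin by simp
    then have "\<Lambda> * N v \<le> e v"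
      using low[of v] by (simp add: ip_def N_def e_def vnorm_sq)
    moreover have Nv: "N v = (N w)\<^sup>2 * \<rho> + (cmod ?t)\<^sup>2 * N w"
      unfolding v_def N_lin xw Nx using W by simp
    moreover have ev: "e v = (N w)\<^sup>2 * e x + (cmod ?t)\<^sup>2 * e w"
      unfolding v_def e_lin stat[OF xw] using W by simp
    ultimately have "N w * (\<Lambda> * N v) \<le> N w * ((N w)\<^sup>2 * e x + (cmod ?t)\<^sup>2 * e w)"
      using W by (intro mult_left_mono) auto
    also have "\<dots> = (N w)\<^sup>2 * (e x * N w) + (cmod ?t)\<^sup>2 * N w * e w"
      by (simp add: algebra_simps)
    also have "\<dots> \<le> (N w)\<^sup>2 * (e w * \<rho>) + (cmod ?t)\<^sup>2 * N w * e w"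
      using min[of w] by (intro add_right_mono mult_left_mono) auto
    also have "\<dots> = N v * e w" unfolding Nv by (simp add: algebra_simps)
    finally have "N v * (\<Lambda> * N w) \<le> N v * e w" by (simp add: algebra_simps)
    moreover have "0 < N v" unfolding Nv using W \<rho> by (simp add: add_pos_nonneg)
    ultimately show ?thesis by simp
  qed
  have "outer_err n x0 x = 2 * \<rho>\<^sup>2 - 2 * (cmod (ip x x0))\<^sup>2"
  proof -
    have "(vnorm n x0) ^ 4 = \<rho>\<^sup>2" "(vnorm n x) ^ 4 = \<rho>\<^sup>2"
      using nv by (simp_all add: is_null_vec_def \<rho>_def N_def vnorm_sq[symmetric] power_mult[symmetric])
    then show ?thesis unfolding outer_err_eq ip_def by simp
  qed
  also have "(cmod (ip x x0))\<^sup>2 = (cmod \<beta>)\<^sup>2 * \<rho>\<^sup>2"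
    using \<rho> by (simp add: \<beta>_def norm_divide power_divide)
  also have "2 * \<rho>\<^sup>2 - 2 * ((cmod \<beta>)\<^sup>2 * \<rho>\<^sup>2) = 2 * \<rho> * (\<rho> - (cmod \<beta>)\<^sup>2 * \<rho>)"
    by (simp add: power2_eq_square algebra_simps)
  also have "\<rho> - (cmod \<beta>)\<^sup>2 * \<rho> = N w" using \<rho>_eq by linarith
  finally have "\<Lambda> * outer_err n x0 x = 2 * \<rho> * (\<Lambda> * N w)" by simp
  also have "\<dots> \<le> 2 * \<rho> * e x0"
    using ew e_x0 mult_nonneg_nonneg[OF zero_le_power2 e0[of x], of "cmod \<beta>"] \<rho> by (intro mult_left_mono) auto
  finally show ?thesis by (simp add: \<rho>_def N_def e_def vnorm_sq)
qed

text \<open>Both sides are continuous in finitely many coordinates and the inequality is strict, so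
  it survives approximation from \<open>D\<close>. Restricting the approximant to \<open>L\<close>
  places it in a set of test vectors that is countable when \<open>D\<close> is.\<close>

lemma array_energy_dense:
  fixes x :: real
  assumes L: "finite L" and D: "\<And>X. open X \<Longrightarrow> X \<noteq> {} \<Longrightarrow> \<exists>d\<in>D. d \<in> X"
    and z: "array_energy L J G z < 2 * x * (\<Sum>i\<in>L. (cmod (z i))\<^sup>2)"
  shows "\<exists>y\<in>PiE L (\<lambda>_. D). array_energy L J G y < 2 * x * (\<Sum>i\<in>L. (cmod (y i))\<^sup>2)"
proof -
  have "\<forall>k i. \<exists>d. d \<in> D \<and> dist d (z i) < inverse (real (Suc k))"
  proof (intro allI)
    fix k i
    show "\<exists>d. d \<in> D \<and> dist d (z i) < inverse (real (Suc k))"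
      using D[of "ball (z i) (inverse (real (Suc k)))"] by (auto simp: dist_commute)
  qed
  then obtain d where "\<forall>k i. d k i \<in> D \<and> dist (d k i) (z i) < inverse (real (Suc k))"
    unfolding choice_iff by blast
  then have d: "\<And>k i. d k i \<in> D" "\<And>k i. dist (d k i) (z i) < inverse (real (Suc k))" by auto
  have lim: "(\<lambda>k. d k i) \<longlonglongrightarrow> z i" for i
  proof (rule metric_tendsto_imp_tendsto[where f="\<lambda>k. inverse (real (Suc k))" and a=0])
    show "(\<lambda>k. inverse (real (Suc k))) \<longlonglongrightarrow> 0" by (rule LIMSEQ_inverse_real_of_nat)
    show "\<forall>\<^sub>F k in sequentially. dist (d k i) (z i) \<le> dist (inverse (real (Suc k))) 0"
      using d(2) by (intro always_eventually allI) (simp add: less_imp_le)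
  qed
  have "(\<lambda>k. 2 * x * (\<Sum>i\<in>L. (cmod (d k i))\<^sup>2) - array_energy L J G (d k))
      \<longlonglongrightarrow> 2 * x * (\<Sum>i\<in>L. (cmod (z i))\<^sup>2) - array_energy L J G z"
    unfolding array_energy_def by (intro tendsto_intros lim)
  from order_tendstoD(1)[OF this, of 0] z
  have "\<forall>\<^sub>F k in sequentially. array_energy L J G (d k) < 2 * x * (\<Sum>i\<in>L. (cmod (d k i))\<^sup>2)" by simp
  then obtain k where k: "array_energy L J G (d k) < 2 * x * (\<Sum>i\<in>L. (cmod (d k i))\<^sup>2)"
    by (auto simp: eventually_sequentially)
  have "array_energy L J G (restrict (d k) L) = array_energy L J G (d k)"
    unfolding array_energy_def by (intro sum.cong arg_cong[where f="\<lambda>z. (cmod z)\<^sup>2"]) auto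
  moreover have "(\<Sum>i\<in>L. (cmod (restrict (d k) L i))\<^sup>2) = (\<Sum>i\<in>L. (cmod (d k i))\<^sup>2)" by simp
  ultimately show ?thesis using k d(1) by (intro bexI[of _ "restrict (d k) L"]) auto
qed

section \<open>Columns selected by their moduli\<close>

lemma array_energy_cong:
  assumes "\<And>i j. i \<in> L \<Longrightarrow> j \<in> J \<Longrightarrow> G (i, j) = H (i, j)"
  shows "array_energy L J G z = array_energy L J H z"
  unfolding array_energy_def using assms
  by (intro sum.cong refl arg_cong[where f="\<lambda>z. (cmod z)\<^sup>2"]) auto

text \<open>For dense \<open>D\<close> this says that the least squared singular value is below
  \<open>2 * x\<close>. Testing only vectors with coordinates in \<open>D\<close> makes the event
  measurable when \<open>D\<close> is countable.\<close>

definition low_energy :: "complex set \<Rightarrow> nat set \<Rightarrow> nat set \<Rightarrow> real \<Rightarrow> (nat \<times> nat \<Rightarrow> complex) \<Rightarrow> bool" where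
  "low_energy D L J x G \<longleftrightarrow> (\<exists>z\<in>PiE L (\<lambda>_. D). array_energy L J G z < 2 * x * (\<Sum>i\<in>L. (cmod (z i))\<^sup>2))"

text \<open>Relative to the factor 2 in \<open>low_energy\<close>, the least squared singular value
  of a p by m Gaussian array sits asymptotically at (sqrt m - sqrt p)^2. The factor 11/20 makes
  falling below the level exponentially unlikely in m - p.\<close>

definition edge_level :: "nat \<Rightarrow> nat \<Rightarrow> real" where
  "edge_level m p = 11 / 20 * (sqrt m - sqrt p)\<^sup>2"

lemma low_energy_cong:
  assumes "\<And>i j. i \<in> L \<Longrightarrow> j \<in> J \<Longrightarrow> G (i, j) = H (i, j)"
  shows "low_energy D L J x G \<longleftrightarrow> low_energy D L J x H"
proof -
  have "array_energy L J G = array_energy L J H"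
    by (rule ext, rule array_energy_cong) (rule assms)
  then show ?thesis by (simp only: low_energy_def)
qed

lemma countable_PiE_const:
  assumes "finite L" "countable D"
  shows "countable (PiE L (\<lambda>_. D))"
  using assms by (intro countable_PiE) auto

lemma gauss_PiM_restrict_event:
  assumes R: "R \<subseteq> K" and inv: "\<And>A. P (restrict A R) \<longleftrightarrow> P A"
    and B: "{A \<in> space (gauss_PiM R). P A} \<in> sets (gauss_PiM R)"
  shows "{A \<in> space (gauss_PiM K). P A} \<in> sets (gauss_PiM K)"
    and "finite K \<Longrightarrow> emeasure (gauss_PiM K) {A \<in> space (gauss_PiM K). P A}
      = emeasure (gauss_PiM R) {A \<in> space (gauss_PiM R). P A}"
proof -
  let ?r = "\<lambda>A. restrict A R"
  have r: "?r \<in> measurable (gauss_PiM K) (gauss_PiM R)"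
    by (rule measurable_restrict_subset[OF R])
  have eq: "{A \<in> space (gauss_PiM K). P A} = ?r -` {A \<in> space (gauss_PiM R). P A} \<inter> space (gauss_PiM K)"
    by (auto simp: inv measurable_space[OF r])
  show "{A \<in> space (gauss_PiM K). P A} \<in> sets (gauss_PiM K)"
    unfolding eq by (rule measurable_sets[OF r B])
  assume "finite K"
  then show "emeasure (gauss_PiM K) {A \<in> space (gauss_PiM K). P A}
      = emeasure (gauss_PiM R) {A \<in> space (gauss_PiM R). P A}"
    using emeasure_distr[OF r B] product_prob_space.distr_restrict[OF product_prob_space_cgauss R] unfolding eq by simp
qed

lemma low_energy_restrict: "low_energy D L J x (restrict G (L \<times> J)) \<longleftrightarrow> low_energy D L J x G"
  by (rule low_energy_cong) simp

lemma low_energy_sets: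
  assumes "finite L" "countable D" "L \<times> J \<subseteq> K"
  shows "{G \<in> space (gauss_PiM K). low_energy D L J x G} \<in> sets (gauss_PiM K)"
proof (rule gauss_PiM_restrict_event(1)[OF assms(3)])
  show "{G \<in> space (gauss_PiM (L \<times> J)). low_energy D L J x G} \<in> sets (gauss_PiM (L \<times> J))"
    unfolding low_energy_def by (rule array_energy_small_event_sets[OF countable_PiE_const[OF assms(1,2)]])
qed (rule low_energy_restrict)

lemma emeasure_low_energy_le:
  assumes L: "finite L" and J: "finite J" "card L < card J" and D: "countable D"
    and K: "finite K" "L \<times> J \<subseteq> K"
  shows "emeasure (gauss_PiM K) {G \<in> space (gauss_PiM K). low_energy D L J (edge_level (card J) (card L)) G}
    \<le> ennreal (exp (- (real (card J) - real (card L)) / 100))"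
proof -
  let ?x = "edge_level (card J) (card L)"
  let ?B = "{G \<in> space (gauss_PiM (L \<times> J)). low_energy D L J ?x G}"
  have "emeasure (gauss_PiM K) {G \<in> space (gauss_PiM K). low_energy D L J ?x G} = emeasure (gauss_PiM (L \<times> J)) ?B"
    by (rule gauss_PiM_restrict_event(2)[OF K(2) low_energy_restrict low_energy_sets[OF L D order_refl] K(1)])
  also have "\<dots> \<le> ennreal (exp (- (real (card J) - real (card L)) / 100))"
  proof (cases "L = {}")
    \<comment> \<open>This happens for n = 1: the sums over rows are empty, and the strict
      inequality reads 0 < 0.\<close>
    case True
    then have B0: "?B = {}" by (simp add: low_energy_def array_energy_def)
    show ?thesis by (simp only: B0 emeasure_empty zero_le)
  next
    case False
    then have p: "0 < card L" using L by (simp add: card_gt_0_iff)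
    note cp = chernoff_parameters[OF p J(2), folded edge_level_def]
    have "emeasure (gauss_PiM (L \<times> J)) ?B \<le> ennreal (exp (real (card J) - real (card L) - ?x / ((real (card J) - real (card L)) / real (card J))) *
        (1 / (1 - (real (card J) - real (card L)) / real (card J))) ^ card L *
        (1 / (1 + (real (card J) - real (card L)) / real (card J) * (real (card J) - real (card L) - ?x / ((real (card J) - real (card L)) / real (card J))) / ?x)) ^ (card J - (card L - 1)))"
      unfolding low_energy_def
      by (rule emeasure_array_energy_small_le[OF L False J(1) countable_PiE_const[OF L D] cp(2,3,4,1)])
    also have "\<dots> \<le> ennreal (exp (- (real (card J) - real (card L)) / 100))"
      by (rule ennreal_leI) (rule cp(5))
    finally show ?thesis .
  qed
  finally show ?thesis .
qed

definition smallest_set :: "nat \<Rightarrow> (nat \<Rightarrow> real) \<Rightarrow> nat set \<Rightarrow> bool" where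
  "smallest_set N r I \<longleftrightarrow> I \<subseteq> {..<N} \<and> (\<forall>i\<in>I. \<forall>j\<in>{..<N} - I. r i \<le> r j)"

lemma smallest_set_unique:
  assumes inj: "inj_on r {..<N}" and I: "smallest_set N r I" and I': "smallest_set N r I'" and c: "card I = card I'"
  shows "I = I'"
proof (rule ccontr)
  assume ne: "I \<noteq> I'"
  have fin: "finite I" "finite I'" using I I' by (auto simp: smallest_set_def intro: finite_subset)
  have "\<not> I \<subseteq> I'" using card_subset_eq[OF fin(2) _ c] ne by blast
  then obtain i where i: "i \<in> I" "i \<notin> I'" by blast
  have "\<not> I' \<subseteq> I" using card_subset_eq[OF fin(1) _ c[symmetric]] ne by blast
  then obtain j where j: "j \<in> I'" "j \<notin> I" by blast
  have ij: "i < N" "j < N" using i j I I' by (auto simp: smallest_set_def)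
  have "r i \<le> r j" "r j \<le> r i" using i j ij I I' by (auto simp: smallest_set_def)
  then have "i = j" using inj ij by (auto simp: inj_on_def)
  then show False using i j by simp
qed

lemma smallest_set_le:
  assumes I: "smallest_set N r I" and c: "card I \<le> card {j\<in>{..<N}. r j \<le> t}" and i: "i \<in> I"
  shows "r i \<le> t"
proof (rule ccontr)
  assume t: "\<not> r i \<le> t"
  have fin: "finite I" using I by (auto simp: smallest_set_def intro: finite_subset)
  have "{j\<in>{..<N}. r j \<le> t} \<subseteq> I - {i}"
  proof
    fix j assume j: "j \<in> {j\<in>{..<N}. r j \<le> t}"
    then have "r j < r i" using t by auto
    moreover have "r i \<le> r j" if "j \<notin> I" using I i j that by (auto simp: smallest_set_def)
    ultimately show "j \<in> I - {i}" by (cases "j \<in> I") auto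
  qed
  then have "card {j\<in>{..<N}. r j \<le> t} \<le> card (I - {i})" using fin by (intro card_mono) auto
  also have "\<dots> < card I" using fin i by (intro psubset_card_mono) auto
  finally show False using c by simp
qed

text \<open>Condition on row 0. In the absence of ties it determines the only possible
  \<open>I\<close>, and the rows 1 to n - 1 are independent of it. So the bound for one fixed column
  set applies, with no factor for the number of sets.\<close>

lemma emeasure_selected_low_energy_le:
  fixes m n N :: nat
  assumes n: "0 < n" "n < m" and D: "countable D"
  defines "K \<equiv> {..<n} \<times> {..<N}"
  defines "B \<equiv> {H \<in> space (gauss_PiM K). inj_on (\<lambda>j. cmod (H (0, j))) {..<N} \<and>
    (\<exists>I. smallest_set N (\<lambda>j. cmod (H (0, j))) I \<and> card I = m \<and> low_energy D {1..<n} I (edge_level m (n - 1)) H)}"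
  shows "B \<in> sets (gauss_PiM K)"
    and "emeasure (gauss_PiM K) B \<le> ennreal (exp (- (real m - real (n - 1)) / 100))"
proof -
  interpret product_sigma_finite "\<lambda>_. cgauss" by (rule product_sigma_finite_cgauss)
  define R where "R = {0::nat} \<times> {..<N}"
  define R' where "R' = {1..<n} \<times> {..<N}"
  have K: "K = R \<union> R'" "R \<inter> R' = {}" "finite R" "finite R'" "finite K"
    using n by (auto simp: K_def R_def R'_def)
  let ?x = "edge_level m (n - 1)"
  have coord: "(\<lambda>H. cmod (H (0, j))) \<in> borel_measurable (gauss_PiM K)" if "j < N" for j
    using that n by (intro measurable_compose[OF measurable_gauss_coord borel_measurable_norm]) (auto simp: K_def)
  have fam: "finite {I. I \<subseteq> {..<N} \<and> card I = m}" by (rule finite_subset[of _ "Pow {..<N}"]) auto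
  have inj: "{H \<in> space (gauss_PiM K). inj_on (\<lambda>j. cmod (H (0, j))) {..<N}} \<in> sets (gauss_PiM K)"
  proof -
    have "{H \<in> space (gauss_PiM K). inj_on (\<lambda>j. cmod (H (0, j))) {..<N}}
      = {H \<in> space (gauss_PiM K). \<forall>i\<in>{..<N}. \<forall>j\<in>{..<N} - {i}. cmod (H (0, i)) \<noteq> cmod (H (0, j))}"
      unfolding inj_on_def by blast
    also have "\<dots> \<in> sets (gauss_PiM K)"
    proof (intro sets.sets_Collect_finite_All)
      fix i j assume "i \<in> {..<N}" "j \<in> {..<N} - {i}"
      then have "(\<lambda>H. cmod (H (0, i))) \<in> borel_measurable (gauss_PiM K)"
        "(\<lambda>H. cmod (H (0, j))) \<in> borel_measurable (gauss_PiM K)" using coord by auto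
      show "{H \<in> space (gauss_PiM K). cmod (H (0, i)) \<noteq> cmod (H (0, j))} \<in> sets (gauss_PiM K)"
        unfolding neq_iff by (intro sets.sets_Collect_disj borel_measurable_less) fact+
    qed auto
    finally show ?thesis .
  qed
  have small: "{H \<in> space (gauss_PiM K). smallest_set N (\<lambda>j. cmod (H (0, j))) I} \<in> sets (gauss_PiM K)"
    if I: "I \<subseteq> {..<N}" for I
  proof -
    have "{H \<in> space (gauss_PiM K). smallest_set N (\<lambda>j. cmod (H (0, j))) I}
      = {H \<in> space (gauss_PiM K). \<forall>i\<in>I. \<forall>j\<in>{..<N} - I. cmod (H (0, i)) \<le> cmod (H (0, j))}"
      using I by (simp add: smallest_set_def)
    also have "\<dots> \<in> sets (gauss_PiM K)"
    proof (intro sets.sets_Collect_finite_All)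
      fix i j assume "i \<in> I" "j \<in> {..<N} - I"
      then have "(\<lambda>H. cmod (H (0, i))) \<in> borel_measurable (gauss_PiM K)"
        "(\<lambda>H. cmod (H (0, j))) \<in> borel_measurable (gauss_PiM K)" using coord I by auto
      then show "{H \<in> space (gauss_PiM K). cmod (H (0, i)) \<le> cmod (H (0, j))} \<in> sets (gauss_PiM K)"
        by (intro borel_measurable_le)
    qed (use I in \<open>auto intro: finite_subset\<close>)
    finally show ?thesis .
  qed
  have low: "{H \<in> space (gauss_PiM K). low_energy D {1..<n} I ?x H} \<in> sets (gauss_PiM K)" if I: "I \<subseteq> {..<N}" for I
    using I by (intro low_energy_sets D) (auto simp: K_def)
  have B_eq: "B = {H \<in> space (gauss_PiM K). inj_on (\<lambda>j. cmod (H (0, j))) {..<N}} \<inter>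
      (\<Union>I\<in>{I. I \<subseteq> {..<N} \<and> card I = m}. {H \<in> space (gauss_PiM K). smallest_set N (\<lambda>j. cmod (H (0, j))) I}
        \<inter> {H \<in> space (gauss_PiM K). low_energy D {1..<n} I ?x H})"
    unfolding B_def by (auto simp: smallest_set_def)
  show B: "B \<in> sets (gauss_PiM K)"
    unfolding B_eq using inj small low fam by (intro sets.Int sets.finite_UN) auto
  let ?C = "ennreal (exp (- (real m - real (n - 1)) / 100))"
  have "emeasure (gauss_PiM K) B = (\<integral>\<^sup>+H. indicator B H \<partial>gauss_PiM K)" using B by simp
  also have "\<dots> = (\<integral>\<^sup>+a. \<integral>\<^sup>+g. indicator B (merge R R' (a, g)) \<partial>gauss_PiM R' \<partial>gauss_PiM R)"
    using B unfolding K(1) by (intro product_nn_integral_fold[OF K(2-4)]) simp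
  also have "\<dots> \<le> (\<integral>\<^sup>+a. ?C \<partial>gauss_PiM R)"
  proof (rule nn_integral_mono)
    fix a
    have row: "(\<lambda>j. cmod (merge R R' (a, g) (0, j))) j = (\<lambda>j. cmod (a (0, j))) j" if "j < N" for g j
      using that by (simp add: merge_def R_def)
    have inj_eq: "inj_on (\<lambda>j. cmod (merge R R' (a, g) (0, j))) {..<N} \<longleftrightarrow> inj_on (\<lambda>j. cmod (a (0, j))) {..<N}" for g
      by (rule inj_on_cong) (use row in auto)
    have sm_eq: "smallest_set N (\<lambda>j. cmod (merge R R' (a, g) (0, j))) I \<longleftrightarrow> smallest_set N (\<lambda>j. cmod (a (0, j))) I" for g I
    proof (cases "I \<subseteq> {..<N}")
      case True
      then have "i \<in> I \<Longrightarrow> i < N" for i by auto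
      then show ?thesis using row True by (simp add: smallest_set_def)
    qed (simp add: smallest_set_def)
    have low_eq: "low_energy D {1..<n} I ?x (merge R R' (a, g)) \<longleftrightarrow> low_energy D {1..<n} I ?x g" if "I \<subseteq> {..<N}" for g I
      using that by (intro low_energy_cong) (auto simp: merge_def R_def R'_def)
    show "(\<integral>\<^sup>+g. indicator B (merge R R' (a, g)) \<partial>gauss_PiM R') \<le> ?C"
    proof (cases "inj_on (\<lambda>j. cmod (a (0, j))) {..<N} \<and> (\<exists>I. smallest_set N (\<lambda>j. cmod (a (0, j))) I \<and> card I = m)")
      case False
      then have "indicator B (merge R R' (a, g)) = (0::ennreal)" for g
        unfolding B_def by (simp add: inj_eq sm_eq indicator_def) blast
      then show ?thesis by simp
    next
      case True
      then obtain I where I: "inj_on (\<lambda>j. cmod (a (0, j))) {..<N}" "smallest_set N (\<lambda>j. cmod (a (0, j))) I" "card I = m"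
        by blast
      have IN: "I \<subseteq> {..<N}" "finite I" using I(2) by (auto simp: smallest_set_def intro: finite_subset)
      let ?E = "{g \<in> space (gauss_PiM R'). low_energy D {1..<n} I ?x g}"
      have E: "?E \<in> sets (gauss_PiM R')"
        using IN D by (intro low_energy_sets) (auto simp: R'_def)
      have "(\<integral>\<^sup>+g. indicator B (merge R R' (a, g)) \<partial>gauss_PiM R') \<le> (\<integral>\<^sup>+g. indicator ?E g \<partial>gauss_PiM R')"
      proof (rule nn_integral_mono)
        fix g assume g: "g \<in> space (gauss_PiM R')"
        have "g \<in> ?E" if "merge R R' (a, g) \<in> B"
        proof -
          from that obtain I' where I': "smallest_set N (\<lambda>j. cmod (a (0, j))) I'" "card I' = m"
            "low_energy D {1..<n} I' ?x (merge R R' (a, g))"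
            unfolding B_def by (auto simp: sm_eq)
          have "I' = I" using smallest_set_unique[OF I(1) I'(1) I(2)] I(3) I'(2) by simp
          then show ?thesis using I'(3) low_eq[OF IN(1)] g by simp
        qed
        then show "indicator B (merge R R' (a, g)) \<le> (indicator ?E g :: ennreal)"
          by (auto simp: indicator_def)
      qed
      also have "\<dots> = emeasure (gauss_PiM R') ?E" using E by simp
      also have "\<dots> \<le> ?C"
      proof -
        have c: "card {1..<n} = n - 1" by simp
        have "card {1..<n} < card I" using n I(3) by simp
        moreover have "{1..<n} \<times> I \<subseteq> R'" using IN by (auto simp: R'_def)
        ultimately show ?thesis
          using emeasure_low_energy_le[OF _ IN(2) _ D K(4), of "{1..<n}"] unfolding c I(3) by blast
      qed
      finally show ?thesis .
    qed
  qed
  also have "\<dots> = ?C"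
    using prob_space.emeasure_space_1[OF prob_space_gauss_PiM[of R]] by simp
  finally show "emeasure (gauss_PiM K) B \<le> ?C" .
qed

lemma good_event:
  fixes m n N :: nat
  assumes n: "0 < n" "n < m" "m < N" and \<sigma>: "real m / real N \<le> 1 / 100" and D: "countable D"
  defines "K \<equiv> {..<n} \<times> {..<N}"
  obtains E where "E \<in> sets (gauss_PiM K)"
    and "1 - exp (- (real m / 300)) - exp (- (real m - real (n - 1)) / 100) \<le> measure (gauss_PiM K) E"
    and "\<And>H. H \<in> E \<Longrightarrow> m \<le> card {j\<in>{..<N}. (cmod (H (0, j)))\<^sup>2 \<le> 2 * (11 / 10 * (real m / real N))}"
    and "\<And>H I. H \<in> E \<Longrightarrow> smallest_set N (\<lambda>j. cmod (H (0, j))) I \<Longrightarrow> card I = m \<Longrightarrow>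
      \<not> low_energy D {1..<n} I (edge_level m (n - 1)) H"
proof -
  let ?M = "gauss_PiM K"
  interpret prob_space ?M by (rule prob_space_gauss_PiM)
  define R where "R = {0::nat} \<times> {..<N}"
  have K: "finite K" "R \<subseteq> K" using n by (auto simp: K_def R_def)
  have R: "finite R" "card R = N" by (auto simp: R_def card_cartesian_product)
  let ?t = "2 * (11 / 10 * (real m / real N))"
  define B1 where "B1 = {H \<in> space ?M. card {k\<in>R. (cmod (H k))\<^sup>2 \<le> ?t} < m}"
  define B2 where "B2 = (\<Union>i\<in>{..<N}. \<Union>j\<in>{..<N} - {i}. {H \<in> space ?M. cmod (H (0, i)) = cmod (H (0, j))})"
  define B3 where "B3 = {H \<in> space (gauss_PiM K). inj_on (\<lambda>j. cmod (H (0, j))) {..<N} \<and>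
    (\<exists>I. smallest_set N (\<lambda>j. cmod (H (0, j))) I \<and> card I = m \<and> low_energy D {1..<n} I (edge_level m (n - 1)) H)}"
  have B1: "B1 \<in> sets ?M" "emeasure ?M B1 \<le> ennreal (exp (- (real m / 300)))"
  proof -
    have res: "card {k\<in>R. (cmod (restrict H R k))\<^sup>2 \<le> ?t} < m \<longleftrightarrow> card {k\<in>R. (cmod (H k))\<^sup>2 \<le> ?t} < m" for H
    proof -
      have "{k\<in>R. (cmod (restrict H R k))\<^sup>2 \<le> ?t} = {k\<in>R. (cmod (H k))\<^sup>2 \<le> ?t}" by auto
      then show ?thesis by (simp only:)
    qed
    show "B1 \<in> sets ?M"
      unfolding B1_def by (rule gauss_PiM_restrict_event(1)[OF K(2) res few_small_coords_sets[OF R(1)]])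
    have "emeasure ?M B1 = emeasure (gauss_PiM R) {H \<in> space (gauss_PiM R). card {k\<in>R. (cmod (H k))\<^sup>2 \<le> ?t} < m}"
      unfolding B1_def by (rule gauss_PiM_restrict_event(2)[OF K(2) res few_small_coords_sets[OF R(1)] K(1)])
    also have "\<dots> \<le> ennreal (exp (- (real m / 300)))"
      using emeasure_few_small_coords_le_exp[OF R(1), of m] \<sigma> n unfolding R(2) by simp
    finally show "emeasure ?M B1 \<le> ennreal (exp (- (real m / 300)))" .
  qed
  have B2: "B2 \<in> null_sets ?M"
    unfolding B2_def using n
    by (intro null_sets_UN' countable_finite null_sets_equal_modulus K(1)) (auto simp: K_def)
  have B3: "B3 \<in> sets ?M" "emeasure ?M B3 \<le> ennreal (exp (- (real m - real (n - 1)) / 100))"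
    unfolding B3_def K_def by (rule emeasure_selected_low_energy_le[OF n(1,2) D])+
  define E where "E = space ?M - (B1 \<union> B2 \<union> B3)"
  have U: "B1 \<union> B2 \<union> B3 \<in> sets ?M" using B1 B2 B3 by auto
  have "prob (B1 \<union> B2 \<union> B3) \<le> prob B1 + prob B2 + prob B3"
    using B1 B2 B3 measure_Un_le[of "B1 \<union> B2" ?M B3] measure_Un_le[of B1 ?M B2] by auto
  also have "\<dots> \<le> exp (- (real m / 300)) + 0 + exp (- (real m - real (n - 1)) / 100)"
    using B1(2) B3(2) B2 by (intro add_mono) (auto simp: emeasure_eq_measure null_sets_def)
  finally have p: "1 - exp (- (real m / 300)) - exp (- (real m - real (n - 1)) / 100) \<le> prob E"
    unfolding E_def prob_compl[OF U] by simp
  have E: "E \<in> sets ?M" using U by (auto simp: E_def)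
  have count: "m \<le> card {j\<in>{..<N}. (cmod (H (0, j)))\<^sup>2 \<le> ?t}" if H: "H \<in> E" for H
  proof -
    have "bij_betw snd {k\<in>R. (cmod (H k))\<^sup>2 \<le> ?t} {j\<in>{..<N}. (cmod (H (0, j)))\<^sup>2 \<le> ?t}"
      by (rule bij_betw_byWitness[where f'="\<lambda>j. (0, j)"]) (auto simp: R_def)
    then have "card {k\<in>R. (cmod (H k))\<^sup>2 \<le> ?t} = card {j\<in>{..<N}. (cmod (H (0, j)))\<^sup>2 \<le> ?t}"
      by (rule bij_betw_same_card)
    then show ?thesis using H by (auto simp: E_def B1_def)
  qed
  have low: "\<not> low_energy D {1..<n} I (edge_level m (n - 1)) H"
    if H: "H \<in> E" "smallest_set N (\<lambda>j. cmod (H (0, j))) I" "card I = m" for H I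
  proof -
    have "inj_on (\<lambda>j. cmod (H (0, j))) {..<N}"
      using H(1) unfolding E_def B2_def inj_on_def by auto
    then show ?thesis using H by (auto simp: E_def B3_def)
  qed
  show ?thesis by (rule that[OF E p count low])
qed

text \<open>The deterministic part. The moduli of the data are those of the first row of
  \<open>T A\<close> times the norm of \<open>x0\<close>, so the selection is made by that row. A
  vector \<open>z\<close> orthogonal to \<open>x0\<close> has \<open>V z 0 = 0\<close>, so its
  energy involves only the rows 1 to n - 1.\<close>

lemma null_vec_error_on_good_event:
  fixes m n N :: nat and T :: "(nat \<times> nat \<Rightarrow> complex) \<Rightarrow> (nat \<times> nat \<Rightarrow> complex)"
  assumes n: "0 < n" "n < m" "m < N"
    and D: "\<And>X. open X \<Longrightarrow> X \<noteq> {} \<Longrightarrow> \<exists>d\<in>D. d \<in> (X :: complex set)"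
    and x0: "\<exists>i<n. x0 i \<noteq> 0"
    and V: "gauss_unitary {..<n} V" "\<And>i. i \<in> {..<n} \<Longrightarrow> i \<noteq> 0 \<Longrightarrow> V x0 i = 0"
    and T: "\<forall>A. \<forall>i\<in>{..<n}. \<forall>j\<in>{..<N}. T A (i, j) = V (\<lambda>i. A (i, j)) i"
    and count: "m \<le> card {j\<in>{..<N}. (cmod (T A (0, j)))\<^sup>2 \<le> 2 * (11 / 10 * (real m / real N))}"
    and low: "\<And>I. smallest_set N (\<lambda>j. cmod (T A (0, j))) I \<Longrightarrow> card I = m \<Longrightarrow>
      \<not> low_energy D {1..<n} I (edge_level m (n - 1)) (T A)"
    and I: "I \<subseteq> {..<N}" "card I = m"
      "\<forall>i\<in>I. \<forall>j\<in>{..<N} - I. cmod (col_ip A n i x0) \<le> cmod (col_ip A n j x0)"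
    and x: "is_null_vec A n I x0 x"
  shows "edge_level m (n - 1) * outer_err n x0 x \<le> 22 / 10 * (real m * (real m / real N)) * (vnorm n x0) ^ 4"
proof -
  let ?X = "edge_level m (n - 1)"
  let ?t = "2 * (11 / 10 * (real m / real N))"
  define \<zeta> where "\<zeta> = V x0 0"
  define H where "H = T A"
  have n0: "0 \<in> {..<n}" using n by simp
  have split0: "(\<Sum>i\<in>{..<n}. f i) = f 0 + (\<Sum>i\<in>{1..<n}. f i)" for f :: "nat \<Rightarrow> 'b::comm_monoid_add"
  proof -
    have "{..<n} = insert 0 {1..<n}" using n by auto
    then show ?thesis by simp
  qed
  have \<rho>: "(vnorm n x0)\<^sup>2 = (cmod \<zeta>)\<^sup>2"
    unfolding vnorm_sq \<zeta>_def using gauss_unitary_norm[OF V(1), of x0]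
      sum_eq_single[OF finite_lessThan n0, of "\<lambda>i. (cmod (V x0 i))\<^sup>2"] V(2) by simp
  have \<rho>pos: "0 < vnorm n x0"
  proof -
    obtain i where "i < n" "x0 i \<noteq> 0" using x0 by blast
    then have "0 < (\<Sum>i<n. (cmod (x0 i))\<^sup>2)" by (intro sum_pos2[of _ i]) auto
    then show ?thesis by (simp add: vnorm_def)
  qed
  then have \<zeta>: "0 < cmod \<zeta>" using \<rho> by (metis norm_ge_zero order_le_less power2_eq_square mult_zero_left zero_less_power less_irrefl)
  have col: "col_ip A n j y = (\<Sum>i\<in>{..<n}. cnj (H (i, j)) * V y i)" if j: "j < N" for j y
  proof -
    have "col_ip A n j y = (\<Sum>i\<in>{..<n}. cnj (V (\<lambda>i. A (i, j)) i) * V y i)"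
      unfolding col_ip_def by (rule gauss_unitary_ip[OF V(1), symmetric])
    also have "\<dots> = (\<Sum>i\<in>{..<n}. cnj (H (i, j)) * V y i)"
      using T j by (intro sum.cong) (auto simp: H_def)
    finally show ?thesis .
  qed
  have col0: "cmod (col_ip A n j x0) = cmod (H (0, j)) * cmod \<zeta>" if "j < N" for j
    unfolding col[OF that] \<zeta>_def
    using sum_eq_single[OF finite_lessThan n0, of "\<lambda>i. cnj (H (i, j)) * V x0 i"] V(2) by (simp add: norm_mult)
  have fin: "finite I" using I(1) finite_subset by blast
  have sm: "smallest_set N (\<lambda>j. cmod (H (0, j))) I"
    unfolding smallest_set_def
  proof (intro conjI I(1) ballI)
    fix i j assume ij: "i \<in> I" "j \<in> {..<N} - I"
    then have "cmod (H (0, i)) * cmod \<zeta> \<le> cmod (H (0, j)) * cmod \<zeta>"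
      using I(1,3) col0 by (metis DiffD1 lessThan_iff subsetD)
    then show "cmod (H (0, i)) \<le> cmod (H (0, j))" using \<zeta> by simp
  qed
  have sq: "cmod (H (0, i)) \<le> sqrt ?t" if "i \<in> I" for i
  proof (rule smallest_set_le[OF sm _ that])
    have "(cmod (H (0, j)))\<^sup>2 \<le> ?t \<longleftrightarrow> cmod (H (0, j)) \<le> sqrt ?t" for j
      using real_le_rsqrt[of "cmod (H (0, j))" ?t] sqrt_ge_absD[of "cmod (H (0, j))" ?t] by auto
    then show "card I \<le> card {j\<in>{..<N}. cmod (H (0, j)) \<le> sqrt ?t}"
      using count I(2) by (simp add: H_def)
  qed
  \<comment> \<open>Each selected term is bounded by the threshold for the largest one; against the
    typical average this costs a factor slightly above 2.\<close>
  have e0: "sub_energy A n I x0 \<le> real m * ?t * (cmod \<zeta>)\<^sup>2"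
  proof -
    have "sub_energy A n I x0 \<le> (\<Sum>j\<in>I. ?t * (cmod \<zeta>)\<^sup>2)"
      unfolding sub_energy_def
    proof (rule sum_mono)
      fix j assume j: "j \<in> I"
      then have jN: "j < N" using I(1) by auto
      have "(cmod (H (0, j)))\<^sup>2 \<le> (sqrt ?t)\<^sup>2" using sq[OF j] by (intro power_mono) auto
      then have "(cmod (H (0, j)))\<^sup>2 \<le> ?t" by simp
      then show "(cmod (col_ip A n j x0))\<^sup>2 \<le> ?t * (cmod \<zeta>)\<^sup>2"
        unfolding col0[OF jN] power_mult_distrib by (rule mult_right_mono) simp
    qed
    also have "\<dots> = real m * ?t * (cmod \<zeta>)\<^sup>2" using I(2) by simp
    finally show ?thesis .
  qed
  have lb: "2 * ?X * (vnorm n z)\<^sup>2 \<le> sub_energy A n I z" if z: "(\<Sum>i<n. cnj (x0 i) * z i) = 0" for z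
  proof -
    have "cnj \<zeta> * V z 0 = (\<Sum>i\<in>{..<n}. cnj (V x0 i) * V z i)"
      unfolding \<zeta>_def using sum_eq_single[OF finite_lessThan n0, of "\<lambda>i. cnj (V x0 i) * V z i"] V(2) by simp
    also have "\<dots> = 0" unfolding gauss_unitary_ip[OF V(1)] by (rule z)
    finally have Vz: "V z 0 = 0" using \<zeta> by simp
    have "sub_energy A n I z = array_energy {1..<n} I H (V z)"
      unfolding sub_energy_def array_energy_def
    proof (rule sum.cong[OF refl])
      fix j assume "j \<in> I"
      then have "j < N" using I(1) by auto
      from col[OF this, of z] show "(cmod (col_ip A n j z))\<^sup>2 = (cmod (\<Sum>i\<in>{1..<n}. cnj (H (i, j)) * V z i))\<^sup>2"
        unfolding split0 Vz by simp
    qed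
    moreover have "(vnorm n z)\<^sup>2 = (\<Sum>i\<in>{1..<n}. (cmod (V z i))\<^sup>2)"
      unfolding vnorm_sq gauss_unitary_norm[OF V(1), of z, symmetric] split0 Vz by simp
    moreover have "2 * ?X * (\<Sum>i\<in>{1..<n}. (cmod (V z i))\<^sup>2) \<le> array_energy {1..<n} I H (V z)"
    proof (rule ccontr)
      assume "\<not> ?thesis"
      then have "array_energy {1..<n} I H (V z) < 2 * ?X * (\<Sum>i\<in>{1..<n}. (cmod (V z i))\<^sup>2)" by simp
      from array_energy_dense[OF _ D this] have "low_energy D {1..<n} I ?X H"
        unfolding low_energy_def by blast
      then show False using low[of I] sm I(2) unfolding H_def by blast
    qed
    ultimately show ?thesis by simp
  qed
  have "2 * ?X * outer_err n x0 x \<le> 2 * (vnorm n x0)\<^sup>2 * sub_energy A n I x0"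
    by (rule null_vec_outer_err_le[OF x \<rho>pos lb])
  also have "\<dots> \<le> 2 * (vnorm n x0)\<^sup>2 * (real m * ?t * (vnorm n x0)\<^sup>2)"
    using e0 unfolding \<rho> by (intro mult_left_mono) auto
  also have "\<dots> = 2 * (22 / 10 * (real m * (real m / real N)) * (vnorm n x0) ^ 4)"
    by (simp add: power2_eq_square power4_eq_xxxx)
  finally show ?thesis by simp
qed

section \<open>The error bound\<close>

lemma ln_le_two_sqrt:
  fixes y :: real
  assumes "0 < y"
  shows "ln y \<le> 2 * sqrt y"
proof -
  have "ln y = 2 * ln (sqrt y)" using assms by (simp add: ln_sqrt)
  moreover have "ln (sqrt y) \<le> sqrt y - 1" using assms by (intro ln_le_minus_one) simp
  ultimately show ?thesis by linarith
qed

text \<open>By ln y <= 2 sqrt y at y = N / m, the squared logarithm is at most 4 N / m, which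
  reduces m^2 / N to 4 m. With e^2 <= 9 the first argument of the minimum is of order t^2 m.\<close>

lemma deviation_exponent_le:
  fixes m N :: nat and t :: real
  assumes m: "0 < m" "m < N"
  shows "min (exp 1 ^ 2 * t\<^sup>2 / 16 * (ln (1 / (real m / real N)))\<^sup>2 * (real m)\<^sup>2 / real N) s \<le> 9 / 4 * t\<^sup>2 * real m"
proof -
  have N: "0 < real N" "0 < real m" using m by auto
  have L: "0 \<le> ln (real N / real m)" using m by (intro ln_ge_zero) auto
  have "(ln (real N / real m))\<^sup>2 \<le> (2 * sqrt (real N / real m))\<^sup>2"
    using L N by (intro power_mono ln_le_two_sqrt) auto
  also have "\<dots> = 4 * (real N / real m)" using N by (simp add: power_mult_distrib)
  finally have L2: "(ln (real N / real m))\<^sup>2 \<le> 4 * (real N / real m)" .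
  have e: "exp 1 ^ 2 \<le> (9 :: real)"
    using power_mono[OF exp_le, of 2] by simp
  have "exp 1 ^ 2 * t\<^sup>2 / 16 * (ln (1 / (real m / real N)))\<^sup>2 * (real m)\<^sup>2 / real N
      = (exp 1 ^ 2 * (ln (real N / real m))\<^sup>2) * (t\<^sup>2 / 16 * (real m)\<^sup>2 / real N)"
    by simp
  also have "\<dots> \<le> (9 * (4 * (real N / real m))) * (t\<^sup>2 / 16 * (real m)\<^sup>2 / real N)"
    using e L2 N by (intro mult_right_mono mult_mono) auto
  also have "\<dots> = 9 / 4 * t\<^sup>2 * real m" using N by (simp add: field_simps power2_eq_square)
  finally show ?thesis by (rule min.coboundedI1)
qed

text \<open>For \<open>m \<le> 2 * n\<close> the constraint on \<open>t\<close> makes the last error term at least as large as the failure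
  probability; for \<open>m > 2 * n\<close> the second error term is, unless \<open>m\<close> is bounded.\<close>
lemma failure_budget:
  fixes m n N :: nat and t \<epsilon> :: real
  assumes n: "0 < n" "n < m" "m < N" and \<sigma>: "real m / real N \<le> 1 / 2400"
    and \<epsilon>: "0 < \<epsilon>" "\<epsilon> < 1" and t: "0 < t" "t < 1 / sqrt (real n / real m) - 1"
    and S: "S \<le> 9 / 4 * t\<^sup>2 * real m"
  shows "exp (- (real m / 300)) + exp (- (real m - real (n - 1)) / 100)
      \<le> exp (- 2 * (real_of_int \<lfloor>real m * \<epsilon>\<rfloor>)\<^sup>2 / real N) + 2 * exp (- (1 / 10 ^ 7) * S)
    \<or> 1 \<le> 2 * exp (- (1 / 10 ^ 7) * S)"
proof -
  have nm: "0 < real n" "0 < real m" "real n < real m" "0 < real N" using n by auto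
  define p where "p = real m - real n + 1"
  have p: "real m - real (n - 1) = p" using n by (simp add: p_def of_nat_diff)
  have tm: "t + 1 < sqrt (real m / real n)" using t(2) by (simp add: real_sqrt_divide)
  consider "m \<le> 2 * n" | "2 * n < m" "400 \<le> m" | "2 * n < m" "m < 400" by linarith
  then show ?thesis
  proof cases
    case 1
    \<comment> \<open>The constraint on \<open>t\<close> gives 2 n t <= m - n, hence t <= 1 in this
      case, and S is at most 9/4 (m - n). After the factor 10^-7 the rate is below p / 300, so each
      of the two failure terms is at most exp (- S / 10^7).\<close>
    have "t * sqrt (real n) \<le> sqrt (real m) - sqrt (real n)"
      using tm nm by (simp add: real_sqrt_divide field_simps)
    moreover have "(sqrt (real m) - sqrt (real n)) * (2 * sqrt (real n)) \<le> real m - real n"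
    proof -
      have "(sqrt (real m) - sqrt (real n)) * (2 * sqrt (real n)) \<le> (sqrt (real m) - sqrt (real n)) * (sqrt (real m) + sqrt (real n))"
        using nm by (intro mult_left_mono) auto
      also have "\<dots> = real m - real n" by (simp add: algebra_simps)
      finally show ?thesis .
    qed
    ultimately have "t * sqrt (real n) * (2 * sqrt (real n)) \<le> real m - real n"
      by (smt (verit) mult_right_mono real_sqrt_ge_zero of_nat_0_le_iff)
    then have tn: "t * (2 * real n) \<le> real m - real n" by (simp add: mult.assoc mult.left_commute)
    have "9 / 4 * t\<^sup>2 * real m \<le> 9 / 4 * t\<^sup>2 * (2 * real n)"
      using 1 by (intro mult_left_mono) auto
    also have "\<dots> = 9 / 4 * (t * (t * (2 * real n)))" by (simp add: power2_eq_square)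
    also have "\<dots> \<le> 9 / 4 * (1 * (real m - real n))"
    proof -
      have "t * (2 * real n) \<le> 1 * (2 * real n)" using tn 1 nm by linarith
      then have "t \<le> 1" by (rule mult_right_le_imp_le) (use nm in simp)
      then show ?thesis using t tn nm by (intro mult_left_mono mult_mono) auto
    qed
    finally have "S \<le> 9 / 4 * (1 * (real m - real n))" by (rule order_trans[OF S])
    then have Sp: "1 / 10 ^ 7 * S \<le> p / 300" using nm by (simp add: p_def)
    have "exp (- (real m / 300)) \<le> exp (- (p / 300))" using nm n by (simp add: p_def)
    moreover have "0 \<le> p" using nm by (simp add: p_def)
    then have "exp (- p / 100) \<le> exp (- (p / 300))" by (subst exp_le_cancel_iff) linarith
    moreover have "exp (- (p / 300)) \<le> exp (- (1 / 10 ^ 7) * S)" using Sp by simp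
    ultimately show ?thesis unfolding p by (smt (verit) exp_ge_zero)
  next
    case 2
    have "real m / 2 \<le> p" using 2 by (simp add: p_def)
    then have "exp (- p / 100) \<le> exp (- (real m / 300))" by simp
    \<comment> \<open>Here 1/300 = 1/1200 + 1/400, and m >= 400 makes exp (m / 400) at least 2. The
      rate 1/1200 is what \<sigma> <= 1/2400 yields for the floor term, since 2 m^2 / N <= m /
      1200.\<close>
    moreover have "2 * exp (- (real m / 300)) \<le> exp (- (real m / 1200))"
    proof -
      have "2 \<le> exp (1::real)" using exp_ge_add_one_self[of 1] by simp
      also have "\<dots> \<le> exp (real m / 400)" using 2 by simp
      finally have "2 * exp (- (real m / 300)) \<le> exp (real m / 400) * exp (- (real m / 300))" by simp
      also have "\<dots> = exp (- (real m / 1200))" by (simp add: exp_add[symmetric])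
      finally show ?thesis .
    qed
    moreover have "exp (- (real m / 1200)) \<le> exp (- 2 * (real_of_int \<lfloor>real m * \<epsilon>\<rfloor>)\<^sup>2 / real N)"
    proof -
      have "0 \<le> real_of_int \<lfloor>real m * \<epsilon>\<rfloor>" using \<epsilon> by simp
      moreover have "real_of_int \<lfloor>real m * \<epsilon>\<rfloor> \<le> real m"
        using \<epsilon> nm by (meson dual_order.trans less_imp_le mult_left_le of_int_floor_le of_nat_0_le_iff)
      ultimately have "(real_of_int \<lfloor>real m * \<epsilon>\<rfloor>)\<^sup>2 \<le> (real m)\<^sup>2" by (intro power_mono) auto
      then have "2 * (real_of_int \<lfloor>real m * \<epsilon>\<rfloor>)\<^sup>2 / real N \<le> 2 * (real m)\<^sup>2 / real N"
        by (intro divide_right_mono) auto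
      also have "\<dots> = 2 * real m * (real m / real N)" by (simp add: power2_eq_square)
      also have "\<dots> \<le> 2 * real m * (1 / 2400)" using \<sigma> by (intro mult_left_mono) auto
      finally show ?thesis by simp
    qed
    ultimately show ?thesis unfolding p by (smt (verit) exp_ge_zero)
  next
    case 3
    \<comment> \<open>For bounded \<open>m\<close> the constraint bounds \<open>t\<close> and hence
      S; the constant 10^-7 is small enough to make the second alternative hold.\<close>
    have "t\<^sup>2 \<le> (sqrt (real m / real n))\<^sup>2" using tm t by (intro power_mono) auto
    also have "\<dots> = real m / real n" using nm by simp
    also have "\<dots> \<le> real m" using n by (simp add: divide_le_eq)
    also have "\<dots> \<le> 400" using 3 by simp
    finally have "t\<^sup>2 \<le> 400" .
    then have "t\<^sup>2 * real m \<le> 400 * 400" using 3 by (intro mult_mono) auto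
    then have "S \<le> 9 / 4 * (400 * 400)" using S by simp
    then have "1 / 2 \<le> - (1 / 10 ^ 7) * S + 1" by simp
    also have "\<dots> \<le> exp (- (1 / 10 ^ 7) * S)" using exp_ge_add_one_self[of "- (1 / 10 ^ 7) * S"] by simp
    finally show ?thesis by simp
  qed
qed

text \<open>Since 22/10 = 11/20 * 2 * 2, the edge bound yields the coefficient 2 \<sigma>, and the
  claimed coefficient is at least that for all admissible t, \<epsilon> and \<delta>.\<close>

lemma error_bound_from_edge_level:
  fixes m n N :: nat and t \<epsilon> \<delta> err \<rho> :: real
  assumes n: "0 < n" "n < m" "m < N" and \<epsilon>: "0 < \<epsilon>" "\<epsilon> < 1" and \<delta>: "0 < \<delta>"
    and t: "0 < t" "t < 1 / sqrt (real n / real m) - 1"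
    and err: "edge_level m (n - 1) * err \<le> 22 / 10 * (real m * (real m / real N)) * \<rho> ^ 4"
  shows "err \<le> (((2 + t) / (1 - \<epsilon>)) * (real m / real N) + \<epsilon> * (- 2 * ln (1 - real m / real N) + \<delta>)) *
    (2 * \<rho> ^ 4 / (1 - (1 + t) * sqrt (real n / real m))\<^sup>2)"
proof -
  have nm: "0 < real n" "0 < real m" "real n < real m" "0 < real N" "real m < real N" using n by auto
  define \<sigma> where "\<sigma> = real m / real N"
  define G where "G = 1 - (1 + t) * sqrt (real n / real m)"
  define C where "C = ((2 + t) / (1 - \<epsilon>)) * \<sigma> + \<epsilon> * (- 2 * ln (1 - \<sigma>) + \<delta>)"
  have \<sigma>: "0 < \<sigma>" "\<sigma> < 1" using nm by (auto simp: \<sigma>_def)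
  have q: "0 < sqrt (real n / real m)" using nm by simp
  have "(1 + t) * sqrt (real n / real m) < 1"
    using t(2) q by (simp add: field_simps)
  then have G: "0 < G" by (simp add: G_def)
  \<comment> \<open>The edge belongs to n - 1 rows and the claim to n; sqrt (n - 1) <= (1 + t) sqrt
    n covers the difference. Squaring is possible because \<open>G\<close> is positive.\<close>
  have GX: "11 / 20 * real m * G\<^sup>2 \<le> edge_level m (n - 1)"
  proof -
    have "sqrt (real m) * G = sqrt (real m) - (1 + t) * sqrt (real n)"
      using nm by (simp add: G_def real_sqrt_divide field_simps)
    also have "\<dots> \<le> sqrt (real m) - sqrt (real (n - 1))"
    proof -
      have "sqrt (real (n - 1)) \<le> 1 * sqrt (real n)" by simp
      also have "\<dots> \<le> (1 + t) * sqrt (real n)" using t by (intro mult_right_mono) auto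
      finally show ?thesis by simp
    qed
    finally have "(sqrt (real m) * G)\<^sup>2 \<le> (sqrt (real m) - sqrt (real (n - 1)))\<^sup>2"
      using G nm by (intro power_mono) auto
    then show ?thesis using nm by (simp add: edge_level_def power_mult_distrib)
  qed
  have C: "2 * \<sigma> \<le> C"
  proof -
    have "2 * 1 \<le> (2 + t) * (1 / (1 - \<epsilon>))" using \<epsilon> t by (intro mult_mono) auto
    then have "2 * \<sigma> \<le> ((2 + t) / (1 - \<epsilon>)) * \<sigma>" using \<sigma> by (intro mult_right_mono) auto
    moreover have "ln (1 - \<sigma>) \<le> 0" using \<sigma> by simp
    then have "0 \<le> \<epsilon> * (- 2 * ln (1 - \<sigma>) + \<delta>)"
      using \<epsilon> \<delta> by (intro mult_nonneg_nonneg) linarith+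
    ultimately show ?thesis by (simp add: C_def)
  qed
  have r4: "0 \<le> \<rho> ^ 4" by simp
  have "err \<le> C * (2 * \<rho> ^ 4 / G\<^sup>2)"
  proof (cases "err \<le> 0")
    case True
    moreover have "0 \<le> C * (2 * \<rho> ^ 4 / G\<^sup>2)" using C \<sigma> r4 by (intro mult_nonneg_nonneg) auto
    ultimately show ?thesis by linarith
  next
    case False
    then have "11 / 20 * real m * G\<^sup>2 * err \<le> edge_level m (n - 1) * err"
      using GX by (intro mult_right_mono) auto
    also have "\<dots> \<le> 22 / 10 * (real m * \<sigma>) * \<rho> ^ 4" using err by (simp add: \<sigma>_def)
    also have "\<dots> = 11 / 20 * real m * (2 * \<sigma> * (2 * \<rho> ^ 4))" by simp
    also have "\<dots> \<le> 11 / 20 * real m * (C * (2 * \<rho> ^ 4))"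
      using C r4 nm by (intro mult_left_mono mult_right_mono) auto
    finally have "11 / 20 * real m * (G\<^sup>2 * err) \<le> 11 / 20 * real m * (C * (2 * \<rho> ^ 4))" by simp
    then have "G\<^sup>2 * err \<le> C * (2 * \<rho> ^ 4)" using nm by (simp only: mult_le_cancel_left_pos)
    then show ?thesis using G by (simp add: field_simps)
  qed
  then show ?thesis by (simp only: C_def G_def \<sigma>_def)
qed

text \<open>The asymptotic condition on \<sigma> becomes a threshold \<open>\<sigma>0\<close> and a
  constant \<open>c\<close>, both uniform in all other parameters. The good event quantifies over
  uncountably many \<open>x\<close>, so the probability is stated for a measurable \<open>E\<close>
  inside it. On \<open>E\<close> the bound holds for every choice of \<open>I\<close> under ties and
  every minimizer at once.\<close>

theorem theorem1:
  shows "\<exists>c>0. \<exists>\<sigma>0>0. \<forall>(n::nat) (N::nat) (m::nat) (x0::nat \<Rightarrow> complex) (\<epsilon>::real) (\<delta>::real) (t::real).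
     0 < n \<longrightarrow> n < N \<longrightarrow> m < N \<longrightarrow> n < m \<longrightarrow> real m / real N \<le> \<sigma>0 \<longrightarrow>
     (\<exists>i<n. x0 i \<noteq> 0) \<longrightarrow> 0 < \<epsilon> \<longrightarrow> \<epsilon> < 1 \<longrightarrow> 0 < \<delta> \<longrightarrow>
     0 < t \<longrightarrow> t < 1 / sqrt (real n / real m) - 1 \<longrightarrow>
     (let \<sigma> = real m / real N; \<nu> = real n / real m in
      \<exists>E \<in> sets (gauss_mat n N).
        E \<subseteq> {A \<in> space (gauss_mat n N). \<forall>I x.
               I \<subseteq> {..<N} \<longrightarrow> card I = m \<longrightarrow>
               (\<forall>i\<in>I. \<forall>j\<in>{..<N} - I. cmod (col_ip A n i x0) \<le> cmod (col_ip A n j x0)) \<longrightarrow>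
               is_null_vec A n I x0 x \<longrightarrow>
               outer_err n x0 x \<le>
                 (((2 + t) / (1 - \<epsilon>)) * \<sigma> + \<epsilon> * (- 2 * ln (1 - \<sigma>) + \<delta>)) *
                 (2 * (vnorm n x0)^4 / (1 - (1 + t) * sqrt \<nu>)^2)} \<and>
        measure (gauss_mat n N) E \<ge>
          1 - 2 * exp (- real N * \<delta>^2 * exp (- \<delta>) * \<bar>1 - \<sigma>\<bar>^2 / 2)
            - exp (- 2 * (real_of_int \<lfloor>real m * \<epsilon>\<rfloor>)^2 / real N)
            - 2 * exp (- c * min (exp 1 ^ 2 * t^2 / 16 * (ln (1 / \<sigma>))^2 * (real m)^2 / real N)
                                 (exp 1 * t / 4 * real m * ln (1 / \<sigma>))))"
proof -
  have main: "\<exists>E \<in> sets (gauss_mat n N).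
        E \<subseteq> {A \<in> space (gauss_mat n N). \<forall>I x.
               I \<subseteq> {..<N} \<longrightarrow> card I = m \<longrightarrow>
               (\<forall>i\<in>I. \<forall>j\<in>{..<N} - I. cmod (col_ip A n i x0) \<le> cmod (col_ip A n j x0)) \<longrightarrow>
               is_null_vec A n I x0 x \<longrightarrow>
               outer_err n x0 x \<le>
                 (((2 + t) / (1 - \<epsilon>)) * (real m / real N) + \<epsilon> * (- 2 * ln (1 - real m / real N) + \<delta>)) *
                 (2 * (vnorm n x0)^4 / (1 - (1 + t) * sqrt (real n / real m))^2)} \<and>
        measure (gauss_mat n N) E \<ge>
          1 - 2 * exp (- real N * \<delta>^2 * exp (- \<delta>) * \<bar>1 - real m / real N\<bar>^2 / 2)
            - exp (- 2 * (real_of_int \<lfloor>real m * \<epsilon>\<rfloor>)^2 / real N)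
            - 2 * exp (- (1 / 10 ^ 7) * min (exp 1 ^ 2 * t^2 / 16 * (ln (1 / (real m / real N)))^2 * (real m)^2 / real N)
                                 (exp 1 * t / 4 * real m * ln (1 / (real m / real N))))"
      (is "\<exists>E\<in>_. _ \<subseteq> ?good \<and> 1 - 2 * exp ?P1 - exp ?P2 - 2 * exp (- (1 / 10 ^ 7) * ?S) \<le> _")
    if n: "0 < n" "n < m" "m < N" and \<sigma>: "real m / real N \<le> 1 / 2400" and x0: "\<exists>i<n. x0 i \<noteq> 0"
      and \<epsilon>: "0 < \<epsilon>" "\<epsilon> < 1" and \<delta>: "0 < \<delta>" and t: "0 < t" "t < 1 / sqrt (real n / real m) - 1"
    for n N m :: nat and x0 :: "nat \<Rightarrow> complex" and \<epsilon> \<delta> t :: real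
  proof -
    have S: "?S \<le> 9 / 4 * t\<^sup>2 * real m" by (rule deviation_exponent_le) (use n in auto)
    show ?thesis
    proof (cases "1 \<le> 2 * exp (- (1 / 10 ^ 7) * ?S)")
      case True
      \<comment> \<open>Here the claimed lower bound on the probability is nonpositive, so the empty
        event suffices.\<close>
      then have "1 - 2 * exp ?P1 - exp ?P2 - 2 * exp (- (1 / 10 ^ 7) * ?S) \<le> 0"
        using exp_ge_zero[of ?P1] exp_ge_zero[of ?P2] by linarith
      then show ?thesis by (intro bexI[of _ "{}"]) auto
    next
      case False
      obtain D :: "complex set" where D: "countable D" "\<And>X. open X \<Longrightarrow> X \<noteq> {} \<Longrightarrow> \<exists>d\<in>D. d \<in> X"
        by (rule countable_dense_setE) blast
      obtain V where V: "gauss_unitary {..<n} V" "\<And>i. i \<in> {..<n} \<Longrightarrow> i \<noteq> 0 \<Longrightarrow> V x0 i = 0"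
        by (rule gauss_unitary_to_axis[of "{..<n}" 0 x0]) (use n in auto)
      let ?M = "gauss_PiM ({..<n} \<times> {..<N})"
      have M: "gauss_mat n N = ?M" by (simp add: gauss_mat_def)
      obtain T where T: "measure_preserving_map ?M T"
        "\<forall>A. \<forall>i\<in>{..<n}. \<forall>j\<in>{..<N}. T A (i, j) = V (\<lambda>i. A (i, j)) i"
        using gauss_unitary_columns[OF V(1) finite_lessThan finite_lessThan[of N]] by blast
      have \<sigma>': "real m / real N \<le> 1 / 100" using \<sigma> by linarith
      obtain E where E: "E \<in> sets ?M"
        "1 - exp (- (real m / 300)) - exp (- (real m - real (n - 1)) / 100) \<le> measure ?M E"
        "\<And>H. H \<in> E \<Longrightarrow> m \<le> card {j\<in>{..<N}. (cmod (H (0, j)))\<^sup>2 \<le> 2 * (11 / 10 * (real m / real N))}"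
        "\<And>H I. H \<in> E \<Longrightarrow> smallest_set N (\<lambda>j. cmod (H (0, j))) I \<Longrightarrow> card I = m \<Longrightarrow>
          \<not> low_energy D {1..<n} I (edge_level m (n - 1)) H"
        by (rule good_event[OF n \<sigma>' D(1)]) (assumption | blast)+
      \<comment> \<open>\<open>E\<close> refers to coordinates in which \<open>x0\<close> lies on
        the first axis; pulling it back along \<open>T\<close> keeps its probability.\<close>
      define E' where "E' = T -` E \<inter> space ?M"
      have "E' \<in> sets ?M"
        unfolding E'_def by (rule measurable_sets[OF measure_preserving_map_measurable[OF T(1)] E(1)])
      moreover have "E' \<subseteq> ?good"
      proof -
        have "outer_err n x0 x \<le>
                 (((2 + t) / (1 - \<epsilon>)) * (real m / real N) + \<epsilon> * (- 2 * ln (1 - real m / real N) + \<delta>)) *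
                 (2 * (vnorm n x0)^4 / (1 - (1 + t) * sqrt (real n / real m))^2)"
          if A: "A \<in> E'" and I: "I \<subseteq> {..<N}" "card I = m"
            "\<forall>i\<in>I. \<forall>j\<in>{..<N} - I. cmod (col_ip A n i x0) \<le> cmod (col_ip A n j x0)"
            and x: "is_null_vec A n I x0 x" for A I x
        proof -
          have TA: "T A \<in> E" using A by (simp add: E'_def)
          show ?thesis
            by (rule error_bound_from_edge_level[OF n \<epsilon> \<delta> t])
              (rule null_vec_error_on_good_event[OF n D(2) x0 V T(2) E(3)[OF TA] E(4)[OF TA] I x])
        qed
        then show ?thesis by (auto simp: E'_def M)
      qed
      moreover have "measure ?M E' = measure ?M E"
        using measure_preserving_map_emeasure[OF T(1) E(1)] by (simp add: E'_def measure_def)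
      moreover have "1 - 2 * exp ?P1 - exp ?P2 - 2 * exp (- (1 / 10 ^ 7) * ?S) \<le> measure ?M E"
        using failure_budget[OF n \<sigma> \<epsilon> t S] False E(2) exp_ge_zero[of ?P1] by linarith
      ultimately show ?thesis unfolding M by (intro bexI[of _ E'] conjI) simp_all
    qed
  qed
  show ?thesis
    unfolding Let_def
    by (rule exI[of _ "1 / 10 ^ 7"], rule conjI, simp, rule exI[of _ "1 / 2400"], rule conjI, simp,
        intro allI impI, rule main) assumption+
qed

end
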